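(* Let $0<q<1$, let $r$ be a positive integer and $n$ an integer such that $n\ge r$. Then $$\sum_{k_1,\dots,k_r=-n}^n\ \prod_{1\le i<j\le r}\big|[k_i-k_j]_q\,[k_i+k_j]_q\big|\ \prod_{i=1}^r[k_i]_q^2\,q^{(k_i-r+i-1)^2/2}\begin{bmatrix}2n\\ n+k_i\end{bmatrix}_q$$ $$=2^r\,\frac{r!}{[r]_q!}\cdot\frac{(-1;q^{1/2})_{r+1}\,(-q^{r/2+1};q)_{n-r}}{(-1;q)_{n-r}}\ \prod_{i=1}^{r+1}\frac{(-q^{1/2};q^{1/2})_{i-1}\,(-q^{1/2};q^{1/2})_{2n-i-r}}{(-q^{1/2};q^{1/2})_{2n-2i+2}}$$ $$\times\prod_{i=1}^r\frac{\Gamma_q(1+\frac12 i)^2}{\Gamma_q(\frac12)}\cdot\frac{\Gamma_q(2n+1)\,\Gamma_q(n-i+\frac32)}{\Gamma_q(n-i+1)\,\Gamma_q(n-\frac12 i+1)^2}.$$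
   Context: Notation: $(a;q)_\infty=\prod_{k\ge1}(1-aq^{k-1})$, $(a;q)_k=(a;q)_\infty/(aq^k;q)_\infty$ for any integer $k$ (so $(a;q)_{-1}=1/(1-aq^{-1})$), and likewise with base $q^{1/2}$; $\begin{bmatrix}N\\ M\end{bmatrix}_q=\frac{(q;q)_N}{(q;q)_M(q;q)_{N-M}}$ for integers $0\le M\le N$; $[x]_q=\frac{1-q^x}{1-q}$; $[r]_q!=[1]_q[2]_q\cdots[r]_q$; $\Gamma_q(x)=(1-q)^{1-x}\frac{(q;q)_\infty}{(q^x;q)_\infty}$. *)

theory Defs
  imports "HOL-Analysis.Analysis"
begin

definition q_poch_inf :: "real \<Rightarrow> real \<Rightarrow> real"
  where "q_poch_inf a q = (\<Prod>k. 1 - a * q ^ k)"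

(* Integer index: k may be negative, e.g. (a;q)_{-1} = 1 / (1 - a/q). *)
definition q_poch :: "real \<Rightarrow> real \<Rightarrow> int \<Rightarrow> real"
  where "q_poch a q k = q_poch_inf a q / q_poch_inf (a * q powi k) q"

(* Meant for integers 0 <= M <= N. *)
definition q_binomial :: "real \<Rightarrow> int \<Rightarrow> int \<Rightarrow> real"
  where "q_binomial q N M = q_poch q q N / (q_poch q q M * q_poch q q (N - M))"

definition q_number :: "real \<Rightarrow> real \<Rightarrow> real"
  where "q_number q x = (1 - q powr x) / (1 - q)"

definition q_fact :: "real \<Rightarrow> nat \<Rightarrow> real"
  where "q_fact q r = (\<Prod>i=1..r. q_number q (real i))"

definition q_Gamma :: "real \<Rightarrow> real \<Rightarrow> real"
  where "q_Gamma q x = (1 - q) powr (1 - x) * (q_poch_inf q q / q_poch_inf (q powr x) q)"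

end

theory Submission
  imports Defs "HOL-Computational_Algebra.Polynomial" "HOL-Combinatorics.Multiset_Permutations"
begin

text \<open>
  Write \<open>h = q^(1/2)\<close>, \<open>g = q^(1/4)\<close>, \<open>x_k = q^k + q^(-k)\<close>, \<open>y_k = h^k + h^(-k)\<close>. The factor
  \<open>[a - b] [a + b]\<close> is \<open>q^a (x_a - x_b) / (1 - q)^2\<close>, and the powers of \<open>q\<close> so released make
  every summand an even function of each \<open>k_i\<close> that vanishes when some \<open>k_i\<close> is 0. Hence the left-hand
  side is a constant times \<open>2^r r!\<close> times the sum, over the \<open>r\<close>-element subsets \<open>A\<close> of
  \<open>N = {1..n}\<close>, of the Vandermonde product \<open>V(A)\<close> in the \<open>x_a\<close> times weights \<open>w(a)\<close>
  (lemma \<open>lhs_eq_subset_sum\<close>).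

  The weights are the point of the problem: up to one constant, \<open>w(a)\<close> is
  \<open>1 / (y_a * prod of |x_a - x_b| over b in N - {a})\<close>. Since
  \<open>V(A) / (product of these rows) = V(N - A) / V(N)\<close>, passing to the complement \<open>L = N - A\<close> leaves the
  unweighted sum of \<open>V(L) * prod y_l\<close> over the subsets \<open>L\<close> with \<open>m = n - r\<close> elements
  (lemma \<open>subset_sum_evaluation\<close>). As \<open>x_l = y_l^2 - 2\<close>, the summand is the alternant
  \<open>det (xi_j^(2 l) + xi_j^(- 2 l))\<close> at the nodes \<open>xi_j = g^(2 j - 1)\<close>. So the task is to sum all
  maximal minors of a matrix whose rows are the functions \<open>f_l = xi^(2 l) + xi^(- 2 l)\<close>.

  This is done for arbitrary distinct nodes between 0 and 1. In the exterior algebra the sum of the minors is the component of degree \<open>m\<close>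
  of the ordered product of the \<open>1 + f_l\<close>. Its even part is governed by a two-form \<open>Q\<close> and its odd part
  by the one-form \<open>c = f_1 + ... + f_n\<close>, as for a Pfaffian. For these rows \<open>Q\<close> has the closed form
  \<open>\<kappa> \<kappa>' (\<alpha> \<beta>' - \<beta> \<alpha>') (\<gamma> \<delta>' - \<delta> \<gamma>') / (X - X')\<close> in the variable
  \<open>X = xi^2 + xi^(-2)\<close>, and Pfaffians of this type (Okada) factor into two determinants divided by a
  Vandermonde product. The proof of that factorization, lemma \<open>pfaffian_core\<close>, expands along one row
  and reduces to the identity \<open>bilinear_moments\<close>, which is nothing but partial fractions: cofactors
  are orthogonal to many powers of \<open>X\<close>, so they are values of polynomials of low degree. The outcome
  is \<open>subset_form_product\<close>: up to simple factors, the sum of the minors times a Vandermonde product equals a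
  product of two alternants with exponents in arithmetic progression. At the nodes \<open>g^(2 j - 1)\<close> these alternants become, after transposition,
  Vandermonde products themselves, so the sum is an explicit product.

  It remains to recognize this product in the Gamma functions on the right. Both sides satisfy the same
  first-order recurrence in \<open>m\<close> for fixed \<open>r\<close>, and for \<open>m = 0\<close> a common recurrence in \<open>r\<close>; the only
  facts about the q-Gamma function needed are its functional equation and the resulting duplication formula.
\<close>

section \<open>Alternating functions of lists\<close>

text \<open>A function \<open>G\<close> of lists collects one alternating form for each degree, the degree being the length
  of the list. \<open>wedge v G\<close> is the exterior product of the one-form \<open>v\<close> with \<open>G\<close>, i.e. the Laplace
  expansion of a determinant along the row of \<open>v\<close>. The recursion on the first argument is the rule
  that contraction with a point is an antiderivation; it makes most identities below inductions on the list.\<close>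

fun wedge :: "('a \<Rightarrow> real) \<Rightarrow> ('a list \<Rightarrow> real) \<Rightarrow> 'a list \<Rightarrow> real" where
  "wedge v G [] = 0"
| "wedge v G (y # xs) = v y * G xs - wedge v (\<lambda>zs. G (y # zs)) xs"

definition unit_form :: "'a list \<Rightarrow> real" where
  "unit_form xs = (if xs = [] then 1 else 0)"

lemma unit_form_simps [simp]: "unit_form [] = 1" "unit_form (x # xs) = 0"
  by (simp_all add: unit_form_def)

lemma wedge_cong:
  assumes "\<And>x. x \<in> set xs \<Longrightarrow> v x = w x"
    and "\<And>zs. Suc (length zs) = length xs \<Longrightarrow> set zs \<subseteq> set xs \<Longrightarrow> G zs = H zs"
  shows "wedge v G xs = wedge w H xs"
  using assms
proof (induction xs arbitrary: G H)
  case (Cons y xs)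
  have "wedge v (\<lambda>zs. G (y # zs)) xs = wedge w (\<lambda>zs. H (y # zs)) xs"
    by (intro Cons.IH Cons.prems) auto
  moreover have "G xs = H xs" using Cons.prems(2) by auto
  ultimately show ?case using Cons.prems(1) by simp
qed simp

lemma wedge_add_left: "wedge (\<lambda>x. u x + v x) G xs = wedge u G xs + wedge v G xs"
  by (induction xs arbitrary: G) (auto simp: algebra_simps)

lemma wedge_scale_left: "wedge (\<lambda>x. c * v x) G xs = c * wedge v G xs"
  by (induction xs arbitrary: G) (auto simp: algebra_simps)

lemma wedge_zero_left [simp]: "wedge (\<lambda>x. 0) G xs = 0"
  by (induction xs arbitrary: G) auto

lemma wedge_sum_left: "wedge (\<lambda>x. \<Sum>i\<in>I. f i x) G xs = (\<Sum>i\<in>I. wedge (f i) G xs)"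
  by (induction I rule: infinite_finite_induct) (auto simp: wedge_add_left)

lemma wedge_add_right: "wedge v (\<lambda>zs. G zs + H zs) xs = wedge v G xs + wedge v H xs"
  by (induction xs arbitrary: G H) (auto simp: algebra_simps)

lemma wedge_diff_right: "wedge v (\<lambda>zs. G zs - H zs) xs = wedge v G xs - wedge v H xs"
  by (induction xs arbitrary: G H) (auto simp: algebra_simps)

lemma wedge_scale_right: "wedge v (\<lambda>zs. c * G zs) xs = c * wedge v G xs"
  by (induction xs arbitrary: G) (auto simp: algebra_simps)

lemma wedge_neg_right: "wedge v (\<lambda>zs. - G zs) xs = - wedge v G xs"
  using wedge_scale_right[of v "-1"] by simp

lemma wedge_zero_right [simp]: "wedge v (\<lambda>zs. 0) xs = 0"
  by (induction xs) auto

lemma wedge_scale_form: "wedge v (\<lambda>zs. c * G zs) = (\<lambda>xs. c * wedge v G xs)"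
  using wedge_scale_right by blast

lemma wedge_zero_form [simp]: "wedge v (\<lambda>zs. 0) = (\<lambda>zs. 0)"
  by auto

lemma wedge_sum_right: "wedge v (\<lambda>zs. \<Sum>i\<in>I. G i zs) xs = (\<Sum>i\<in>I. wedge v (G i) xs)"
  by (induction I rule: infinite_finite_induct) (auto simp: wedge_add_right)

text \<open>All sign bookkeeping of determinants is contained in this law.\<close>

lemma wedge_anticommute: "wedge u (wedge v G) xs = - wedge v (wedge u G) xs"
proof (induction xs arbitrary: G)
  case (Cons y xs)
  have "wedge u (wedge v G) (y # xs)
      = u y * wedge v G xs - (v y * wedge u G xs - wedge u (wedge v (\<lambda>zs. G (y # zs))) xs)" for u v
    by (simp add: wedge_diff_right wedge_scale_right)
  from this[of u v] this[of v u] Cons.IH[of "\<lambda>zs. G (y # zs)"]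
  show ?case by linarith
qed simp

lemma wedge_self [simp]: "wedge v (wedge v G) xs = 0"
  using wedge_anticommute[of v v G xs] by simp

lemma wedge_self_inner: "wedge v (wedge u (wedge v G)) xs = 0"
proof -
  have "wedge u (wedge v G) = (\<lambda>zs. - wedge v (wedge u G) zs)"
    using wedge_anticommute[of u v G] by auto
  then show ?thesis by (simp add: wedge_neg_right)
qed

lemma wedge_expand:
  "wedge v G xs = (\<Sum>j<length xs. (-1) ^ j * v (xs ! j) * G (take j xs @ drop (Suc j) xs))"
proof (induction xs arbitrary: G)
  case (Cons y xs)
  show ?case
    by (simp add: Cons.IH sum.lessThan_Suc_shift sum_negf[symmetric] del: sum.lessThan_Suc)
qed simp

text \<open>Multiplying every one-form by the same function \<open>k\<close> multiplies each column of the
  determinant by the value of \<open>k\<close> at its node.\<close>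

lemma wedge_scale_nodes:
  "wedge (\<lambda>x. k x * v x) (\<lambda>zs. prod_list (map k zs) * G zs) xs
     = prod_list (map k xs) * wedge v G xs"
proof (induction xs arbitrary: G)
  case (Cons y xs)
  have "wedge (\<lambda>x. k x * v x) (\<lambda>zs. k y * prod_list (map k zs) * G (y # zs)) xs
      = k y * wedge (\<lambda>x. k x * v x) (\<lambda>zs. prod_list (map k zs) * G (y # zs)) xs"
    by (simp only: wedge_scale_right mult.assoc)
  then show ?case
    unfolding wedge.simps list.map prod_list.Cons Cons.IH by algebra
qed simp

text \<open>\<open>alternant fs xs\<close> is the determinant of the matrix \<open>f_i (x_j)\<close>; it is 0 unless the matrix is square.\<close>

definition alternant :: "('a \<Rightarrow> real) list \<Rightarrow> 'a list \<Rightarrow> real" where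
  "alternant fs = foldr wedge fs unit_form"

lemma alternant_Nil [simp]: "alternant [] = unit_form"
  by (simp add: alternant_def)

lemma alternant_Cons [simp]: "alternant (f # fs) = wedge f (alternant fs)"
  by (simp add: alternant_def)

lemma alternant_length_neq: "length fs \<noteq> length xs \<Longrightarrow> alternant fs xs = 0"
proof (induction fs arbitrary: xs)
  case Nil
  then show ?case by (cases xs) auto
next
  case (Cons f fs)
  have "wedge f (alternant fs) xs = wedge f (\<lambda>_. 0) xs"
    by (rule wedge_cong) (use Cons in auto)
  then show ?case by simp
qed

lemma alternant_move_last:
  "alternant (fs @ [g]) xs = (-1) ^ length fs * alternant (g # fs) xs"
proof (induction fs arbitrary: xs)
  case (Cons f fs)
  have "alternant (fs @ [g]) = (\<lambda>zs. (-1) ^ length fs * alternant (g # fs) zs)"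
    using Cons.IH by auto
  then show ?case
    by (simp add: wedge_scale_right wedge_anticommute[of f g])
qed simp

text \<open>Laplace expansion along a row and along a column commute, being a double sum.\<close>

lemma wedge_swap:
  "wedge u (\<lambda>zs. wedge v (\<lambda>ws. H zs ws) ys) xs = wedge v (\<lambda>ws. wedge u (\<lambda>zs. H zs ws) xs) ys"
proof (induction xs arbitrary: H)
  case (Cons x xs)
  show ?case
    by (simp add: Cons.IH wedge_diff_right wedge_scale_right)
qed simp

lemma alternant_transpose:
  fixes K :: "'e \<Rightarrow> 'a \<Rightarrow> real"
  assumes "length es = length xs"
  shows "alternant (map K es) xs = alternant (map (\<lambda>x e. K e x) xs) es"
  using assms
proof (induction "length xs" arbitrary: es xs rule: less_induct)
  case less
  show ?case
  proof (cases xs)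
    case Nil
    then show ?thesis using less.prems by simp
  next
    case (Cons y ys)
    then obtain f fs where es: "es = f # fs" "length fs = length ys"
      using less.prems by (cases es) auto
    let ?T = "\<lambda>zs. alternant (map (\<lambda>x e. K e x) zs)"
    let ?A = "\<lambda>gs. alternant (map K gs)"
    have IH: "?A gs zs = ?T zs gs" if "length gs = length zs" "length zs \<le> length ys" for gs zs
      by (rule less.hyps) (use that Cons in simp_all)
    have "wedge (K f) (\<lambda>zs. ?A fs (y # zs)) ys = wedge (K f) (\<lambda>zs. ?T (y # zs) fs) ys"
      by (intro wedge_cong IH) (use es in simp_all)
    also have "\<dots> = wedge (\<lambda>e. K e y) (\<lambda>gs. wedge (K f) (\<lambda>zs. ?T zs gs) ys) fs"
      by (simp only: list.map alternant_Cons) (rule wedge_swap)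
    also have "\<dots> = wedge (\<lambda>e. K e y) (\<lambda>gs. wedge (K f) (\<lambda>zs. ?A gs zs) ys) fs"
    proof (rule wedge_cong)
      fix gs :: "'e list"
      assume gs: "Suc (length gs) = length fs"
      show "wedge (K f) (\<lambda>zs. ?T zs gs) ys = wedge (K f) (\<lambda>zs. ?A gs zs) ys"
        by (intro wedge_cong IH[symmetric]) (use es gs in simp_all)
    qed simp
    also have "\<dots> = wedge (\<lambda>e. K e y) (\<lambda>gs. ?A (f # gs) ys) fs"
      by simp
    also have "\<dots> = wedge (\<lambda>e. K e y) (\<lambda>gs. ?T ys (f # gs)) fs"
      by (intro wedge_cong IH) (use es in simp_all)
    finally have *: "wedge (K f) (\<lambda>zs. ?A fs (y # zs)) ys
        = wedge (\<lambda>e. K e y) (\<lambda>gs. ?T ys (f # gs)) fs" .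
    have "?A es xs = K f y * ?A fs ys - wedge (K f) (\<lambda>zs. ?A fs (y # zs)) ys"
      by (simp add: Cons es)
    also have "\<dots> = K f y * ?T ys fs - wedge (\<lambda>e. K e y) (\<lambda>gs. ?T ys (f # gs)) fs"
      using * IH[of fs ys] es by simp
    also have "\<dots> = ?T xs es"
      by (simp add: Cons es)
    finally show ?thesis .
  qed
qed

section \<open>Vandermonde products\<close>

text \<open>The sign convention is \<open>earlier minus later\<close>, so that decreasing lists give positive values.\<close>

fun vander :: "real list \<Rightarrow> real" where
  "vander [] = 1"
| "vander (x # xs) = (\<Prod>y\<leftarrow>xs. x - y) * vander xs"

text \<open>The determinant of the \<open>\<mu> X^i\<close>, \<open>i < k\<close>, with the highest power in front: then the powers that may
  be subtracted from a row without changing the determinant are the ones already present.\<close>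

fun power_form :: "('a \<Rightarrow> real) \<Rightarrow> ('a \<Rightarrow> real) \<Rightarrow> nat \<Rightarrow> 'a list \<Rightarrow> real" where
  "power_form X \<mu> 0 = unit_form"
| "power_form X \<mu> (Suc k) = wedge (\<lambda>x. \<mu> x * X x ^ k) (power_form X \<mu> k)"

lemma wedge_low_power_form: "i < k \<Longrightarrow> wedge (\<lambda>x. \<mu> x * X x ^ i) (power_form X \<mu> k) xs = 0"
proof (induction k arbitrary: xs)
  case (Suc k)
  show ?case
  proof (cases "i = k")
    case False
    then have *: "wedge (\<lambda>x. \<mu> x * X x ^ i) (power_form X \<mu> k) = (\<lambda>xs. 0)"
      using Suc by auto
    show ?thesis
      by (simp add: wedge_anticommute[of "\<lambda>x. \<mu> x * X x ^ i"] *)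
  qed simp
qed simp

lemma wedge_monic_power_form:
  assumes "degree p = k" "lead_coeff p = 1"
  shows "wedge (\<lambda>x. \<mu> x * poly p (X x)) (power_form X \<mu> k) xs = power_form X \<mu> (Suc k) xs"
proof -
  have "(\<lambda>x. \<mu> x * poly p (X x))
      = (\<lambda>x. \<mu> x * X x ^ k + (\<Sum>i<k. coeff p i * (\<mu> x * X x ^ i)))"
    using assms by (simp add: poly_altdef lessThan_Suc_atMost[symmetric] sum_distrib_left algebra_simps)
  then show ?thesis
    by (simp add: wedge_add_left wedge_sum_left wedge_scale_left wedge_low_power_form)
qed

text \<open>Row operations: each \<open>X^(i + 1)\<close> is replaced by \<open>(X - w) X^i\<close>. With \<open>w\<close> the value at
  one node, only the form \<open>\<mu>\<close> survives at that node, which is the induction step for Vandermonde's determinant.\<close>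

lemma power_form_shift:
  "power_form X \<mu> (Suc k) xs
     = (-1) ^ k * wedge \<mu> (power_form X (\<lambda>x. (X x - w) * \<mu> x) k) xs"
proof (induction k arbitrary: xs)
  case (Suc k)
  let ?P = "power_form X (\<lambda>x. (X x - w) * \<mu> x)"
  have *: "(\<lambda>x. \<mu> x * X x ^ Suc k) = (\<lambda>x. (X x - w) * \<mu> x * X x ^ k + w * (\<mu> x * X x ^ k))"
    by (auto simp: algebra_simps)
  have IH: "power_form X \<mu> (Suc k) = (\<lambda>xs. (-1) ^ k * wedge \<mu> (?P k) xs)"
    using Suc.IH by auto
  let ?u = "\<lambda>x. (X x - w) * \<mu> x * X x ^ k"
  have "power_form X \<mu> (Suc (Suc k)) xs = wedge (\<lambda>x. \<mu> x * X x ^ Suc k) (power_form X \<mu> (Suc k)) xs"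
    by (rule fun_cong[OF power_form.simps(2)])
  also have "\<dots> = wedge ?u (power_form X \<mu> (Suc k)) xs"
    unfolding * wedge_add_left[of ?u] wedge_scale_left
    by (simp only: wedge_low_power_form[OF lessI] mult_zero_right add_0_right)
  also have "\<dots> = (-1) ^ k * wedge ?u (wedge \<mu> (?P k)) xs"
    unfolding IH wedge_scale_right ..
  also have "wedge ?u (wedge \<mu> (?P k)) xs = - wedge \<mu> (?P (Suc k)) xs"
    unfolding power_form.simps(2) by (rule wedge_anticommute)
  finally show ?case by simp
qed simp

lemma power_form_vanish: "\<mu> y = 0 \<Longrightarrow> power_form X \<mu> k (y # zs) = 0"
  by (induction k arbitrary: zs) auto

lemma power_form_scale:
  "power_form X (\<lambda>x. c x * \<mu> x) k xs = prod_list (map c xs) * power_form X \<mu> k xs"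
proof (induction k arbitrary: xs)
  case 0
  then show ?case by (cases xs) auto
next
  case (Suc k)
  have "power_form X (\<lambda>x. c x * \<mu> x) k = (\<lambda>xs. prod_list (map c xs) * power_form X \<mu> k xs)"
    using Suc by auto
  then show ?case by (simp add: wedge_scale_nodes mult.assoc)
qed

lemma prod_list_uminus: "(-1) ^ length xs * (\<Prod>x\<leftarrow>xs. f x - c) = (\<Prod>x\<leftarrow>xs. c - (f x :: real))"
proof (induction xs)
  case (Cons y xs)
  have "(-1) ^ length (y # xs) * (\<Prod>x\<leftarrow>y # xs. f x - c)
      = (c - f y) * ((-1) ^ length xs * (\<Prod>x\<leftarrow>xs. f x - c))"
    by (simp only: list.map prod_list.Cons length_Cons power_Suc) algebra
  then show ?case by (simp only: Cons.IH list.map prod_list.Cons)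
qed simp

lemma power_form_eq_vander:
  assumes "length xs = k"
  shows "power_form X \<mu> k xs = (\<Prod>x\<leftarrow>xs. \<mu> x) * vander (map X xs)"
  using assms
proof (induction xs arbitrary: k)
  case (Cons y xs)
  then obtain l where l: "k = Suc l" "length xs = l" by auto
  let ?P = "power_form X (\<lambda>x. (X x - X y) * \<mu> x)"
  have "power_form X \<mu> k (y # xs) = (-1) ^ l * wedge \<mu> (?P l) (y # xs)"
    unfolding l by (rule power_form_shift)
  also have "wedge \<mu> (?P l) (y # xs) = \<mu> y * ?P l xs"
    by (simp add: power_form_vanish)
  also have "?P l xs = (\<Prod>x\<leftarrow>xs. X x - X y) * power_form X \<mu> l xs"
    by (rule power_form_scale)
  finally have "power_form X \<mu> k (y # xs)
     = \<mu> y * ((-1) ^ length xs * (\<Prod>x\<leftarrow>xs. X x - X y)) * power_form X \<mu> l xs"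
    using l by simp
  then have "power_form X \<mu> k (y # xs)
     = \<mu> y * (\<Prod>x\<leftarrow>xs. X y - X x) * ((\<Prod>x\<leftarrow>xs. \<mu> x) * vander (map X xs))"
    unfolding prod_list_uminus using Cons.IH l by (simp only:)
  then show ?case by (simp add: comp_def del: power_form.simps(2))
qed simp

section \<open>The sum of all minors as an exterior product\<close>

text \<open>The ordered exterior product of the \<open>1 + f_l\<close> for \<open>l = 1..n\<close>. Its component of degree \<open>m\<close> is the sum of
  all \<open>m\<close>-rowed minors, see \<open>subset_form_eq_sum\<close>.\<close>

fun subset_form :: "(nat \<Rightarrow> 'a \<Rightarrow> real) \<Rightarrow> nat \<Rightarrow> 'a list \<Rightarrow> real" where
  "subset_form f 0 = unit_form"
| "subset_form f (Suc n) = (\<lambda>xs. subset_form f n xs + wedge (f (Suc n)) (subset_form f n) xs)"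

fun single_sum :: "(nat \<Rightarrow> 'a \<Rightarrow> real) \<Rightarrow> nat \<Rightarrow> 'a \<Rightarrow> real" where
  "single_sum f 0 = (\<lambda>x. 0)"
| "single_sum f (Suc n) = (\<lambda>x. single_sum f n x + f (Suc n) x)"

text \<open>The sum of \<open>f_k(y) f_l(x) - f_l(y) f_k(x)\<close> over \<open>n \<ge> k > l \<ge> 1\<close>, i.e. the component of degree two of
  \<open>subset_form\<close>.\<close>

fun pair_sum :: "(nat \<Rightarrow> 'a \<Rightarrow> real) \<Rightarrow> nat \<Rightarrow> 'a \<Rightarrow> 'a \<Rightarrow> real" where
  "pair_sum f 0 y = (\<lambda>x. 0)"
| "pair_sum f (Suc n) y = (\<lambda>x. pair_sum f n y x
     + (f (Suc n) y * single_sum f n x + (- single_sum f n y) * f (Suc n) x))"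

text \<open>Wedging a minor with one more row inserts that row with a sign depending on its place. So
  every minor of size \<open>k\<close> arises from \<open>k\<close> smaller ones with alternating signs, which add up to 1 if \<open>k\<close> is odd
  and to 0 if \<open>k\<close> is even.\<close>

lemma subset_form_parity:
  "wedge (single_sum f n) (subset_form f n) xs = (if odd (length xs) then subset_form f n xs else 0)"
proof (induction n arbitrary: xs)
  case 0
  then show ?case by (cases xs) auto
next
  case (Suc n)
  let ?F = "subset_form f n" and ?c = "single_sum f n" and ?f = "f (Suc n)"
  have "wedge ?c (wedge ?f ?F) xs = - wedge ?f (wedge ?c ?F) xs"
    by (rule wedge_anticommute)
  also have "wedge ?f (wedge ?c ?F) xs = wedge ?f (\<lambda>zs. (if even (length xs) then 1 else 0) * ?F zs) xs"
    by (rule wedge_cong) (auto simp: Suc.IH, metis even_Suc, metis even_Suc)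
  also have "\<dots> = (if even (length xs) then 1 else 0) * wedge ?f ?F xs"
    by (rule wedge_scale_right)
  finally have *: "wedge ?c (wedge ?f ?F) xs = - ((if even (length xs) then 1 else 0) * wedge ?f ?F xs)" .
  show ?case
    by (simp add: wedge_add_left wedge_add_right * Suc.IH)
qed

text \<open>The expansion of a Pfaffian along its first row: contraction of the even part with a point \<open>y\<close>
  multiplies it by the one-form \<open>pair_sum f n y\<close>. The induction uses that contraction is an antiderivation and
  that \<open>subset_form_parity\<close> expresses the odd part by the even one.\<close>

lemma subset_form_Cons:
  fixes xs :: "'a list"
  assumes "odd (length xs)"
  shows "subset_form f n (y # xs) = wedge (pair_sum f n y) (subset_form f n) xs"
  using assms
proof (induction n arbitrary: xs)
  case 0
  then show ?case by (cases xs) auto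
next
  case (Suc n)
  let ?F = "subset_form f n" and ?c = "single_sum f n" and ?f = "f (Suc n)" and ?Q = "pair_sum f n y"
  have 1: "?F (y # zs) = ?c y * ?F zs + wedge ?Q ?F zs" if "even (length zs)" for zs
  proof -
    have "?F (y # zs) = wedge ?c ?F (y # zs)"
      using that by (simp add: subset_form_parity del: wedge.simps)
    also have "\<dots> = ?c y * ?F zs - wedge ?c (\<lambda>ws. ?F (y # ws)) zs"
      by simp
    also have "wedge ?c (\<lambda>ws. ?F (y # ws)) zs = wedge ?c (wedge ?Q ?F) zs"
    proof (rule wedge_cong)
      fix ws :: "'a list"
      assume "Suc (length ws) = length zs"
      then have "odd (length ws)" using that by (metis even_Suc)
      then show "?F (y # ws) = wedge ?Q ?F ws" by (rule Suc.IH)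
    qed simp
    also have "\<dots> = - wedge ?Q (wedge ?c ?F) zs"
      by (rule wedge_anticommute)
    also have "wedge ?Q (wedge ?c ?F) zs = wedge ?Q ?F zs"
    proof (rule wedge_cong)
      fix ws :: "'a list"
      assume "Suc (length ws) = length zs"
      then have "odd (length ws)" using that by (metis even_Suc)
      then show "wedge ?c ?F ws = ?F ws" by (simp add: subset_form_parity)
    qed simp
    finally show ?thesis by simp
  qed
  have "wedge ?f (\<lambda>zs. ?F (y # zs)) xs = wedge ?f (\<lambda>zs. ?c y * ?F zs + wedge ?Q ?F zs) xs"
  proof (rule wedge_cong)
    fix zs :: "'a list"
    assume "Suc (length zs) = length xs"
    then have "even (length zs)" using Suc.prems by (metis even_Suc)
    then show "?F (y # zs) = ?c y * ?F zs + wedge ?Q ?F zs" by (rule 1)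
  qed simp
  also have "\<dots> = ?c y * wedge ?f ?F xs + wedge ?f (wedge ?Q ?F) xs"
    by (simp only: wedge_add_right wedge_scale_right)
  finally have 2: "wedge ?f (\<lambda>zs. ?F (y # zs)) xs = ?c y * wedge ?f ?F xs - wedge ?Q (wedge ?f ?F) xs"
    using wedge_anticommute[of ?f ?Q ?F xs] by linarith
  have "wedge ?c (wedge ?f ?F) xs = - wedge ?f (wedge ?c ?F) xs"
    by (rule wedge_anticommute)
  also have "wedge ?f (wedge ?c ?F) xs = wedge ?f (\<lambda>_. 0) xs"
  proof (rule wedge_cong)
    fix zs :: "'a list"
    assume "Suc (length zs) = length xs"
    then have "even (length zs)" using Suc.prems by (metis even_Suc)
    then show "wedge ?c ?F zs = 0" by (simp add: subset_form_parity)
  qed simp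
  finally have 3: "wedge ?c (wedge ?f ?F) xs = 0" by simp
  show ?case
    unfolding subset_form.simps pair_sum.simps wedge_add_left wedge_add_right wedge_scale_left
      wedge.simps Suc.IH[OF Suc.prems] 2 3
    using Suc.prems by (simp add: subset_form_parity algebra_simps)
qed

lemma sorted_list_of_set_insert_top:
  assumes "L \<subseteq> {1..n}"
  shows "sorted_list_of_set (insert (Suc n) L) = sorted_list_of_set L @ [Suc n]"
proof (rule sorted_distinct_set_unique)
  have "finite L" using assms finite_subset by blast
  then show "sorted (sorted_list_of_set L @ [Suc n])" "distinct (sorted_list_of_set L @ [Suc n])"
    "set (sorted_list_of_set (insert (Suc n) L)) = set (sorted_list_of_set L @ [Suc n])"
    using assms by (auto simp: sorted_append simp del: sorted_list_of_set_insert_remove)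
qed simp_all

lemma subset_form_eq_sum:
  "subset_form f n xs = (\<Sum>L\<in>Pow {1..n}. alternant (map f (rev (sorted_list_of_set L))) xs)"
proof (induction n arbitrary: xs)
  case (Suc n)
  let ?a = "\<lambda>L. alternant (map f (rev (sorted_list_of_set L)))"
  have "wedge (f (Suc n)) (subset_form f n) xs
      = wedge (f (Suc n)) (\<lambda>xs. \<Sum>L\<in>Pow {1..n}. ?a L xs) xs"
    by (rule wedge_cong) (simp_all add: Suc.IH)
  also have "\<dots> = (\<Sum>L\<in>Pow {1..n}. wedge (f (Suc n)) (?a L) xs)"
    by (rule wedge_sum_right)
  also have "\<dots> = (\<Sum>L\<in>Pow {1..n}. ?a (insert (Suc n) L) xs)"
    by (rule sum.cong) (auto simp: sorted_list_of_set_insert_top simp del: sorted_list_of_set_insert_remove)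
  also have "\<dots> = (\<Sum>L\<in>insert (Suc n) ` Pow {1..n}. ?a L xs)"
  proof (subst sum.reindex)
    have "Suc n \<notin> A" if "A \<in> Pow {1..n}" for A
      using that by auto
    then show "inj_on (insert (Suc n)) (Pow {1..n})"
      by (intro inj_onI) (metis insert_ident)
  qed simp
  finally have *: "wedge (f (Suc n)) (subset_form f n) xs = \<dots>" .
  have "Pow {1..Suc n} = Pow {1..n} \<union> insert (Suc n) ` Pow {1..n}"
    by (simp add: atLeastAtMostSuc_conv Pow_insert)
  moreover have "Pow {1..n} \<inter> insert (Suc n) ` Pow {1..n} = {}" by auto
  ultimately show ?case
    by (simp add: sum.union_disjoint Suc.IH *)
qed simp

section \<open>The two-form of the even powers\<close>

text \<open>For \<open>e = 1\<close> and \<open>e = -1\<close> these are the symmetric and antisymmetric Laurent binomials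
  \<open>x^k + e x^(-k)\<close>.\<close>

definition recip :: "real \<Rightarrow> nat \<Rightarrow> real \<Rightarrow> real" where
  "recip e k x = x ^ k + e / x ^ k"

lemma recip_altdef: "recip e k x = x ^ k + e * inverse x ^ k"
  by (simp add: recip_def divide_inverse power_inverse)

definition xvar :: "real \<Rightarrow> real" where "xvar x = recip 1 2 x"
definition evenpow :: "nat \<Rightarrow> real \<Rightarrow> real" where "evenpow l x = recip 1 (l + l) x"

text \<open>A geometric sum: the right-hand side telescopes in \<open>n\<close>, since
  \<open>(x^n - x^(-n)) (x^(n + 1) + x^(- n - 1)) = x^(2 n + 1) - x^(- 2 n - 1) - x + x^(-1)\<close>.\<close>

lemma single_sum_evenpow:
  assumes "x > 0" "x \<noteq> 1"
  shows "single_sum evenpow n x * recip (-1) 1 x = recip (-1) n x * recip 1 (Suc n) x"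
proof (induction n)
  case 0
  then show ?case by (simp add: recip_def)
next
  case (Suc n)
  define U where "U = x ^ n"
  have "U \<noteq> 0" using assms by (simp add: U_def)
  have "recip (-1) (Suc n) x * recip 1 (Suc (Suc n)) x
      = recip (-1) n x * recip 1 (Suc n) x + evenpow (Suc n) x * recip (-1) 1 x"
    using assms \<open>U \<noteq> 0\<close> unfolding evenpow_def recip_def mult_2 power_add power_Suc U_def[symmetric]
    by (simp add: field_simps)
  then show ?case using Suc.IH by (simp add: algebra_simps)
qed

text \<open>The Casorati determinant, in steps of two, of the sequences \<open>recip e k x\<close> and \<open>recip e k y\<close>
  indexed by \<open>k\<close>.\<close>

definition casorati :: "real \<Rightarrow> nat \<Rightarrow> real \<Rightarrow> real \<Rightarrow> real" where
  "casorati e k x y = recip e (Suc (Suc k)) x * recip e k y - recip e k x * recip e (Suc (Suc k)) y"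

text \<open>The increment of the right-hand side of \<open>pair_sum_evenpow\<close>, with \<open>i\<close>, \<open>j\<close>, \<open>u\<close>, \<open>v\<close> in place of
  the inverses of \<open>x\<close>, \<open>y\<close>, \<open>U = x^k\<close>, \<open>V = y^k\<close>, so that it becomes a membership in a polynomial ideal.\<close>

lemma pair_sum_step:
  fixes x y U V i j u v :: real
  assumes "x * i = 1" "y * j = 1" "U * u = 1" "V * v = 1"
  shows "((U*x*x-u*i*i)*(V-v)-(U-u)*(V * y*y-v * j*j))*((U*x*x*x+u*i*i*i)*(V * y+v * j)-(U*x+u*i)*(V * y*y*y+v * j*j*j))
    + (x*x+i*i-y*y-j*j)*((U*U*x*x*x*x+u*u*i*i*i*i)*(V * y-v * j)*(V * y*y+v * j*j)*(x-i) - (V * V * y*y*y*y+v * v * j*j*j*j)*(U*x-u*i)*(U*x*x+u*i*i)*(y-j))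
    = ((U*x*x*x-u*i*i*i)*(V * y-v * j)-(U*x-u*i)*(V * y*y*y-v * j*j*j))*((U*x*x*x*x+u*i*i*i*i)*(V * y*y+v * j*j)-(U*x*x+u*i*i)*(V * y*y*y*y+v * j*j*j*j))"
  using assms by algebra

text \<open>For fixed \<open>x\<close> the sequence \<open>f_l = evenpow l x\<close> satisfies
  \<open>f_(l + 1) + f_(l - 1) = xvar x * f_l\<close>, so by summation by parts \<open>(xvar x - xvar y)\<close> times the two-form consists of boundary terms only. That these terms factor into two
  antisymmetric determinants is the source of the product formula.\<close>

lemma pair_sum_evenpow:
  assumes "x > 0" "x \<noteq> 1" "y > 0" "y \<noteq> 1"
  shows "pair_sum evenpow (Suc k) x y * ((xvar x - xvar y) * (recip (-1) 1 x * recip (-1) 1 y))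
           = casorati (-1) k x y * casorati 1 (Suc k) x y"
proof (induction k)
  case 0
  then show ?case by (simp add: casorati_def recip_def)
next
  case (Suc k)
  let ?c = "single_sum evenpow (Suc k)" and ?w = "evenpow (Suc (Suc k))"
  let ?z = "recip (-1) 1"
  have "pair_sum evenpow (Suc (Suc k)) x y * ((xvar x - xvar y) * (?z x * ?z y))
     = casorati (-1) k x y * casorati 1 (Suc k) x y
       + (xvar x - xvar y) * (?w x * (?c y * ?z y) * ?z x - ?w y * (?c x * ?z x) * ?z y)"
    unfolding Suc.IH[symmetric] pair_sum.simps(2)[of _ "Suc k"] by algebra
  also have "\<dots> = casorati (-1) k x y * casorati 1 (Suc k) x y
       + (xvar x - xvar y) * (?w x * (recip (-1) (Suc k) y * recip 1 (Suc (Suc k)) y) * ?z x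
          - ?w y * (recip (-1) (Suc k) x * recip 1 (Suc (Suc k)) x) * ?z y)"
    unfolding single_sum_evenpow[OF assms(1,2)] single_sum_evenpow[OF assms(3,4)] ..
  also have "\<dots> = casorati (-1) (Suc k) x y * casorati 1 (Suc (Suc k)) x y"
  proof -
    define i j U V u v where defs: "i = inverse x" "j = inverse y"
      "U = x ^ k" "V = y ^ k" "u = i ^ k" "v = j ^ k"
    have "x * i = 1" "y * j = 1" "U * u = 1" "V * v = 1"
      using assms by (auto simp: defs power_mult_distrib[symmetric])
    from pair_sum_step[OF this] show ?thesis
      unfolding casorati_def recip_altdef xvar_def evenpow_def mult_2 add_Suc add_Suc_right
        power_add power_Suc power_0 numeral_2_eq_2 One_nat_def defs(1-4)[symmetric]
      unfolding defs(5,6)[symmetric]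
      by algebra
  qed
  finally show ?case .
qed

section \<open>Partial fractions and moments\<close>

text \<open>The quotient of \<open>vander ts\<close> by the product for the list without \<open>t_j\<close> is, up to sign, the reciprocal of a
  Lagrange weight.\<close>

lemma vander_remove:
  assumes "j < length ts"
  shows "vander ts = (-1) ^ j * (\<Prod>k\<in>{..<length ts} - {j}. ts ! j - ts ! k)
                  * vander (take j ts @ drop (Suc j) ts)"
  using assms
proof (induction ts arbitrary: j)
  case (Cons x ts)
  show ?case
  proof (cases j)
    case 0
    have "{..<length (x # ts)} - {j} = Suc ` {..<length ts}"
      using 0 by (auto simp: lessThan_Suc_eq_insert_0)
    then have "(\<Prod>k\<in>{..<length (x # ts)} - {j}. (x # ts) ! j - (x # ts) ! k) = (\<Prod>k<length ts. x - ts ! k)"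
      using 0 by (simp add: prod.reindex)
    then show ?thesis using 0
      by (simp add: prod.list_conv_set_nth atLeast0LessThan)
  next
    case (Suc i)
    then have i: "i < length ts" using Cons.prems by simp
    have "{..<length (x # ts)} - {j} = insert 0 (Suc ` ({..<length ts} - {i}))"
      using Suc by (auto simp: lessThan_Suc_eq_insert_0)
    then have "(\<Prod>k\<in>{..<length (x # ts)} - {j}. (x # ts) ! j - (x # ts) ! k)
        = (ts ! i - x) * (\<Prod>k\<in>{..<length ts} - {i}. ts ! i - ts ! k)"
      using Suc by (simp add: prod.reindex)
    moreover have "(\<Prod>y\<leftarrow>ts. x - y) = (x - ts ! i) * (\<Prod>y\<leftarrow>take i ts @ drop (Suc i) ts. x - y)"
      by (subst id_take_nth_drop[OF i]) simp
    ultimately have "vander (x # ts) = (x - ts ! i) * (\<Prod>y\<leftarrow>take i ts @ drop (Suc i) ts. x - y) *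
        ((-1) ^ i * (\<Prod>k\<in>{..<length ts} - {i}. ts ! i - ts ! k) * vander (take i ts @ drop (Suc i) ts))"
      "(\<Prod>k\<in>{..<length (x # ts)} - {j}. (x # ts) ! j - (x # ts) ! k)
        = (ts ! i - x) * (\<Prod>k\<in>{..<length ts} - {i}. ts ! i - ts ! k)"
      "vander (take j (x # ts) @ drop (Suc j) (x # ts))
        = (\<Prod>y\<leftarrow>take i ts @ drop (Suc i) ts. x - y) * vander (take i ts @ drop (Suc i) ts)"
      using Suc Cons.IH[OF i] by simp_all
    moreover have "(a - b) * u * (s * d * v) = (-1 * s) * ((b - a) * d) * (u * v)" for a b u s d v :: real
      by algebra
    ultimately show ?thesis
      using Suc by (simp only: power_Suc)
  qed
qed simp

lemma lagrange_poly:
  fixes t :: "nat \<Rightarrow> real" and R :: "real poly"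
  assumes inj: "inj_on t {..<N}" and deg: "degree R < N"
  shows "R = (\<Sum>j<N. smult (poly R (t j) / (\<Prod>k\<in>{..<N} - {j}. t j - t k))
                (\<Prod>k\<in>{..<N} - {j}. [:- t k, 1:]))" (is "R = ?L")
proof (rule poly_eqI_degree[of "t ` {..<N}"])
  have 1: "degree (\<Prod>k\<in>{..<N} - {j}. [:- t k, 1:]) \<le> N - 1" if "j < N" for j
    using that degree_prod_sum_le[of "{..<N} - {j}" "\<lambda>k. [:- t k, 1:]"] by simp
  have "degree ?L \<le> N - 1"
    by (intro degree_sum_le) (blast intro: order_trans[OF degree_smult_le] 1)+
  then show "degree ?L < card (t ` {..<N})"
    using deg by (simp add: card_image[OF inj])
  show "degree R < card (t ` {..<N})"
    using deg by (simp add: card_image[OF inj])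
  fix x assume "x \<in> t ` {..<N}"
  then obtain i where i: "i < N" "x = t i" by auto
  have "poly ?L x = (\<Sum>j<N. if j = i then poly R (t i) else 0)"
    unfolding poly_sum poly_smult poly_prod
  proof (rule sum.cong)
    fix j assume j: "j \<in> {..<N}"
    show "poly R (t j) / (\<Prod>k\<in>{..<N} - {j}. t j - t k) * (\<Prod>k\<in>{..<N} - {j}. poly [:- t k, 1:] x)
        = (if j = i then poly R (t i) else 0)"
    proof (cases "j = i")
      case True
      have "(\<Prod>k\<in>{..<N} - {i}. t i - t k) \<noteq> 0"
        using inj i by (auto simp: inj_on_def)
      then show ?thesis using True i by simp
    next
      case False
      then have "(\<Prod>k\<in>{..<N} - {j}. poly [:- t k, 1:] x) = 0"
        using i by (auto intro!: bexI[of _ i])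
      then show ?thesis using False by simp
    qed
  qed simp
  then show "poly R x = poly ?L x" using i by simp
qed

text \<open>The leading coefficient in Lagrange's interpolation formula. It vanishes for polynomials of degree below
  \<open>N - 1\<close>, which is how moment conditions are turned into degree bounds.\<close>

lemma lagrange_lead:
  fixes t :: "nat \<Rightarrow> real" and R :: "real poly"
  assumes inj: "inj_on t {..<N}" and deg: "degree R < N"
  shows "(\<Sum>j<N. poly R (t j) / (\<Prod>k\<in>{..<N} - {j}. t j - t k)) = coeff R (N - 1)"
proof -
  have 1: "coeff (\<Prod>k\<in>{..<N} - {j}. [:- t k, 1:]) (N - 1) = 1" if "j < N" for j
  proof -
    have "degree (\<Prod>k\<in>{..<N} - {j}. [:- t k, 1:]) = N - 1"
      using that by (subst degree_prod_eq_sum_degree) auto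
    moreover have "lead_coeff (\<Prod>k\<in>{..<N} - {j}. [:- t k, 1:]) = 1"
      by (simp add: lead_coeff_prod)
    ultimately show ?thesis by simp
  qed
  show ?thesis
    by (subst (2) lagrange_poly[OF assms])
       (unfold coeff_sum coeff_smult, rule sum.cong, simp_all only: 1 lessThan_iff mult_1_right)
qed

lemma lagrange_partial_fractions:
  fixes t :: "nat \<Rightarrow> real" and R :: "real poly"
  assumes inj: "inj_on t {..<N}" and deg: "degree R < N" and w: "w \<notin> t ` {..<N}"
  shows "(\<Sum>j<N. poly R (t j) / (\<Prod>k\<in>{..<N} - {j}. t j - t k) / (w - t j))
           = poly R w / (\<Prod>k<N. w - t k)"
proof -
  have "(\<Prod>k<N. w - t k) \<noteq> 0" using w by auto
  have *: "(\<Prod>k\<in>{..<N} - {j}. w - t k) = (\<Prod>k<N. w - t k) / (w - t j)" if "j < N" for j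
    using that w by (subst prod.remove[of "{..<N}" j]) auto
  have "poly R w = (\<Sum>j<N. poly R (t j) / (\<Prod>k\<in>{..<N} - {j}. t j - t k) * (\<Prod>k\<in>{..<N} - {j}. w - t k))"
    by (subst lagrange_poly[OF inj deg]) (simp add: poly_sum poly_prod)
  also have "\<dots> = (\<Prod>k<N. w - t k) * (\<Sum>j<N. poly R (t j) / (\<Prod>k\<in>{..<N} - {j}. t j - t k) / (w - t j))"
    unfolding sum_distrib_left by (rule sum.cong) (simp_all add: *)
  finally show ?thesis using \<open>(\<Prod>k<N. w - t k) \<noteq> 0\<close> by simp
qed

text \<open>A vector \<open>e\<close> on the nodes whose first \<open>p\<close> moments vanish consists, up to the Lagrange weights, of
  the values of a polynomial of degree at most \<open>N - 1 - p\<close>: every further vanishing moment kills one more leading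
  coefficient of the interpolation polynomial.\<close>

lemma moments_interpolation:
  fixes t :: "nat \<Rightarrow> real" and e :: "nat \<Rightarrow> real"
  assumes inj: "inj_on t {..<N}" and "p < N"
    and mom: "\<And>k. k < p \<Longrightarrow> (\<Sum>j<N. e j * t j ^ k) = 0"
  obtains P where "degree P + p < N"
    "\<And>j. j < N \<Longrightarrow> poly P (t j) = e j * (\<Prod>k\<in>{..<N} - {j}. t j - t k)"
proof -
  define P where "P = (\<Sum>j<N. smult (e j) (\<Prod>k\<in>{..<N} - {j}. [:- t k, 1:]))"
  have at: "poly P (t i) = e i * (\<Prod>k\<in>{..<N} - {i}. t i - t k)" if i: "i < N" for i
  proof -
    have "poly P (t i) = (\<Sum>j<N. if j = i then e i * (\<Prod>k\<in>{..<N} - {i}. t i - t k) else 0)"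
      unfolding P_def poly_sum poly_smult poly_prod
    proof (rule sum.cong)
      fix j assume "j \<in> {..<N}"
      show "e j * (\<Prod>k\<in>{..<N} - {j}. poly [:- t k, 1:] (t i))
        = (if j = i then e i * (\<Prod>k\<in>{..<N} - {i}. t i - t k) else 0)"
        using i by (cases "j = i") (auto intro!: bexI[of _ i])
    qed simp
    then show ?thesis using i by simp
  qed
  have nz: "(\<Prod>k\<in>{..<N} - {j}. t j - t k) \<noteq> 0" if "j < N" for j
    using inj that by (auto simp: inj_on_def)
  have "degree P + k < N" if "k \<le> p" for k
    using that
  proof (induction k)
    case 0
    have "degree (\<Prod>k\<in>{..<N} - {j}. [:- t k, 1:]) \<le> N - 1" if "j < N" for j
      using that degree_prod_sum_le[of "{..<N} - {j}" "\<lambda>k. [:- t k, 1:]"] by simp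
    then have "degree P \<le> N - 1"
      unfolding P_def by (intro degree_sum_le) (blast intro: order_trans[OF degree_smult_le])+
    then show ?case using \<open>p < N\<close> by simp
  next
    case (Suc k)
    then have IH: "degree P + k < N" by simp
    have "degree (monom 1 k * P) \<le> degree P + k"
      using degree_mult_le[of "monom 1 k" P] degree_monom_le[of "1::real" k] by linarith
    then have d: "degree (monom 1 k * P) < N" using IH by simp
    have "coeff (monom 1 k * P) (N - 1) = (\<Sum>j<N. e j * t j ^ k)"
      unfolding lagrange_lead[OF inj d, symmetric]
    proof (rule sum.cong)
      fix j assume "j \<in> {..<N}"
      then show "poly (monom 1 k * P) (t j) / (\<Prod>k\<in>{..<N} - {j}. t j - t k) = e j * t j ^ k"
        using nz[of j] at[of j] by (simp add: poly_monom del: prod_zero_iff)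
    qed simp
    also have "\<dots> = 0" using Suc.prems by (intro mom) simp
    finally have "coeff P (N - 1 - k) = 0"
      using IH by (simp add: coeff_monom_mult split: if_splits)
    moreover have "degree P \<le> N - 1 - k" using IH by simp
    ultimately have "degree P < N - 1 - k \<or> P = 0"
      by (metis le_neq_implies_less leading_coeff_0_iff)
    then show ?case using Suc.prems \<open>p < N\<close> by auto
  qed
  from this[of p] at show ?thesis using that by blast
qed

text \<open>With \<open>N = 2 p + 1\<close> nodes, \<open>a\<close> and \<open>b\<close> interpolate polynomials \<open>P\<close> and \<open>R\<close> of degree at most
  \<open>p\<close>, and the product \<open>P R\<close> still has degree below \<open>N\<close>. So each of the three sums is a partial fraction
  expansion, of \<open>P R\<close>, \<open>P\<close> and \<open>R\<close> over the node polynomial, evaluated at \<open>w\<close>.\<close>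

lemma bilinear_moments:
  fixes t :: "nat \<Rightarrow> real"
  assumes inj: "inj_on t {..<N}" and N: "N = Suc (2 * p)" and w: "w \<notin> t ` {..<N}"
    and a: "\<And>k. k < p \<Longrightarrow> (\<Sum>j<N. a j * t j ^ k) = 0"
    and b: "\<And>k. k < p \<Longrightarrow> (\<Sum>j<N. b j * t j ^ k) = 0"
  shows "(\<Sum>j<N. a j * b j * (\<Prod>k\<in>{..<N} - {j}. t j - t k) / (w - t j))
     = (\<Prod>j<N. w - t j) * (\<Sum>j<N. a j / (w - t j)) * (\<Sum>j<N. b j / (w - t j))"
proof -
  let ?d = "\<lambda>j. \<Prod>k\<in>{..<N} - {j}. t j - t k"
  have nz: "?d j \<noteq> 0" if "j < N" for j
    using inj that by (auto simp: inj_on_def)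
  have W: "(\<Prod>j<N. w - t j) \<noteq> 0" using w by auto
  have "p < N" using N by simp
  obtain P where P: "degree P + p < N" "\<And>j. j < N \<Longrightarrow> poly P (t j) = a j * ?d j"
    using moments_interpolation[OF inj \<open>p < N\<close> a] by blast
  obtain R where R: "degree R + p < N" "\<And>j. j < N \<Longrightarrow> poly R (t j) = b j * ?d j"
    using moments_interpolation[OF inj \<open>p < N\<close> b] by blast
  have deg: "degree (P * R) < N"
    using degree_mult_le[of P R] P(1) R(1) N by linarith
  have "(\<Sum>j<N. a j * b j * ?d j / (w - t j)) = (\<Sum>j<N. poly (P * R) (t j) / ?d j / (w - t j))"
    by (rule sum.cong) (use P(2) R(2) nz in \<open>simp_all del: prod_zero_iff\<close>)
  also have "\<dots> = poly P w * poly R w / (\<Prod>k<N. w - t k)"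
    using lagrange_partial_fractions[OF inj deg w] by simp
  finally have "(\<Sum>j<N. a j * b j * ?d j / (w - t j)) = poly P w * poly R w / (\<Prod>k<N. w - t k)" .
  moreover have "(\<Sum>j<N. a j / (w - t j)) = poly P w / (\<Prod>k<N. w - t k)"
  proof -
    have "(\<Sum>j<N. a j / (w - t j)) = (\<Sum>j<N. poly P (t j) / ?d j / (w - t j))"
      by (rule sum.cong) (use P(2) nz in \<open>simp_all del: prod_zero_iff\<close>)
    then show ?thesis using lagrange_partial_fractions[OF inj _ w, of P] P(1) by simp
  qed
  moreover have "(\<Sum>j<N. b j / (w - t j)) = poly R w / (\<Prod>k<N. w - t k)"
  proof -
    have "(\<Sum>j<N. b j / (w - t j)) = (\<Sum>j<N. poly R (t j) / ?d j / (w - t j))"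
      by (rule sum.cong) (use R(2) nz in \<open>simp_all del: prod_zero_iff\<close>)
    then show ?thesis using lagrange_partial_fractions[OF inj _ w, of R] R(1) by simp
  qed
  ultimately show ?thesis using W by simp
qed

section \<open>Factorization of Pfaffians with entries over differences\<close>

text \<open>The determinant with rows \<open>\<alpha> X^i\<close> and \<open>\<beta> X^i\<close> for \<open>i < k\<close>, highest powers in front.\<close>

fun two_form :: "('a \<Rightarrow> real) \<Rightarrow> ('a \<Rightarrow> real) \<Rightarrow> ('a \<Rightarrow> real) \<Rightarrow> nat \<Rightarrow> 'a list \<Rightarrow> real" where
  "two_form X \<alpha> \<beta> 0 = unit_form"
| "two_form X \<alpha> \<beta> (Suc k) = wedge (\<lambda>x. \<alpha> x * X x ^ k) (wedge (\<lambda>x. \<beta> x * X x ^ k) (two_form X \<alpha> \<beta> k))"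

lemma wedge_past_pair: "wedge u (wedge a (wedge b G)) = wedge a (wedge b (wedge u G))"
proof
  fix xs
  have "wedge u (wedge b G) = (\<lambda>xs. - wedge b (wedge u G) xs)"
    using wedge_anticommute by blast
  then show "wedge u (wedge a (wedge b G)) xs = wedge a (wedge b (wedge u G)) xs"
    using wedge_anticommute[of u a "wedge b G" xs] by (simp add: wedge_neg_right)
qed

lemma wedge_low_two_form:
  assumes "i < k"
  shows "wedge (\<lambda>x. \<alpha> x * X x ^ i) (two_form X \<alpha> \<beta> k) xs = 0"
    and "wedge (\<lambda>x. \<beta> x * X x ^ i) (two_form X \<alpha> \<beta> k) xs = 0"
proof -
  have "wedge (\<lambda>x. \<alpha> x * X x ^ i) (two_form X \<alpha> \<beta> k) = (\<lambda>_. 0) \<and>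
        wedge (\<lambda>x. \<beta> x * X x ^ i) (two_form X \<alpha> \<beta> k) = (\<lambda>_. 0)"
    using assms
  proof (induction k)
    case (Suc k)
    show ?case
    proof (cases "i = k")
      case True
      then show ?thesis by (auto simp: wedge_self_inner)
    next
      case False
      then have "i < k" using Suc.prems by simp
      from Suc.IH[OF this] show ?thesis
        by (auto simp: wedge_past_pair[of "\<lambda>x. \<alpha> x * X x ^ i"] wedge_past_pair[of "\<lambda>x. \<beta> x * X x ^ i"])
    qed
  qed simp
  then show "wedge (\<lambda>x. \<alpha> x * X x ^ i) (two_form X \<alpha> \<beta> k) xs = 0"
    "wedge (\<lambda>x. \<beta> x * X x ^ i) (two_form X \<alpha> \<beta> k) xs = 0" by simp_all
qed

lemma two_form_shift:
  "two_form X \<alpha> \<beta> (Suc k)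
     = wedge \<alpha> (wedge \<beta> (two_form X (\<lambda>x. (X x - w) * \<alpha> x) (\<lambda>x. (X x - w) * \<beta> x) k))"
proof (induction k)
  case (Suc k)
  let ?P = "two_form X (\<lambda>x. (X x - w) * \<alpha> x) (\<lambda>x. (X x - w) * \<beta> x)"
  let ?T = "two_form X \<alpha> \<beta> (Suc k)"
  let ?a = "\<lambda>x. (X x - w) * \<alpha> x * X x ^ k" and ?b = "\<lambda>x. (X x - w) * \<beta> x * X x ^ k"
  let ?c = "\<lambda>x. \<alpha> x * X x ^ k" and ?e = "\<lambda>x. \<beta> x * X x ^ k"
  have a: "(\<lambda>x. \<alpha> x * X x ^ Suc k) = (\<lambda>x. ?a x + w * ?c x)"
    and b: "(\<lambda>x. \<beta> x * X x ^ Suc k) = (\<lambda>x. ?b x + w * ?e x)"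
    by (auto simp: algebra_simps)
  have 1: "wedge (\<lambda>x. \<beta> x * X x ^ Suc k) ?T = wedge ?b ?T"
    unfolding b by (rule ext, simp only: wedge_add_left wedge_scale_left wedge_low_two_form[OF lessI] mult_zero_right add_0_right)
  have "wedge ?c (wedge ?b ?T) = (\<lambda>_. 0)"
  proof
    fix xs
    have "wedge ?c (wedge ?b ?T) xs = - wedge ?b (wedge ?c ?T) xs"
      by (rule wedge_anticommute)
    also have "wedge ?c ?T = (\<lambda>_. 0)"
      using wedge_low_two_form(1)[OF lessI] by blast
    finally show "wedge ?c (wedge ?b ?T) xs = 0" by simp
  qed
  then have z: "wedge ?c (wedge ?b ?T) xs = 0" for xs
    by (rule fun_cong)
  have 2: "wedge (\<lambda>x. \<alpha> x * X x ^ Suc k) (wedge ?b ?T) = wedge ?a (wedge ?b ?T)"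
    by (rule ext) (simp only: a wedge_add_left wedge_scale_left z mult_zero_right add_0_right)
  have "two_form X \<alpha> \<beta> (Suc (Suc k)) = wedge ?a (wedge ?b ?T)"
    unfolding two_form.simps(2)[of _ _ _ "Suc k"] 1 2 ..
  also have "\<dots> = wedge \<alpha> (wedge \<beta> (?P (Suc k)))"
    unfolding Suc.IH wedge_past_pair[of ?b] wedge_past_pair[of ?a] by simp
  finally show ?case .
qed simp

lemma two_form_vanish: "\<alpha> y = 0 \<Longrightarrow> \<beta> y = 0 \<Longrightarrow> two_form X \<alpha> \<beta> k (y # zs) = 0"
proof (induction k arbitrary: zs)
  case (Suc k)
  then have "(\<lambda>zs. two_form X \<alpha> \<beta> k (y # zs)) = (\<lambda>_. 0)" by auto
  with Suc show ?case by simp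
qed simp

lemma two_form_scale:
  "two_form X (\<lambda>x. c x * \<alpha> x) (\<lambda>x. c x * \<beta> x) k = (\<lambda>xs. prod_list (map c xs) * two_form X \<alpha> \<beta> k xs)"
proof (induction k)
  case 0
  have "unit_form xs = prod_list (map c xs) * unit_form xs" for xs by (cases xs) auto
  then show ?case by auto
next
  case (Suc k)
  have "wedge (\<lambda>x. c x * f x) (\<lambda>xs. prod_list (map c xs) * G xs) = (\<lambda>xs. prod_list (map c xs) * wedge f G xs)"
    for f G by (intro ext wedge_scale_nodes)
  then show ?case by (simp add: Suc mult.assoc)
qed

text \<open>After row operations all rows but \<open>\<alpha>\<close> and \<open>\<beta>\<close> contain the factor \<open>X - X(y)\<close> and vanish at
  \<open>y\<close>. What remains is a determinant on the other nodes with one distinguished row, which has the shape required by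
  \<open>pfaffian_core\<close>.\<close>

lemma two_form_Cons:
  assumes "X y \<notin> X ` set xs"
  shows "two_form X \<alpha> \<beta> (Suc p) (y # xs)
    = (\<Prod>x\<leftarrow>xs. X x - X y)
      * wedge (\<lambda>x. (\<alpha> y * \<beta> x - \<beta> y * \<alpha> x) / (X x - X y)) (two_form X \<alpha> \<beta> p) xs"
proof -
  let ?P = "two_form X (\<lambda>x. (X x - X y) * \<alpha> x) (\<lambda>x. (X x - X y) * \<beta> x) p"
  have "wedge \<beta> ?P (y # zs) = \<beta> y * ?P zs" for zs
    by (simp add: two_form_vanish)
  then have "two_form X \<alpha> \<beta> (Suc p) (y # xs) = \<alpha> y * wedge \<beta> ?P xs + (- \<beta> y) * wedge \<alpha> ?P xs"
    unfolding two_form_shift[where w = "X y"] by (simp add: wedge_scale_right)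
  also have "\<dots> = wedge (\<lambda>x. \<alpha> y * \<beta> x + (- \<beta> y) * \<alpha> x) ?P xs"
    by (simp only: wedge_add_left wedge_scale_left)
  also have "\<dots> = wedge (\<lambda>x. (X x - X y) * ((\<alpha> y * \<beta> x - \<beta> y * \<alpha> x) / (X x - X y))) ?P xs"
  proof (rule wedge_cong)
    fix x assume "x \<in> set xs"
    then have "X x - X y \<noteq> 0" using assms by (metis eq_iff_diff_eq_0 imageI)
    then show "\<alpha> y * \<beta> x + - \<beta> y * \<alpha> x = (X x - X y) * ((\<alpha> y * \<beta> x - \<beta> y * \<alpha> x) / (X x - X y))"
      by simp
  qed simp
  finally show ?thesis
    by (simp only: two_form_scale wedge_scale_nodes)
qed

text \<open>One step of the factorization. Expanding along the distinguished row leaves a sum over the removed node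
  \<open>j\<close>, in which the two \<open>two_form\<close> values are cofactors \<open>D_j\<close> and \<open>D'_j\<close>. A determinant with a repeated row
  vanishes, so \<open>\<phi> D\<close> and \<open>\<psi> D'\<close> are orthogonal to \<open>1, X, ..., X^(p - 1)\<close>, and \<open>bilinear_moments\<close> turns the
  single sum of products into a product of two sums.\<close>

lemma pfaffian_core:
  fixes X \<kappa> \<alpha> \<beta> \<gamma> \<delta> :: "'a \<Rightarrow> real"
  assumes len: "length xs = Suc (2 * p)" and dist: "distinct (map X xs)" and w: "w \<notin> X ` set xs"
    and G: "\<And>zs. length zs = 2 * p \<Longrightarrow> set zs \<subseteq> set xs \<Longrightarrow> distinct (map X zs) \<Longrightarrow>
      G zs * vander (map X zs)
        = prod_list (map \<kappa> zs) * two_form X \<alpha> \<beta> p zs * two_form X \<gamma> \<delta> p zs"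
    and \<phi>: "\<And>x. \<phi> x = a * \<alpha> x + b * \<beta> x" and \<psi>: "\<And>x. \<psi> x = c * \<gamma> x + d * \<delta> x"
  shows "wedge (\<lambda>x. \<kappa> x * \<phi> x * \<psi> x / (w - X x)) G xs * vander (map X xs)
    = prod_list (map \<kappa> xs) * (\<Prod>x\<leftarrow>xs. w - X x)
      * wedge (\<lambda>x. \<phi> x / (w - X x)) (two_form X \<alpha> \<beta> p) xs
      * wedge (\<lambda>x. \<psi> x / (w - X x)) (two_form X \<gamma> \<delta> p) xs"
proof -
  define N where "N = length xs"
  define t where "t j = X (xs ! j)" for j
  define rest where "rest j = take j xs @ drop (Suc j) xs" for j
  \<comment> \<open>the cofactors of the distinguished row\<close>
  define D where "D j = (-1) ^ j * two_form X \<alpha> \<beta> p (rest j)" for j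
  define D' where "D' j = (-1) ^ j * two_form X \<gamma> \<delta> p (rest j)" for j
  define A where "A j = \<phi> (xs ! j) * D j" for j
  define B where "B j = \<psi> (xs ! j) * D' j" for j
  define d' where "d' j = (\<Prod>k\<in>{..<N} - {j}. t j - t k)" for j
  have inj: "inj_on t {..<N}"
    using dist unfolding t_def N_def distinct_conv_nth by (auto simp: inj_on_def)
  have w': "w \<notin> t ` {..<N}"
    using w nth_mem unfolding t_def N_def by blast
  have expand: "wedge v (two_form X \<alpha> \<beta> p) xs = (\<Sum>j<N. v (xs ! j) * D j)"
    "wedge v (two_form X \<gamma> \<delta> p) xs = (\<Sum>j<N. v (xs ! j) * D' j)" for v
    unfolding wedge_expand N_def D_def D'_def rest_def by (simp_all add: mult_ac)
  have mA: "(\<Sum>j<N. A j * t j ^ k) = 0" if "k < p" for k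
  proof -
    have "(\<Sum>j<N. A j * t j ^ k) = wedge (\<lambda>x. \<phi> x * X x ^ k) (two_form X \<alpha> \<beta> p) xs"
      unfolding expand A_def t_def by (simp add: mult_ac)
    also have "(\<lambda>x. \<phi> x * X x ^ k) = (\<lambda>x. a * (\<alpha> x * X x ^ k) + b * (\<beta> x * X x ^ k))"
      by (simp add: \<phi> algebra_simps)
    finally show ?thesis
      by (simp add: wedge_add_left wedge_scale_left wedge_low_two_form[OF that])
  qed
  have mB: "(\<Sum>j<N. B j * t j ^ k) = 0" if "k < p" for k
  proof -
    have "(\<Sum>j<N. B j * t j ^ k) = wedge (\<lambda>x. \<psi> x * X x ^ k) (two_form X \<gamma> \<delta> p) xs"
      unfolding expand B_def t_def by (simp add: mult_ac)
    also have "(\<lambda>x. \<psi> x * X x ^ k) = (\<lambda>x. c * (\<gamma> x * X x ^ k) + d * (\<delta> x * X x ^ k))"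
      by (simp add: \<psi> algebra_simps)
    finally show ?thesis
      by (simp add: wedge_add_left wedge_scale_left wedge_low_two_form[OF that])
  qed
  have "wedge (\<lambda>x. \<kappa> x * \<phi> x * \<psi> x / (w - X x)) G xs * vander (map X xs)
      = (\<Sum>j<N. prod_list (map \<kappa> xs) * (A j * B j * d' j / (w - t j)))"
    unfolding wedge_expand sum_distrib_right N_def[symmetric]
  proof (rule sum.cong)
    fix j assume "j \<in> {..<N}"
    then have j: "j < length xs" by (simp add: N_def)
    have len': "length (rest j) = 2 * p" using j len by (simp add: rest_def)
    have split: "xs = take j xs @ xs ! j # drop (Suc j) xs" by (rule id_take_nth_drop[OF j])
    have sub: "set (rest j) \<subseteq> set xs"
      unfolding rest_def using set_take_subset set_drop_subset by fastforce
    have "distinct (map X (take j xs @ xs ! j # drop (Suc j) xs))"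
      using dist split by metis
    then have dist': "distinct (map X (rest j))" by (auto simp: rest_def)
    have \<kappa>: "prod_list (map \<kappa> xs) = \<kappa> (xs ! j) * prod_list (map \<kappa> (rest j))"
      by (subst split) (simp add: rest_def)
    have "vander (map X xs) = (-1) ^ j * (\<Prod>k\<in>{..<N} - {j}. map X xs ! j - map X xs ! k) * vander (map X (rest j))"
      using vander_remove[of j "map X xs"] j by (simp add: N_def rest_def take_map drop_map)
    also have "(\<Prod>k\<in>{..<N} - {j}. map X xs ! j - map X xs ! k) = d' j"
      unfolding d'_def t_def by (rule prod.cong) (use j in \<open>auto simp: N_def\<close>)
    finally have v: "vander (map X xs) = (-1) ^ j * d' j * vander (map X (rest j))" .
    have s: "(-1) ^ j * (-1) ^ j = (1 :: real)" by (simp flip: power_add)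
    have alg: "s * (k * f * h / e) * g * (s * d * v) = k * P * (f * (s * T) * (h * (s * U)) * d / e)"
      if "g * v = P * T * U" for s k f h e g d v P T U :: real
    proof -
      have "s * (k * f * h / e) * g * (s * d * v) = s * s * (k * f * h / e) * d * (g * v)" by algebra
      then show ?thesis unfolding that by (simp add: mult_ac)
    qed
    have "(-1) ^ j * (\<kappa> (xs ! j) * \<phi> (xs ! j) * \<psi> (xs ! j) / (w - X (xs ! j))) * G (rest j)
            * ((-1) ^ j * d' j * vander (map X (rest j)))
        = \<kappa> (xs ! j) * prod_list (map \<kappa> (rest j)) * (A j * B j * d' j / (w - t j))"
      unfolding A_def B_def D_def D'_def t_def
      by (rule alg[OF G[OF len' sub dist']])
    then show "(-1) ^ j * (\<kappa> (xs ! j) * \<phi> (xs ! j) * \<psi> (xs ! j) / (w - X (xs ! j)))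
         * G (take j xs @ drop (Suc j) xs) * vander (map X xs)
       = prod_list (map \<kappa> xs) * (A j * B j * d' j / (w - t j))"
      unfolding v \<kappa> rest_def[symmetric] .
  qed simp
  also have "\<dots> = prod_list (map \<kappa> xs) * (\<Sum>j<N. A j * B j * d' j / (w - t j))"
    by (simp add: sum_distrib_left)
  also have "(\<Sum>j<N. A j * B j * d' j / (w - t j))
     = (\<Prod>j<N. w - t j) * (\<Sum>j<N. A j / (w - t j)) * (\<Sum>j<N. B j / (w - t j))"
    unfolding d'_def by (rule bilinear_moments[OF inj _ w' mA mB]) (use len in \<open>simp_all add: N_def\<close>)
  also have "(\<Sum>j<N. A j / (w - t j)) = wedge (\<lambda>x. \<phi> x / (w - X x)) (two_form X \<alpha> \<beta> p) xs"
    unfolding expand A_def t_def by simp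
  also have "(\<Sum>j<N. B j / (w - t j)) = wedge (\<lambda>x. \<psi> x / (w - X x)) (two_form X \<gamma> \<delta> p) xs"
    unfolding expand B_def t_def by simp
  also have "(\<Prod>j<N. w - t j) = (\<Prod>x\<leftarrow>xs. w - X x)"
    by (simp add: t_def N_def prod.list_conv_set_nth atLeast0LessThan)
  finally show ?thesis by (simp add: mult_ac)
qed

lemma prod_list_diff_swap:
  "odd (length xs) \<Longrightarrow> (\<Prod>x\<leftarrow>xs. f x - c) = - (\<Prod>x\<leftarrow>xs. c - (f x :: real))"
  using prod_list_uminus[of xs f c] by simp

lemma wedge_divide_swap:
  "wedge (\<lambda>x. f x / (X x - w)) G xs = - wedge (\<lambda>x. f x / (w - X x)) G xs"
proof -
  have "(\<lambda>x. f x / (X x - w)) = (\<lambda>x. (-1) * (f x / (w - X x)))"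
  proof
    fix x show "f x / (X x - w) = (-1) * (f x / (w - X x))"
      by (cases "X x = w") (simp_all add: field_simps)
  qed
  then have "wedge (\<lambda>x. f x / (X x - w)) G xs = (-1) * wedge (\<lambda>x. f x / (w - X x)) G xs"
    by (simp only: wedge_scale_left)
  then show ?thesis by simp
qed

text \<open>Okada's evaluation of the Pfaffian with entries
  \<open>(\<alpha> \<beta>' - \<beta> \<alpha>') (\<gamma> \<delta>' - \<delta> \<gamma>') / (X - X')\<close>. The Pfaffian enters only through its expansion along the
  first row; the expansion along the node \<open>y\<close> uses
  \<open>pfaffian_core\<close> with \<open>w = X y\<close>.\<close>

lemma pfaffian_even:
  fixes X \<kappa> \<alpha> \<beta> \<gamma> \<delta> :: "'a \<Rightarrow> real"
  assumes Nil: "G [] = 1"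
    and Cons: "\<And>y xs. odd (length xs) \<Longrightarrow> G (y # xs) = wedge (Q y) G xs"
    and Q: "\<And>y x. y \<in> S \<Longrightarrow> x \<in> S \<Longrightarrow> X y \<noteq> X x \<Longrightarrow>
       Q y x * (X y - X x) = \<kappa> y * \<kappa> x * ((\<alpha> y * \<beta> x - \<beta> y * \<alpha> x) * (\<gamma> y * \<delta> x - \<delta> y * \<gamma> x))"
    and "length xs = 2 * p" "set xs \<subseteq> S" "distinct (map X xs)"
  shows "G xs * vander (map X xs)
     = prod_list (map \<kappa> xs) * two_form X \<alpha> \<beta> p xs * two_form X \<gamma> \<delta> p xs"
  using assms(4-6)
proof (induction p arbitrary: xs)
  case 0
  then show ?case by (simp add: Nil)
next
  case (Suc p)
  then obtain y ys where xs: "xs = y # ys" "length ys = Suc (2 * p)" by (cases xs) auto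
  let ?w = "X y"
  let ?\<phi> = "\<lambda>x. \<alpha> y * \<beta> x - \<beta> y * \<alpha> x" and ?\<psi> = "\<lambda>x. \<gamma> y * \<delta> x - \<delta> y * \<gamma> x"
  have w: "?w \<notin> X ` set ys" and dist: "distinct (map X ys)"
    using Suc.prems by (auto simp: xs)
  let ?W = "wedge (\<lambda>x. ?\<phi> x / (?w - X x)) (two_form X \<alpha> \<beta> p) ys"
  let ?W' = "wedge (\<lambda>x. ?\<psi> x / (?w - X x)) (two_form X \<gamma> \<delta> p) ys"
  let ?O = "\<Prod>x\<leftarrow>ys. ?w - X x"
  have core: "wedge (\<lambda>x. \<kappa> x * ?\<phi> x * ?\<psi> x / (?w - X x)) G ys * vander (map X ys)
    = prod_list (map \<kappa> ys) * ?O * ?W * ?W'"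
    by (rule pfaffian_core[OF xs(2) dist w, of G \<kappa> \<alpha> \<beta> \<gamma> \<delta> _ "- \<beta> y" "\<alpha> y" _ "- \<delta> y" "\<gamma> y"])
       (use Suc.IH Suc.prems xs in auto)
  have "G xs = wedge (Q y) G ys"
    using xs by (simp add: Cons del: wedge.simps)
  also have "\<dots> = wedge (\<lambda>x. \<kappa> y * (\<kappa> x * ?\<phi> x * ?\<psi> x / (?w - X x))) G ys"
  proof (rule wedge_cong)
    fix x assume x: "x \<in> set ys"
    then have "X y \<noteq> X x" using w by auto
    moreover from this have "Q y x * (X y - X x) = \<kappa> y * \<kappa> x * (?\<phi> x * ?\<psi> x)"
      using Q[of y x] x Suc.prems xs by auto
    ultimately show "Q y x = \<kappa> y * (\<kappa> x * ?\<phi> x * ?\<psi> x / (?w - X x))"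
      by (simp add: eq_divide_eq mult_ac)
  qed simp
  finally have GG: "G xs = \<kappa> y * wedge (\<lambda>x. \<kappa> x * ?\<phi> x * ?\<psi> x / (?w - X x)) G ys"
    by (simp only: wedge_scale_left)
  have "odd (length ys)" using xs by simp
  then have E: "two_form X \<alpha> \<beta> (Suc p) xs = ?O * ?W" "two_form X \<gamma> \<delta> (Suc p) xs = ?O * ?W'"
    unfolding xs(1) two_form_Cons[OF w] wedge_divide_swap prod_list_diff_swap[OF \<open>odd (length ys)\<close>]
    by simp_all
  have "G xs * vander (map X xs) = \<kappa> y * ?O * (wedge (\<lambda>x. \<kappa> x * ?\<phi> x * ?\<psi> x / (?w - X x)) G ys * vander (map X ys))"
    unfolding GG by (simp add: xs(1) comp_def)
  also have "\<dots> = prod_list (map \<kappa> xs) * (?O * ?W) * (?O * ?W')"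
    unfolding core by (simp add: xs(1))
  finally show ?case unfolding E .
qed

text \<open>The analogue for a Pfaffian bordered by a one-form with a single pole in \<open>X\<close> at \<open>w\<close>.\<close>

lemma pfaffian_odd:
  fixes X \<kappa> \<alpha> \<beta> \<gamma> \<delta> :: "'a \<Rightarrow> real"
  assumes "length xs = Suc (2 * p)" "distinct (map X xs)" "w \<notin> X ` set xs"
    and "\<And>zs. length zs = 2 * p \<Longrightarrow> set zs \<subseteq> set xs \<Longrightarrow> distinct (map X zs) \<Longrightarrow>
      G zs * vander (map X zs)
        = prod_list (map \<kappa> zs) * two_form X \<alpha> \<beta> p zs * two_form X \<gamma> \<delta> p zs"
    and Q: "\<And>x. x \<in> set xs \<Longrightarrow> Q x * (X x - w) = \<kappa> x * (\<alpha> x + \<beta> x) * (\<gamma> x + \<delta> x)"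
  shows "wedge Q G xs * vander (map X xs)
     = prod_list (map \<kappa> xs) * (\<Prod>x\<leftarrow>xs. X x - w)
       * wedge (\<lambda>x. (\<alpha> x + \<beta> x) / (X x - w)) (two_form X \<alpha> \<beta> p) xs
       * wedge (\<lambda>x. (\<gamma> x + \<delta> x) / (X x - w)) (two_form X \<gamma> \<delta> p) xs"
proof -
  have "odd (length xs)" using assms(1) by simp
  have "wedge Q G xs = wedge (\<lambda>x. \<kappa> x * (\<alpha> x + \<beta> x) * (\<gamma> x + \<delta> x) / (X x - w)) G xs"
    by (rule wedge_cong) (use assms(3) Q in \<open>auto simp: eq_divide_eq\<close>)
  moreover have "wedge (\<lambda>x. \<kappa> x * (\<alpha> x + \<beta> x) * (\<gamma> x + \<delta> x) / (w - X x)) G xs * vander (map X xs)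
    = prod_list (map \<kappa> xs) * (\<Prod>x\<leftarrow>xs. w - X x)
       * wedge (\<lambda>x. (\<alpha> x + \<beta> x) / (w - X x)) (two_form X \<alpha> \<beta> p) xs
       * wedge (\<lambda>x. (\<gamma> x + \<delta> x) / (w - X x)) (two_form X \<gamma> \<delta> p) xs"
    by (rule pfaffian_core[OF assms(1-4), of _ 1 1 _ 1 1]) auto
  ultimately show ?thesis
    unfolding wedge_divide_swap prod_list_diff_swap[OF \<open>odd (length xs)\<close>] by simp
qed

section \<open>Alternants with exponents in arithmetic progression\<close>

lemma wedge_pair_drop_low:
  assumes g: "wedge g T = (\<lambda>_. 0)" and h: "wedge h T = (\<lambda>_. 0)"
  shows "wedge (\<lambda>x. u x + g x) (wedge (\<lambda>x. v x + h x) T) = wedge u (wedge v T)"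
proof
  fix xs
  have 1: "wedge (\<lambda>x. v x + h x) T = wedge v T"
    using h by (auto simp: wedge_add_left)
  have "wedge g (wedge v T) xs = - wedge v (wedge g T) xs"
    by (rule wedge_anticommute)
  then have "wedge g (wedge v T) xs = 0" by (simp add: g)
  then show "wedge (\<lambda>x. u x + g x) (wedge (\<lambda>x. v x + h x) T) xs = wedge u (wedge v T) xs"
    unfolding 1 wedge_add_left by simp
qed

text \<open>The two rows \<open>\<alpha> a + \<beta> b\<close> and \<open>\<beta> a + \<alpha> b\<close> have the leading terms \<open>\<alpha> X^k\<close> and
  \<open>\<beta> X^k\<close>; everything else lies in the span of the rows already present.\<close>

lemma wedge_pair_monic_two_form:
  assumes a: "degree a = k" "lead_coeff a = 1" and b: "\<And>i. i \<ge> k \<Longrightarrow> coeff b i = 0"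
  shows "wedge (\<lambda>x. \<alpha> x * poly a (X x) + \<beta> x * poly b (X x))
           (wedge (\<lambda>x. \<beta> x * poly a (X x) + \<alpha> x * poly b (X x)) (two_form X \<alpha> \<beta> k))
         = two_form X \<alpha> \<beta> (Suc k)"
proof -
  define g where "g = (\<lambda>x. (\<Sum>i<k. coeff a i * (\<alpha> x * X x ^ i)) + (\<Sum>i<k. coeff b i * (\<beta> x * X x ^ i)))"
  define h where "h = (\<lambda>x. (\<Sum>i<k. coeff a i * (\<beta> x * X x ^ i)) + (\<Sum>i<k. coeff b i * (\<alpha> x * X x ^ i)))"
  have pa: "poly a y = y ^ k + (\<Sum>i<k. coeff a i * y ^ i)" for y
    using a by (simp add: poly_altdef lessThan_Suc_atMost[symmetric])
  have "degree b \<le> k" by (rule degree_le) (use b in auto)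
  then have "poly b y = (\<Sum>i\<le>k. coeff b i * y ^ i)" for y
    unfolding poly_altdef by (intro sum.mono_neutral_left) (auto simp: coeff_eq_0)
  then have pb: "poly b y = (\<Sum>i<k. coeff b i * y ^ i)" for y
    using b[of k] by (simp add: lessThan_Suc_atMost[symmetric])
  have 1: "(\<lambda>x. \<alpha> x * poly a (X x) + \<beta> x * poly b (X x)) = (\<lambda>x. \<alpha> x * X x ^ k + g x)"
    "(\<lambda>x. \<beta> x * poly a (X x) + \<alpha> x * poly b (X x)) = (\<lambda>x. \<beta> x * X x ^ k + h x)"
    by (simp_all add: pa pb g_def h_def sum_distrib_left algebra_simps)
  have "wedge g (two_form X \<alpha> \<beta> k) = (\<lambda>_. 0)" "wedge h (two_form X \<alpha> \<beta> k) = (\<lambda>_. 0)"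
    unfolding g_def h_def
    by (auto simp: wedge_add_left wedge_sum_left wedge_scale_left wedge_low_two_form)
  then show ?thesis
    unfolding 1 two_form.simps by (rule wedge_pair_drop_low)
qed

text \<open>The Chebyshev polynomials of the second kind, normalized to be monic: \<open>chebU k\<close> at \<open>t + 1/t\<close> is
  \<open>(t^(k + 1) - t^(- k - 1)) / (t - 1/t)\<close>.\<close>

fun chebU :: "nat \<Rightarrow> real poly" where
  "chebU 0 = 1"
| "chebU (Suc 0) = [:0, 1:]"
| "chebU (Suc (Suc k)) = pCons 0 (chebU (Suc k)) - chebU k"

lemma chebU_monic: "degree (chebU k) = k \<and> lead_coeff (chebU k) = 1"
proof (induction k rule: chebU.induct)
  case (3 k)
  then have "chebU (Suc k) \<noteq> 0" by auto
  then have d: "degree (pCons 0 (chebU (Suc k))) = Suc (Suc k)" using 3 by simp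
  then have "degree (chebU (Suc (Suc k))) = Suc (Suc k)"
    using 3 degree_add_eq_left[of "- chebU k" "pCons 0 (chebU (Suc k))"] by simp
  moreover have "coeff (chebU (Suc k)) (Suc k) = 1" "coeff (chebU k) (Suc (Suc k)) = 0"
    using 3 by (auto simp: coeff_eq_0)
  ultimately show ?case by simp
qed auto

lemma recip_three_term:
  assumes "x > 0"
  shows "xvar x * recip e (Suc (Suc k)) x = recip e (k + 4) x + recip e k x"
  using assms unfolding xvar_def recip_def power_add power_Suc
  by (simp add: field_simps power2_eq_square power4_eq_xxxx)

lemma recip_two_term:
  assumes "x > 0"
  shows "recip 1 1 x * recip e (Suc k) x = recip e (Suc (Suc k)) x + recip e k x"
  using assms unfolding recip_def power_Suc
  by (simp add: field_simps)

text \<open>The \<open>m\<close> exponents \<open>N + m - 1, N + m - 3, ..., N - m + 1\<close>, symmetric around \<open>N\<close>.\<close>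

definition arith_desc :: "nat \<Rightarrow> nat \<Rightarrow> nat list" where
  "arith_desc N m = map (\<lambda>i. N + m - 1 - 2 * i) [0..<m]"

lemma arith_desc_length [simp]: "length (arith_desc N m) = m"
  by (simp add: arith_desc_def)

lemma arith_desc_Suc_Suc:
  assumes "m \<le> N"
  shows "arith_desc N (Suc (Suc m)) = (N + m + 1) # arith_desc N m @ [N - m - 1]"
  using assms
  by (auto simp: arith_desc_def nth_append nth_Cons' intro!: nth_equalityI)

text \<open>The continuation of \<open>- chebU (k - 1)\<close> to \<open>k = 0\<close> by the same recurrence, so that
  \<open>recip_up\<close> and \<open>recip_down\<close> need no case distinction.\<close>

definition chebU_prev :: "nat \<Rightarrow> real poly" where
  "chebU_prev k = (case k of 0 \<Rightarrow> 0 | Suc j \<Rightarrow> - chebU j)"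

lemma chebU_prev_simps [simp]: "chebU_prev 0 = 0" "chebU_prev (Suc 0) = -1"
  by (simp_all add: chebU_prev_def)

lemma chebU_prev_Suc_Suc [simp]: "chebU_prev (Suc (Suc k)) = pCons 0 (chebU_prev (Suc k)) - chebU_prev k"
proof (cases k)
  case 0
  then show ?thesis by (simp add: chebU_prev_def one_pCons)
next
  case (Suc j)
  then show ?thesis by (simp add: chebU_prev_def)
qed

lemma coeff_chebU_prev: "k \<le> i \<Longrightarrow> coeff (chebU_prev k) i = 0"
  using chebU_monic by (cases k) (auto simp: chebU_prev_def coeff_eq_0)

lemma recip_three_term':
  assumes "x > 0" "2 \<le> k"
  shows "xvar x * recip e k x = recip e (k + 2) x + recip e (k - 2) x"
  using recip_three_term[of x e "k - 2"] assms
  by (simp add: numeral_2_eq_2 numeral_eq_Suc Suc_diff_Suc)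

text \<open>The functions \<open>recip e (N + 1 + 2 k)\<close> obey a three-term recurrence with multiplier \<open>xvar\<close>; hence they are
  combinations of two neighbours with Chebyshev coefficients, here and downwards in \<open>recip_down\<close>.\<close>

lemma recip_up:
  assumes "x > 0" "N \<ge> 1"
  shows "recip e (N + 1 + 2 * k) x
      = recip e (N + 1) x * poly (chebU k) (xvar x) + recip e (N - 1) x * poly (chebU_prev k) (xvar x)"
proof (induction k rule: chebU.induct)
  case 2
  show ?case using recip_three_term'[OF assms(1), of "N + 1" e] assms(2)
    by (simp add: numeral_eq_Suc algebra_simps)
next
  case (3 k)
  have "recip e (N + 1 + 2 * Suc (Suc k)) x = xvar x * recip e (N + 1 + 2 * Suc k) x - recip e (N + 1 + 2 * k) x"
    using recip_three_term'[OF assms(1), of "N + 1 + 2 * Suc k" e] by simp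
  then show ?case unfolding 3 by (simp add: algebra_simps)
qed auto

lemma recip_down:
  assumes "x > 0"
  shows "2 * k + 1 \<le> N \<Longrightarrow> recip e (N - 1 - 2 * k) x
      = recip e (N - 1) x * poly (chebU k) (xvar x) + recip e (N + 1) x * poly (chebU_prev k) (xvar x)"
proof (induction k rule: chebU.induct)
  case 2
  have "N - 1 + 2 = N + 1" "N - 1 - 2 = N - 1 - 2 * Suc 0" using 2 by auto
  then show ?case using recip_three_term'[OF assms(1), of "N - 1" e] 2
    by (simp add: algebra_simps)
next
  case (3 k)
  have "N - 1 - 2 * Suc k + 2 = N - 1 - 2 * k" "N - 1 - 2 * Suc k - 2 = N - 1 - 2 * Suc (Suc k)"
    using 3 by auto
  then have "recip e (N - 1 - 2 * Suc (Suc k)) x = xvar x * recip e (N - 1 - 2 * Suc k) x - recip e (N - 1 - 2 * k) x"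
    using recip_three_term'[OF assms(1), of "N - 1 - 2 * Suc k" e] 3 by simp
  moreover have "2 * Suc k + 1 \<le> N" "2 * k + 1 \<le> N" using 3 by auto
  ultimately show ?case using 3 by (simp add: algebra_simps)
qed auto

lemma wedge_cong_pos:
  assumes "\<And>x. x > 0 \<Longrightarrow> v x = w x" "\<And>zs. set zs \<subseteq> {0<..} \<Longrightarrow> G zs = H zs" "set xs \<subseteq> {0<..}"
  shows "wedge v G xs = wedge w H xs"
  by (rule wedge_cong) (use assms in auto)

lemma alternant_outer:
  "alternant (a # fs @ [b]) = (\<lambda>xs. (-1) ^ length fs * wedge a (wedge b (alternant fs)) xs)"
proof
  fix xs
  have "alternant (fs @ [b]) = (\<lambda>xs. (-1) ^ length fs * wedge b (alternant fs) xs)"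
    using alternant_move_last[of fs b] by auto
  then show "alternant (a # fs @ [b]) xs = (-1) ^ length fs * wedge a (wedge b (alternant fs)) xs"
    by (simp add: wedge_scale_right)
qed

text \<open>Rows are added in pairs, one above and one below the exponents already present. Moving the lower row
  to the end of the list passes an even number of rows.\<close>

lemma two_form_eq_alternant:
  assumes "set xs \<subseteq> {0<..}" "2 * p \<le> N + 1"
  shows "two_form xvar (recip e (N + 1)) (recip e (N - 1)) p xs = alternant (map (recip e) (arith_desc N (2 * p))) xs"
  using assms
proof (induction p arbitrary: xs)
  case 0
  then show ?case by (simp add: arith_desc_def)
next
  case (Suc p)
  let ?\<alpha> = "recip e (N + 1)" and ?\<beta> = "recip e (N - 1)"
  have N: "2 * p + 1 \<le> N" "N \<ge> 1" using Suc.prems by auto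
  have "two_form xvar ?\<alpha> ?\<beta> (Suc p) xs
     = wedge (\<lambda>x. ?\<alpha> x * poly (chebU p) (xvar x) + ?\<beta> x * poly (chebU_prev p) (xvar x))
           (wedge (\<lambda>x. ?\<beta> x * poly (chebU p) (xvar x) + ?\<alpha> x * poly (chebU_prev p) (xvar x)) (two_form xvar ?\<alpha> ?\<beta> p)) xs"
    by (subst wedge_pair_monic_two_form) (use chebU_monic[of p] coeff_chebU_prev in auto)
  also have "\<dots> = wedge (recip e (N + 1 + 2 * p)) (wedge (recip e (N - 1 - 2 * p))
        (alternant (map (recip e) (arith_desc N (2 * p))))) xs"
    using Suc.prems N
    by (intro wedge_cong_pos Suc.IH recip_up[symmetric] recip_down[symmetric]) auto
  also have "\<dots> = alternant (map (recip e) (arith_desc N (2 * Suc p))) xs"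
    using N arith_desc_Suc_Suc[of "2 * p" N]
    by (simp add: alternant_outer add_ac del: alternant_Cons)
  finally show ?case .
qed

text \<open>Multiplying the rows by \<open>x + 1/x\<close> turns exponents of one parity into sums of two neighbours of the
  other parity. Together with the middle row \<open>recip e N\<close> these sums generate all exponents around \<open>N\<close>. The sign arises
  because the lower rows now pass an odd number of rows.\<close>

lemma scaled_two_form_eq_alternant:
  assumes "set xs \<subseteq> {0<..}" "2 * p \<le> N"
  shows "wedge (recip e N) (\<lambda>zs. prod_list (map (recip 1 1) zs) * two_form xvar (recip e (N + 1)) (recip e (N - 1)) p zs) xs
       = (-1) ^ p * alternant (map (recip e) (arith_desc N (2 * p + 1))) xs"
proof -
  let ?s = "recip 1 1"
  define C where "C p = (\<lambda>zs. prod_list (map ?s zs) * alternant (map (recip e) (arith_desc N (2 * p))) zs)" for p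
  define B where "B p = (\<lambda>xs. (-1) ^ p * alternant (map (recip e) (arith_desc N (2 * p + 1))) xs)" for p
  have B0: "B 0 = wedge (recip e N) unit_form"
    by (simp add: B_def arith_desc_def)
  have BS: "B (Suc p) = wedge (recip e (N + 2 * p + 2)) (wedge (recip e (N - 2 * p - 2)) (B p))"
    if "2 * p + 2 \<le> N" for p
  proof -
    have "alternant (map (recip e) (arith_desc N (2 * Suc p + 1)))
        = (\<lambda>xs. - wedge (recip e (N + 2 * p + 2)) (wedge (recip e (N - 2 * p - 2)) (alternant (map (recip e) (arith_desc N (2 * p + 1))))) xs)"
    proof -
      have "arith_desc N (2 * Suc p + 1) = (N + 2 * p + 2) # arith_desc N (2 * p + 1) @ [N - 2 * p - 2]"
        using that arith_desc_Suc_Suc[of "2 * p + 1" N] by simp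
      then show ?thesis
        by (simp add: alternant_outer del: alternant_Cons)
    qed
    then show ?thesis
      unfolding B_def wedge_scale_form by (simp add: fun_eq_iff)
  qed
  have low: "wedge (recip e (N + 2 * p)) (B p) = (\<lambda>_. 0) \<and> wedge (recip e (N - 2 * p)) (B p) = (\<lambda>_. 0)"
    if "2 * p \<le> N" for p
  proof (cases p)
    case 0
    then show ?thesis by (auto simp: B0)
  next
    case (Suc k)
    then have "B p = wedge (recip e (N + 2 * p)) (wedge (recip e (N - 2 * p)) (B k))"
      using BS[of k] that by (simp add: algebra_simps)
    then show ?thesis by (auto simp: wedge_self_inner)
  qed
  have CS: "C (Suc p) xs = wedge (\<lambda>x. recip e (N + 2 * p + 2) x + recip e (N + 2 * p) x)
      (wedge (\<lambda>x. recip e (N - 2 * p - 2) x + recip e (N - 2 * p) x) (C p)) xs"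
    if "2 * p + 2 \<le> N" "set xs \<subseteq> {0<..}" for p xs
  proof -
    have "C (Suc p) xs = wedge (\<lambda>x. ?s x * recip e (N + 2 * p + 1) x)
      (\<lambda>zs. prod_list (map ?s zs) * wedge (recip e (N - 2 * p - 1)) (alternant (map (recip e) (arith_desc N (2 * p)))) zs) xs"
      unfolding C_def using that arith_desc_Suc_Suc[of "2 * p" N]
      by (simp add: alternant_outer wedge_scale_nodes del: alternant_Cons)
    also have "\<dots> = wedge (\<lambda>x. ?s x * recip e (N + 2 * p + 1) x)
      (wedge (\<lambda>x. ?s x * recip e (N - 2 * p - 1) x) (C p)) xs"
      unfolding C_def wedge_scale_nodes ..
    also have "\<dots> = wedge (\<lambda>x. recip e (N + 2 * p + 2) x + recip e (N + 2 * p) x)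
      (wedge (\<lambda>x. recip e (N - 2 * p - 2) x + recip e (N - 2 * p) x) (C p)) xs"
    proof (intro wedge_cong_pos)
      fix x :: real assume "x > 0"
      then show "?s x * recip e (N + 2 * p + 1) x = recip e (N + 2 * p + 2) x + recip e (N + 2 * p) x"
        using recip_two_term[of x e "N + 2 * p"] by simp
      have "N - 2 * p - 1 = Suc (N - 2 * p - 2)" "Suc (Suc (N - 2 * p - 2)) = N - 2 * p"
        using that by auto
      then show "?s x * recip e (N - 2 * p - 1) x = recip e (N - 2 * p - 2) x + recip e (N - 2 * p) x"
        using recip_two_term[OF \<open>x > 0\<close>, of e "N - 2 * p - 2"] by simp
    qed (use that in auto)
    finally show ?thesis .
  qed
  have main: "wedge (recip e N) (C p) xs = B p xs" if "2 * p \<le> N" "set xs \<subseteq> {0<..}" for p xs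
    using that
  proof (induction p arbitrary: xs)
    case 0
    have "C 0 = unit_form"
      unfolding C_def by (auto simp: arith_desc_def fun_eq_iff unit_form_def)
    then show ?case by (simp add: B0)
  next
    case (Suc p)
    let ?a = "\<lambda>x. recip e (N + 2 * p + 2) x + recip e (N + 2 * p) x"
    let ?b = "\<lambda>x. recip e (N - 2 * p - 2) x + recip e (N - 2 * p) x"
    have "wedge (recip e N) (C (Suc p)) xs = wedge (recip e N) (wedge ?a (wedge ?b (C p))) xs"
      using Suc.prems by (intro wedge_cong_pos CS) auto
    also have "\<dots> = wedge ?a (wedge ?b (wedge (recip e N) (C p))) xs"
      by (simp only: wedge_past_pair)
    also have "\<dots> = wedge ?a (wedge ?b (B p)) xs"
      using Suc.prems by (intro wedge_cong_pos Suc.IH) auto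
    also have "\<dots> = B (Suc p) xs"
      using low[of p] Suc.prems BS[of p] by (subst wedge_pair_drop_low) auto
    finally show ?case .
  qed
  have "wedge (recip e N) (\<lambda>zs. prod_list (map ?s zs) * two_form xvar (recip e (N + 1)) (recip e (N - 1)) p zs) xs
      = wedge (recip e N) (C p) xs"
    unfolding C_def using assms
    by (intro wedge_cong_pos) (auto simp: two_form_eq_alternant simp del: One_nat_def)
  then show ?thesis using main[of p xs] assms by (simp add: B_def)
qed

lemma xvar_inj:
  assumes "0 < x" "x < 1" "0 < y" "y < 1" "xvar x = xvar y"
  shows "x = y"
proof -
  have "(x\<^sup>2 - y\<^sup>2) * (x\<^sup>2 * y\<^sup>2 - 1) = 0"
    using assms by (simp add: xvar_def recip_def field_simps)
  moreover have "x * y < 1"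
    using assms mult_strict_mono[of x 1 y 1] by simp
  then have "x\<^sup>2 * y\<^sup>2 < 1"
    using assms by (simp add: power_mult_distrib[symmetric] power_less_one_iff)
  ultimately have "x\<^sup>2 = y\<^sup>2" by auto
  then show ?thesis using assms by (simp add: power2_eq_iff)
qed

lemma recip_split:
  assumes "x > 0" "N \<ge> 1"
  shows "recip e (N + 1) x + recip e (N - 1) x = recip 1 1 x * recip e N x"
  using recip_two_term[OF assms(1), of e "N - 1"] assms(2) by simp

lemma recip_neg:
  assumes "0 < x" "x < 1"
  shows "recip (-1) 1 x < 0"
proof -
  have "x * x < 1" using assms mult_strict_mono[of x 1 x 1] by auto
  then show ?thesis using assms by (simp add: recip_def field_simps)
qed

text \<open>For \<open>m\<close> nodes the sum of all maximal minors is a product of two determinants of rectangular shape (characters of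
  orthogonal type) over a Vandermonde product. For odd \<open>m\<close> the pole \<open>w = - 2\<close> comes from \<open>xvar x + 2 = (x + 1/x)^2\<close>;
  the two signs \<open>(-1)^p\<close> of \<open>scaled_two_form_eq_alternant\<close> cancel.\<close>

lemma subset_form_product:
  assumes n: "n \<ge> 1" and m: "length xs \<le> n" and xs: "set xs \<subseteq> {0<..<1}" "distinct xs"
  shows "subset_form evenpow n xs * vander (map xvar xs) * prod_list (map (recip (-1) 1) xs)
    = alternant (map (recip (-1)) (arith_desc n (length xs))) xs
      * alternant (map (recip 1) (arith_desc (n + 1) (length xs))) xs"
proof -
  \<comment> \<open>the two-form has the denominators \<open>recip (-1) 1\<close>, which become the node factors of the Pfaffian\<close>
  define \<kappa> where "\<kappa> x = inverse (recip (-1) 1 x)" for x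
  let ?\<alpha> = "recip (-1) (n + 1)" and ?\<beta> = "recip (-1) (n - 1)"
  let ?\<gamma> = "recip 1 (n + 1 + 1)" and ?\<delta> = "recip 1 (n + 1 - 1)"
  let ?G = "subset_form evenpow n"
  obtain k where k: "n = Suc k" using n by (cases n) auto
  have sg1: "recip (-1) 1 x < 0" if "x \<in> {0<..<1}" for x :: real
    using that by (intro recip_neg) auto
  have dist: "distinct (map xvar zs)" if "set zs \<subseteq> {0<..<1}" "distinct zs" for zs
    using that by (auto simp: distinct_map inj_on_def intro!: xvar_inj)
  have Q: "pair_sum evenpow n y x * (xvar y - xvar x) = \<kappa> y * \<kappa> x * ((?\<alpha> y * ?\<beta> x - ?\<beta> y * ?\<alpha> x) * (?\<gamma> y * ?\<delta> x - ?\<delta> y * ?\<gamma> x))"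
    if "y \<in> {0<..<1}" "x \<in> {0<..<1}" for x y
    using pair_sum_evenpow[of y x k] that sg1[OF that(1)] sg1[OF that(2)]
    by (simp add: k casorati_def \<kappa>_def field_simps)
  have even: "?G zs * vander (map xvar zs)
     = prod_list (map \<kappa> zs) * two_form xvar ?\<alpha> ?\<beta> p zs * two_form xvar ?\<gamma> ?\<delta> p zs"
    if "length zs = 2 * p" "set zs \<subseteq> {0<..<1}" "distinct (map xvar zs)" for zs p
  proof (rule pfaffian_even[OF _ _ _ that])
    show "?G [] = 1"
      by (induction n) auto
    show "?G (y # ys) = wedge (pair_sum evenpow n y) ?G ys" if "odd (length ys)" for y ys
      using that by (rule subset_form_Cons)
  qed (rule Q)
  have kp: "prod_list (map \<kappa> xs) * prod_list (map (recip (-1) 1) xs) = 1"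
    using xs(1)
  proof (induction xs)
    case (Cons x xs)
    then show ?case using sg1[of x] by (simp add: \<kappa>_def mult_ac)
  qed simp
  have pos: "set xs \<subseteq> {0<..}" using xs(1) by auto
  show ?thesis
  proof (cases "even (length xs)")
    case True
    then obtain p where p: "length xs = 2 * p" by blast
    have "?G xs * vander (map xvar xs) * prod_list (map (recip (-1) 1) xs)
      = two_form xvar ?\<alpha> ?\<beta> p xs * two_form xvar ?\<gamma> ?\<delta> p xs
        * (prod_list (map \<kappa> xs) * prod_list (map (recip (-1) 1) xs))"
      unfolding even[OF p xs(1) dist[OF xs]] by (simp add: mult_ac)
    moreover have "two_form xvar ?\<alpha> ?\<beta> p xs = alternant (map (recip (-1)) (arith_desc n (2 * p))) xs"
      using m p pos by (intro two_form_eq_alternant) auto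
    moreover have "two_form xvar ?\<gamma> ?\<delta> p xs = alternant (map (recip 1) (arith_desc (n + 1) (2 * p))) xs"
      using m p pos by (intro two_form_eq_alternant) auto
    ultimately show ?thesis
      unfolding kp p by simp
  next
    case False
    then obtain p where p: "length xs = Suc (2 * p)" by (metis oddE Suc_eq_plus1)
    have w: "- 2 \<notin> xvar ` set xs"
    proof
      assume "- 2 \<in> xvar ` set xs"
      then obtain x where "x > 0" "xvar x = -2" using pos by auto
      moreover have "xvar x > 0" using \<open>x > 0\<close> by (simp add: xvar_def recip_def add_pos_pos)
      ultimately show False by simp
    qed
    have s2: "xvar x + 2 = recip 1 1 x * recip 1 1 x" "recip 1 1 x > 0" if "x > 0" for x
      using that by (simp_all add: xvar_def recip_def field_simps power2_eq_square add_pos_pos)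
    have c: "single_sum evenpow n x * (xvar x - - 2) = \<kappa> x * (?\<alpha> x + ?\<beta> x) * (?\<gamma> x + ?\<delta> x)"
      if "x \<in> set xs" for x
    proof -
      have x: "x \<in> {0<..<1}" "x > 0" using that xs(1) by auto
      have "single_sum evenpow n x * recip (-1) 1 x = recip (-1) n x * recip 1 (Suc n) x"
        using x by (intro single_sum_evenpow) auto
      then have "single_sum evenpow n x = \<kappa> x * (recip (-1) n x * recip 1 (Suc n) x)"
        using sg1[OF x(1)] by (simp add: \<kappa>_def field_simps)
      then show ?thesis
        using s2[OF x(2)] recip_split[OF x(2) n, of "-1"] recip_split[OF x(2), of "n + 1" 1]
        by simp
    qed
    have W: "(\<Prod>x\<leftarrow>xs. recip 1 1 x) * wedge (\<lambda>x. (recip e (N + 1) x + recip e (N - 1) x) / (xvar x - - 2)) (two_form xvar (recip e (N + 1)) (recip e (N - 1)) p) xs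
        = (-1) ^ p * alternant (map (recip e) (arith_desc N (2 * p + 1))) xs" (is "?l = _") if "N \<ge> n" for e N
    proof -
      let ?T = "\<lambda>zs. prod_list (map (recip 1 1) zs) * two_form xvar (recip e (N + 1)) (recip e (N - 1)) p zs"
      have "?l = wedge (\<lambda>x. recip 1 1 x * ((recip e (N + 1) x + recip e (N - 1) x) / (xvar x - - 2)))
           ?T xs"
        by (simp only: wedge_scale_nodes)
      also have "\<dots> = wedge (recip e N)
           ?T xs"
      proof (rule wedge_cong_pos)
        fix x :: real assume x: "x > 0"
        have "N \<ge> 1" using that n by simp
        then show "recip 1 1 x * ((recip e (N + 1) x + recip e (N - 1) x) / (xvar x - - 2)) = recip e N x"
          unfolding recip_split[OF x \<open>N \<ge> 1\<close>] using s2[OF x] by simp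
      qed (use pos in auto)
      also have "\<dots> = (-1) ^ p * alternant (map (recip e) (arith_desc N (2 * p + 1))) xs"
        using pos m p that by (intro scaled_two_form_eq_alternant) auto
      finally show ?thesis .
    qed
    let ?V = "wedge (\<lambda>x. (?\<alpha> x + ?\<beta> x) / (xvar x - - 2)) (two_form xvar ?\<alpha> ?\<beta> p) xs"
    let ?V' = "wedge (\<lambda>x. (?\<gamma> x + ?\<delta> x) / (xvar x - - 2)) (two_form xvar ?\<gamma> ?\<delta> p) xs"
    let ?s = "\<Prod>x\<leftarrow>xs. recip 1 1 x"
    have "(\<Prod>x\<leftarrow>xs. xvar x - - 2) = ?s * ?s"
      using pos by (induction xs) (auto simp: s2)
    moreover have "?G xs = wedge (single_sum evenpow n) ?G xs"
      using False by (simp add: subset_form_parity)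
    moreover have "wedge (single_sum evenpow n) ?G xs * vander (map xvar xs)
       = prod_list (map \<kappa> xs) * (\<Prod>x\<leftarrow>xs. xvar x - - 2) * ?V * ?V'"
      by (rule pfaffian_odd[OF p dist[OF xs] w _ c]) (use even xs(1) in auto)
    ultimately have "?G xs * vander (map xvar xs) = prod_list (map \<kappa> xs) * (?s * ?V) * (?s * ?V')"
      by (simp only: mult_ac)
    also have "?s * ?V = (-1) ^ p * alternant (map (recip (-1)) (arith_desc n (2 * p + 1))) xs"
      by (rule W) simp
    also have "?s * ?V' = (-1) ^ p * alternant (map (recip 1) (arith_desc (n + 1) (2 * p + 1))) xs"
      by (rule W) simp
    finally have *: "?G xs * vander (map xvar xs) = prod_list (map \<kappa> xs) * ((-1) ^ p * alternant (map (recip (-1)) (arith_desc n (2 * p + 1))) xs)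
       * ((-1) ^ p * alternant (map (recip 1) (arith_desc (n + 1) (2 * p + 1))) xs)" .
    have s: "(-1) ^ p * (-1) ^ p = (1 :: real)" by (simp flip: power_add)
    have "a * (s * b) * (s * c) * d = b * c" if "a * d = 1" "s * s = 1" for a b c d s :: real
      using that by algebra
    from this[OF kp s] show ?thesis
      unfolding * p by simp
  qed
qed

section \<open>The minor sum at geometric nodes\<close>

text \<open>The quotient of \<open>recip e (2 k + 1)\<close> by \<open>recip e 1\<close> as a polynomial in \<open>xvar\<close>, for \<open>e = 1\<close> and \<open>e = -1\<close>.\<close>

definition odd_cheb :: "real \<Rightarrow> nat \<Rightarrow> real poly" where
  "odd_cheb e k = chebU k + smult e (chebU_prev k)"

lemma odd_cheb_monic: "degree (odd_cheb e k) = k \<and> lead_coeff (odd_cheb e k) = 1"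
proof -
  have c: "coeff (odd_cheb e k) k = 1" "i > k \<Longrightarrow> coeff (odd_cheb e k) i = 0" for i
    using chebU_monic[of k] by (auto simp: odd_cheb_def coeff_chebU_prev coeff_eq_0)
  then have "degree (odd_cheb e k) = k" by (intro antisym degree_le le_degree) auto
  then show ?thesis using c by simp
qed

lemma recip_odd:
  assumes "x > 0" "e\<^sup>2 = 1"
  shows "recip e (2 * k + 1) x = recip e 1 x * poly (odd_cheb e k) (xvar x)"
proof (induction k rule: chebU.induct)
  case 2
  have "e * e = 1" using assms(2) by (simp add: power2_eq_square)
  then show ?case using assms(1)
    by (simp add: odd_cheb_def recip_def xvar_def field_simps power2_eq_square numeral_3_eq_3 numeral_2_eq_2)
next
  case (3 k)
  have "recip e (2 * Suc (Suc k) + 1) x = xvar x * recip e (2 * Suc k + 1) x - recip e (2 * k + 1) x"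
    using recip_three_term'[OF assms(1), of "2 * Suc k + 1" e] by simp
  then show ?case using 3 by (simp add: odd_cheb_def algebra_simps)
qed (simp add: odd_cheb_def)

lemma odd_alternant:
  assumes "e\<^sup>2 = 1" "set xs \<subseteq> {0<..}"
  shows "alternant (map (\<lambda>j. recip e (2 * j + 1)) (rev [0..<m])) xs = power_form xvar (recip e 1) m xs"
  using assms(2)
proof (induction m arbitrary: xs)
  case (Suc m)
  have "alternant (map (\<lambda>j. recip e (2 * j + 1)) (rev [0..<Suc m])) xs
     = wedge (recip e (2 * m + 1)) (alternant (map (\<lambda>j. recip e (2 * j + 1)) (rev [0..<m]))) xs"
    by simp
  also have "\<dots> = wedge (\<lambda>x. recip e 1 x * poly (odd_cheb e m) (xvar x)) (power_form xvar (recip e 1) m) xs"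
    using Suc.prems by (intro wedge_cong_pos Suc.IH recip_odd assms(1)) auto
  also have "\<dots> = power_form xvar (recip e 1) (Suc m) xs"
    using odd_cheb_monic[of e m] by (intro wedge_monic_power_form) auto
  finally show ?case .
qed simp

text \<open>The exponents decrease because \<open>power_form\<close> lists the highest power first.\<close>

definition nodes :: "real \<Rightarrow> nat \<Rightarrow> real list" where
  "nodes g m = map (\<lambda>j. g ^ (2 * j + 1)) (rev [0..<m])"

text \<open>At the nodes \<open>g^(2 j + 1)\<close> exponents and nodes play symmetric roles. The transposed determinant has rows
  \<open>recip e (2 j + 1)\<close>, which are \<open>recip e 1\<close> times monic polynomials in \<open>xvar\<close>, so it is a Vandermonde product.\<close>

lemma alternant_nodes:
  assumes "e\<^sup>2 = 1" "g > 0" "length es = m"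
  shows "alternant (map (recip e) es) (nodes g m)
    = (\<Prod>k\<leftarrow>es. recip e 1 (g ^ k)) * vander (map (\<lambda>k. xvar (g ^ k)) es)"
proof -
  have sw: "recip e k (g ^ (2 * j + 1)) = recip e (2 * j + 1) (g ^ k)" for k j
  proof -
    have "(g ^ (2 * j + 1)) ^ k = (g ^ k) ^ (2 * j + 1)"
      by (simp only: power_mult[symmetric] mult.commute)
    then show ?thesis by (simp only: recip_def)
  qed
  have "alternant (map (recip e) es) (nodes g m)
      = alternant (map (\<lambda>k j. recip e k (g ^ (2 * j + 1))) es) (rev [0..<m])"
  proof -
    have gen: "alternant (map (recip e) es) (map f js) = alternant (map (\<lambda>k j. recip e k (f j)) es) js"
      for f :: "nat \<Rightarrow> real" and js
    proof (induction es arbitrary: js)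
      case Nil
      then show ?case by (cases js) auto
    next
      case (Cons k es)
      have gen': "wedge v G (map f js) = wedge (\<lambda>j. v (f j)) (\<lambda>zs. G (map f zs)) js" for v G
        by (induction js arbitrary: G) auto
      show ?case by (simp add: gen' Cons)
    qed
    show ?thesis unfolding nodes_def by (rule gen)
  qed
  also have "\<dots> = alternant (map (\<lambda>j k. recip e k (g ^ (2 * j + 1))) (rev [0..<m])) es"
    by (rule alternant_transpose) (use assms in simp)
  also have "\<dots> = alternant (map (\<lambda>j k. recip e (2 * j + 1) (g ^ k)) (rev [0..<m])) es"
    by (simp only: sw)
  also have "\<dots> = alternant (map (\<lambda>j. recip e (2 * j + 1)) (rev [0..<m])) (map (\<lambda>k. g ^ k) es)"
  proof -
    have gen: "alternant (map (\<lambda>j. recip e (2 * j + 1)) js) (map f ks)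
        = alternant (map (\<lambda>j k. recip e (2 * j + 1) (f k)) js) ks"
      for f :: "nat \<Rightarrow> real" and js ks
    proof (induction js arbitrary: ks)
      case Nil
      then show ?case by (cases ks) auto
    next
      case (Cons k es)
      have gen': "wedge v G (map f js) = wedge (\<lambda>j. v (f j)) (\<lambda>zs. G (map f zs)) js" for v G js
        by (induction js arbitrary: G) auto
      show ?case by (simp add: gen' Cons del: One_nat_def)
    qed
    show ?thesis by (rule gen[symmetric])
  qed
  also have "\<dots> = power_form xvar (recip e 1) m (map (\<lambda>k. g ^ k) es)"
    using assms by (intro odd_alternant) auto
  also have "\<dots> = (\<Prod>k\<leftarrow>es. recip e 1 (g ^ k)) * vander (map (\<lambda>k. xvar (g ^ k)) es)"
    using assms by (subst power_form_eq_vander) (simp_all add: comp_def)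
  finally show ?thesis .
qed

lemma arith_desc_eq: "arith_desc (r + m) m = map (\<lambda>i. r + 1 + 2 * i) (rev [0..<m])"
  "arith_desc (r + m + 1) m = map (\<lambda>i. r + 2 + 2 * i) (rev [0..<m])"
  by (auto simp: arith_desc_def rev_nth intro!: nth_equalityI)

lemma prod_rev: "(\<Prod>i\<leftarrow>rev xs. f i) = (\<Prod>i\<leftarrow>xs. f i :: real)"
  by (induction xs) auto

lemma prod_rev_upt: "(\<Prod>i\<leftarrow>rev [0..<m]. f i) = (\<Prod>i<m. f i :: real)"
  unfolding prod_rev by (induction m) auto

lemma vander_rev_upt: "vander (map f (rev [0..<m])) = (\<Prod>i<m. \<Prod>k<i. f i - f k)"
proof (induction m)
  case (Suc m)
  have "(\<Prod>y\<leftarrow>map f (rev [0..<m]). f m - y) = (\<Prod>k<m. f m - f k)"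
    using prod_rev_upt[of "\<lambda>k. f m - f k" m] by (simp add: comp_def)
  then show ?case using Suc by (simp add: comp_def)
qed simp

text \<open>The Vandermonde product of a set, made independent of an enumeration by absolute values.\<close>

definition vander_set :: "(nat \<Rightarrow> real) \<Rightarrow> nat set \<Rightarrow> real" where
  "vander_set X L = (\<Prod>i\<in>L. \<Prod>j\<in>{j \<in> L. i < j}. \<bar>X i - X j\<bar>)"

lemma vander_set_insert_max:
  assumes "finite L" "\<And>l. l \<in> L \<Longrightarrow> l < M"
  shows "vander_set X (insert M L) = (\<Prod>l\<in>L. \<bar>X l - X M\<bar>) * vander_set X L"
proof -
  have M: "M \<notin> L" using assms by auto
  have "vander_set X (insert M L) = (\<Prod>j\<in>{j \<in> insert M L. M < j}. \<bar>X M - X j\<bar>)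
      * (\<Prod>i\<in>L. \<Prod>j\<in>{j \<in> insert M L. i < j}. \<bar>X i - X j\<bar>)"
    unfolding vander_set_def using assms M by simp
  also have "{j \<in> insert M L. M < j} = {}" using assms by force
  also have "(\<Prod>i\<in>L. \<Prod>j\<in>{j \<in> insert M L. i < j}. \<bar>X i - X j\<bar>)
      = (\<Prod>i\<in>L. \<bar>X i - X M\<bar> * (\<Prod>j\<in>{j \<in> L. i < j}. \<bar>X i - X j\<bar>))"
  proof (rule prod.cong)
    fix i assume "i \<in> L"
    then have "{j \<in> insert M L. i < j} = insert M {j \<in> L. i < j}" using assms by auto
    then show "(\<Prod>j\<in>{j \<in> insert M L. i < j}. \<bar>X i - X j\<bar>) = \<bar>X i - X M\<bar> * (\<Prod>j\<in>{j \<in> L. i < j}. \<bar>X i - X j\<bar>)"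
      using assms M by simp
  qed simp
  finally show ?thesis by (simp add: vander_set_def prod.distrib)
qed

lemma vander_sorted_list:
  assumes "finite L" "L \<subseteq> {1..}" "\<And>a b. 1 \<le> a \<Longrightarrow> a < b \<Longrightarrow> X a < X b"
  shows "vander (map X (rev (sorted_list_of_set L))) = vander_set X L"
  using assms(1,2)
proof (induction L rule: finite_linorder_max_induct)
  case (insert M L)
  have "L \<subseteq> {1..M - 1}" "M \<ge> 1" using insert by auto force+
  then have "sorted_list_of_set (insert M L) = sorted_list_of_set L @ [M]"
    using sorted_list_of_set_insert_top[of L "M - 1"] by simp
  moreover have "(\<Prod>y\<leftarrow>map X (rev (sorted_list_of_set L)). X M - y) = (\<Prod>l\<in>L. \<bar>X l - X M\<bar>)"
  proof -
    have "(\<Prod>y\<leftarrow>map X (rev (sorted_list_of_set L)). X M - y) = (\<Prod>l\<leftarrow>sorted_list_of_set L. X M - X l)"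
      using prod_rev[of "\<lambda>l. X M - X l"] by (simp add: comp_def)
    also have "\<dots> = (\<Prod>l\<in>L. X M - X l)"
      using insert by (simp add: prod.distinct_set_conv_list[symmetric])
    also have "\<dots> = (\<Prod>l\<in>L. \<bar>X l - X M\<bar>)"
      using insert assms(3) by (intro prod.cong) (auto simp: abs_if less_imp_le)
    finally show ?thesis .
  qed
  ultimately show ?case
    using insert by (simp add: vander_set_insert_max comp_def)
qed (simp add: vander_set_def)

lemma xvar_power_mono:
  assumes "0 < g" "g < 1" "(a::nat) < b"
  shows "xvar (g ^ a) < xvar (g ^ b)"
proof -
  define u v where "u = (g ^ a)\<^sup>2" and "v = (g ^ b)\<^sup>2"
  have u: "0 < v" "v < u" "u \<le> 1"
    using assms by (auto simp: u_def v_def power_strict_mono power_strict_decreasing power_le_one)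
  have "xvar (g ^ b) - xvar (g ^ a) = (u - v) * (1 - u * v) / (u * v)"
    using u by (simp add: xvar_def recip_def u_def[symmetric] v_def[symmetric] field_simps)
  moreover have "u * v < 1" using u mult_le_less_imp_less[of u 1 v 1] by simp
  then have "(u - v) * (1 - u * v) / (u * v) > 0" using u by (intro divide_pos_pos mult_pos_pos) auto
  ultimately show ?thesis by linarith
qed

text \<open>The closed form that \<open>subset_form_product\<close> yields at the nodes \<open>g^(2 j + 1)\<close>: three Vandermonde
  products in arithmetic progressions of exponents, two in the numerator and one in the denominator. It is arranged as a product over
  \<open>i < m\<close> so that the quotient for consecutive \<open>m\<close> can be read off.\<close>

definition odd_sum_value :: "real \<Rightarrow> nat \<Rightarrow> nat \<Rightarrow> real" where
  "odd_sum_value g r m = (\<Prod>i<m. recip (-1) 1 (g ^ (r + 1 + 2 * i)) * recip 1 1 (g ^ (r + 2 + 2 * i)) / recip (-1) 1 (g ^ (2 * i + 1))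
     * (\<Prod>k<i. (xvar (g ^ (r + 1 + 2 * i)) - xvar (g ^ (r + 1 + 2 * k)))
             * (xvar (g ^ (r + 2 + 2 * i)) - xvar (g ^ (r + 2 + 2 * k)))
             / (xvar (g ^ (2 * i + 1)) - xvar (g ^ (2 * k + 1)))))"

text \<open>The summand is the minor with rows \<open>L\<close>, by \<open>alternant_nodes\<close> with \<open>e = 1\<close> and exponents \<open>2 l\<close>.\<close>

lemma odd_subset_sum:
  assumes g: "0 < g" "g < 1" and n: "r + m \<ge> 1"
  shows "(\<Sum>L | L \<subseteq> {1..r + m} \<and> card L = m. (\<Prod>l\<in>L. recip 1 1 (g ^ (2 * l))) * vander_set (\<lambda>l. xvar (g ^ (2 * l))) L)
     = odd_sum_value g r m" (is "?S = _")
proof -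
  let ?n = "r + m"
  have "subset_form evenpow ?n (nodes g m) = (\<Sum>L\<in>Pow {1..?n}. alternant (map evenpow (rev (sorted_list_of_set L))) (nodes g m))"
    by (rule subset_form_eq_sum)
  also have "\<dots> = (\<Sum>L | L \<subseteq> {1..?n} \<and> card L = m. alternant (map evenpow (rev (sorted_list_of_set L))) (nodes g m))"
    by (rule sum.mono_neutral_right) (auto intro!: alternant_length_neq simp: nodes_def)
  also have "\<dots> = ?S"
  proof (rule sum.cong)
    fix L assume "L \<in> {L. L \<subseteq> {1..?n} \<and> card L = m}"
    then have L: "L \<subseteq> {1..?n}" "card L = m" by auto
    then have fin: "finite L" using finite_subset by blast
    have "map evenpow (rev (sorted_list_of_set L)) = map (recip 1) (map (\<lambda>l. 2 * l) (rev (sorted_list_of_set L)))"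
      by (simp add: evenpow_def[abs_def] mult_2 comp_def)
    then have "alternant (map evenpow (rev (sorted_list_of_set L))) (nodes g m)
       = (\<Prod>k\<leftarrow>map (\<lambda>l. 2 * l) (rev (sorted_list_of_set L)). recip 1 1 (g ^ k))
          * vander (map (\<lambda>k. xvar (g ^ k)) (map (\<lambda>l. 2 * l) (rev (sorted_list_of_set L))))"
      using L g by (simp only:) (rule alternant_nodes, auto)
    also have "(\<Prod>k\<leftarrow>map (\<lambda>l. 2 * l) (rev (sorted_list_of_set L)). recip 1 1 (g ^ k)) = (\<Prod>l\<in>L. recip 1 1 (g ^ (2 * l)))"
      using fin prod_rev[of "\<lambda>l. recip 1 1 (g ^ (2 * l))" "sorted_list_of_set L"]
      by (simp add: comp_def prod.distinct_set_conv_list[symmetric] del: One_nat_def)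
    also have "vander (map (\<lambda>k. xvar (g ^ k)) (map (\<lambda>l. 2 * l) (rev (sorted_list_of_set L))))
       = vander_set (\<lambda>l. xvar (g ^ (2 * l))) L"
      using fin L g by (subst vander_sorted_list[symmetric]) (auto simp: comp_def intro!: xvar_power_mono)
    finally show "alternant (map evenpow (rev (sorted_list_of_set L))) (nodes g m)
       = (\<Prod>l\<in>L. recip 1 1 (g ^ (2 * l))) * vander_set (\<lambda>l. xvar (g ^ (2 * l))) L" .
  qed simp
  finally have S: "?S
     = subset_form evenpow ?n (nodes g m)" by simp
  have nodes: "set (nodes g m) \<subseteq> {0<..<1}" "distinct (nodes g m)" "length (nodes g m) = m"
  proof -
    have "g ^ (2 * j + 1) < 1" for j
      using g power_Suc_less_one[of g "2 * j"] by simp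
    then show "set (nodes g m) \<subseteq> {0<..<1}" using g by (auto simp: nodes_def)
    have "inj (\<lambda>j. g ^ (2 * j + 1))"
    proof (rule injI)
      fix i j assume "g ^ (2 * i + 1) = g ^ (2 * j + 1)"
      then have "\<not> 2 * i + 1 < 2 * j + 1" "\<not> 2 * j + 1 < 2 * i + 1"
        using power_strict_decreasing[of _ _ g] g by (metis less_irrefl)+
      then show "i = j" by simp
    qed
    then show "distinct (nodes g m)"
      unfolding nodes_def distinct_map by (auto intro: inj_on_subset)
  qed (simp add: nodes_def)
  have V: "vander (map xvar (nodes g m)) = (\<Prod>i<m. \<Prod>k<i. xvar (g ^ (2 * i + 1)) - xvar (g ^ (2 * k + 1)))"
    unfolding nodes_def map_map comp_def by (rule vander_rev_upt)
  have Z: "prod_list (map (recip (-1) 1) (nodes g m)) = (\<Prod>i<m. recip (-1) 1 (g ^ (2 * i + 1)))"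
    unfolding nodes_def map_map comp_def by (rule prod_rev_upt)
  have A: "alternant (map (recip (-1)) (arith_desc ?n m)) (nodes g m)
    = (\<Prod>i<m. recip (-1) 1 (g ^ (r + 1 + 2 * i))) * (\<Prod>i<m. \<Prod>k<i. xvar (g ^ (r + 1 + 2 * i)) - xvar (g ^ (r + 1 + 2 * k)))"
    using g unfolding arith_desc_eq
    by (subst alternant_nodes) (simp_all only: map_map comp_def vander_rev_upt prod_rev_upt, simp_all)
  have B: "alternant (map (recip 1) (arith_desc (?n + 1) m)) (nodes g m)
    = (\<Prod>i<m. recip 1 1 (g ^ (r + 2 + 2 * i))) * (\<Prod>i<m. \<Prod>k<i. xvar (g ^ (r + 2 + 2 * i)) - xvar (g ^ (r + 2 + 2 * k)))"
    using g unfolding arith_desc_eq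
    by (subst alternant_nodes) (simp_all only: map_map comp_def vander_rev_upt prod_rev_upt, simp_all)
  have main: "subset_form evenpow ?n (nodes g m) * vander (map xvar (nodes g m)) * prod_list (map (recip (-1) 1) (nodes g m))
    = alternant (map (recip (-1)) (arith_desc ?n m)) (nodes g m)
      * alternant (map (recip 1) (arith_desc (?n + 1) m)) (nodes g m)"
    by (rule subset_form_product[of ?n "nodes g m", unfolded nodes(3)]) (use n nodes(1,2) in \<open>simp_all add: le_add2\<close>)
  have "vander (map xvar (nodes g m)) > 0"
    unfolding V by (intro prod_pos ballI) (simp add: xvar_power_mono[OF g] del: power_Suc)
  then have nzV: "vander (map xvar (nodes g m)) \<noteq> 0" by simp
  have nzZ: "prod_list (map (recip (-1) 1) (nodes g m)) \<noteq> 0"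
  proof -
    have "recip (-1) 1 (g ^ (2 * i + 1)) < 0" for i
      using g power_Suc_less_one[of g "2 * i"] by (intro recip_neg) auto
    then have "recip (-1) 1 (g ^ (2 * i + 1)) \<noteq> 0" for i by (metis less_irrefl)
    then show ?thesis unfolding Z by (simp only: prod_zero_iff finite_lessThan) blast
  qed
  have "odd_sum_value g r m = alternant (map (recip (-1)) (arith_desc ?n m)) (nodes g m)
      * alternant (map (recip 1) (arith_desc (?n + 1) m)) (nodes g m)
      / (vander (map xvar (nodes g m)) * prod_list (map (recip (-1) 1) (nodes g m)))"
    unfolding A B V Z odd_sum_value_def prod.distrib prod_dividef times_divide_times_eq
    by (simp only: mult_ac)
  also have "\<dots> = subset_form evenpow ?n (nodes g m)"
  proof -
    have "a * b * c / (b * c) = a" if "b \<noteq> 0" "c \<noteq> 0" for a b c :: real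
      using that by simp
    from this[OF nzV nzZ, of "subset_form evenpow ?n (nodes g m)"] show ?thesis unfolding main .
  qed
  finally show ?thesis using S by simp
qed

section \<open>From signed tuples to subsets\<close>

lemma sum_signs:
  fixes F :: "(nat \<Rightarrow> nat) \<Rightarrow> real"
  assumes F0: "\<And>K i. i \<in> I \<Longrightarrow> K i = 0 \<Longrightarrow> F K = 0" and fin: "finite I"
  shows "(\<Sum>k\<in>I \<rightarrow>\<^sub>E {-int n..int n}. F (\<lambda>i\<in>I. nat \<bar>k i\<bar>)) = 2 ^ card I * (\<Sum>K\<in>I \<rightarrow>\<^sub>E {1..n}. F K)"
proof -
  let ?a = "\<lambda>k. \<lambda>i\<in>I. nat \<bar>k i\<bar>" and ?s = "\<lambda>k. \<lambda>i\<in>I. sgn (k i :: int)" and ?m = "\<lambda>p. \<lambda>i\<in>I. snd p i * int (fst p i)"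
  let ?S = "(I \<rightarrow>\<^sub>E {1..n}) \<times> (I \<rightarrow>\<^sub>E {-1, 1::int})"
  have "(\<Sum>k\<in>I \<rightarrow>\<^sub>E {-int n..int n}. F (?a k))
      = (\<Sum>k\<in>I \<rightarrow>\<^sub>E ({-int n..int n} - {0}). F (?a k))"
  proof (rule sum.mono_neutral_right)
    show "finite (I \<rightarrow>\<^sub>E {-int n..int n})" using fin by (intro finite_PiE) auto
    show "\<forall>k\<in>(I \<rightarrow>\<^sub>E {-int n..int n}) - (I \<rightarrow>\<^sub>E {-int n..int n} - {0}). F (?a k) = 0"
    proof
      fix k assume "k \<in> (I \<rightarrow>\<^sub>E {-int n..int n}) - (I \<rightarrow>\<^sub>E {-int n..int n} - {0})"
      then obtain i where "i \<in> I" "k i = 0" by (auto simp: PiE_iff)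
      then show "F (?a k) = 0" by (intro F0[of i]) auto
    qed
  qed (auto simp: PiE_iff)
  also have "\<dots> = (\<Sum>p\<in>?S. F (fst p))"
  proof (rule sum.reindex_bij_witness[where
        j = "\<lambda>k. (?a k, ?s k)" and i = ?m])
    fix k assume k: "k \<in> I \<rightarrow>\<^sub>E ({-int n..int n} - {0})"
    show "?m (?a k, ?s k) = k"
      using k by (auto simp: fun_eq_iff restrict_def PiE_iff extensional_def sgn_mult_abs)
    have "nat \<bar>k i\<bar> \<in> {1..n}" "sgn (k i) \<in> {-1, 1}" if "i \<in> I" for i
    proof -
      have "k i \<in> {-int n..int n} - {0}" using k that by auto
      then show "nat \<bar>k i\<bar> \<in> {1..n}" "sgn (k i) \<in> {-1, 1}" by (auto simp: sgn_if)
    qed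
    then show "(?a k, ?s k) \<in> ?S" by auto
  next
    fix p assume p: "p \<in> ?S"
    then have P: "fst p i \<in> {1..n}" "snd p i = -1 \<or> snd p i = 1" if "i \<in> I" for i
      using that by (auto simp: mem_Times_iff PiE_iff)
    then show "?m p \<in> I \<rightarrow>\<^sub>E ({-int n..int n} - {0})"
      by fastforce
    have "nat \<bar>snd p i * int (fst p i)\<bar> = fst p i \<and> sgn (snd p i * int (fst p i)) = snd p i" if "i \<in> I" for i
      using P[OF that] by (auto simp: abs_mult sgn_mult)
    then show "(?a (?m p), ?s (?m p)) = p"
      using p by (auto simp: prod_eq_iff fun_eq_iff restrict_def mem_Times_iff PiE_iff extensional_def)
  qed auto
  also have "\<dots> = (\<Sum>K\<in>I \<rightarrow>\<^sub>E {1..n}. \<Sum>s\<in>I \<rightarrow>\<^sub>E {-1, 1::int}. F K)"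
    unfolding sum.cartesian_product by (simp add: case_prod_beta)
  also have "\<dots> = (\<Sum>K\<in>I \<rightarrow>\<^sub>E {1..n}. 2 ^ card I * F K)"
    using fin by (simp add: card_PiE)
  finally show ?thesis by (simp add: sum_distrib_left)
qed

lemma card_injective_labelings:
  assumes "finite A" "card A = r"
  shows "card {K \<in> {1..r} \<rightarrow>\<^sub>E A. inj_on K {1..r}} = fact r"
proof -
  have "bij_betw (\<lambda>K. map K [1..<Suc r]) {K \<in> {1..r} \<rightarrow>\<^sub>E A. inj_on K {1..r}} (permutations_of_set A)"
  proof (rule bij_betw_byWitness[where f' = "\<lambda>xs. \<lambda>i\<in>{1..r}. xs ! (i - 1)"])
    show "\<forall>K\<in>{K \<in> {1..r} \<rightarrow>\<^sub>E A. inj_on K {1..r}}. (\<lambda>i\<in>{1..r}. map K [1..<Suc r] ! (i - 1)) = K"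
      by (auto simp: fun_eq_iff restrict_def PiE_iff extensional_def nth_append simp del: upt_Suc)
    show "\<forall>xs\<in>permutations_of_set A. map (\<lambda>i\<in>{1..r}. xs ! (i - 1)) [1..<Suc r] = xs"
    proof
      fix xs assume "xs \<in> permutations_of_set A"
      then have "length xs = r" using assms by (simp add: length_finite_permutations_of_set)
      then show "map (\<lambda>i\<in>{1..r}. xs ! (i - 1)) [1..<Suc r] = xs"
        by (auto intro!: nth_equalityI simp del: upt_Suc)
    qed
    show "(\<lambda>K. map K [1..<Suc r]) ` {K \<in> {1..r} \<rightarrow>\<^sub>E A. inj_on K {1..r}} \<subseteq> permutations_of_set A"
    proof safe
      fix K assume K: "K \<in> {1..r} \<rightarrow>\<^sub>E A" "inj_on K {1..r}"
      have s: "set [1..<Suc r] = {1..r}" by auto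
      have "K ` {1..r} = A"
        using K assms by (intro card_subset_eq) (auto simp: card_image)
      then show "map K [1..<Suc r] \<in> permutations_of_set A"
        using K(2) unfolding permutations_of_set_def distinct_map set_map s mem_Collect_eq by auto
    qed
    show "(\<lambda>xs. \<lambda>i\<in>{1..r}. xs ! (i - 1)) ` permutations_of_set A \<subseteq> {K \<in> {1..r} \<rightarrow>\<^sub>E A. inj_on K {1..r}}"
    proof
      fix K assume "K \<in> (\<lambda>xs. \<lambda>i\<in>{1..r}. xs ! (i - 1)) ` permutations_of_set A"
      then obtain xs where xs: "xs \<in> permutations_of_set A" and K: "K = (\<lambda>i\<in>{1..r}. xs ! (i - 1))"
        by blast
      have l: "length xs = r" "distinct xs" "set xs = A"
        using xs assms by (auto simp: length_finite_permutations_of_set permutations_of_set_def)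
      have "inj_on K {1..r}"
        using l by (auto simp: K inj_on_def nth_eq_iff_index_eq)
      moreover have "K i \<in> A" if "i \<in> {1..r}" for i
        using that l nth_mem[of "i - 1" xs] by (auto simp: K)
      ultimately show "K \<in> {K \<in> {1..r} \<rightarrow>\<^sub>E A. inj_on K {1..r}}"
        by (auto simp: K)
    qed
  qed
  then have "card {K \<in> {1..r} \<rightarrow>\<^sub>E A. inj_on K {1..r}} = card (permutations_of_set A)"
    by (rule bij_betw_same_card)
  then show ?thesis using assms by simp
qed

lemma sum_labelings:
  fixes F :: "(nat \<Rightarrow> nat) \<Rightarrow> real" and \<Psi> :: "nat set \<Rightarrow> real"
  assumes F0: "\<And>K. \<not> inj_on K {1..r} \<Longrightarrow> F K = 0"
    and F1: "\<And>K. inj_on K {1..r} \<Longrightarrow> F K = \<Psi> (K ` {1..r})"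
    and fin: "finite B"
  shows "(\<Sum>K\<in>{1..r} \<rightarrow>\<^sub>E B. F K) = fact r * (\<Sum>A | A \<subseteq> B \<and> card A = r. \<Psi> A)"
proof -
  let ?J = "{K \<in> {1..r} \<rightarrow>\<^sub>E B. inj_on K {1..r}}"
  have finJ: "finite ?J" using fin by (intro finite_subset[OF _ finite_PiE[of "{1..r}" "\<lambda>_. B"]]) auto
  have "(\<Sum>K\<in>{1..r} \<rightarrow>\<^sub>E B. F K) = (\<Sum>K\<in>?J. \<Psi> (K ` {1..r}))"
    using fin by (intro sum.mono_neutral_cong_right) (auto intro!: finite_PiE F0 F1 simp del: One_nat_def)
  also have "\<dots> = (\<Sum>A | A \<subseteq> B \<and> card A = r. \<Sum>K\<in>{K \<in> ?J. K ` {1..r} = A}. \<Psi> (K ` {1..r}))"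
    using finJ fin by (intro sum.group[symmetric]) (auto simp: card_image)
  also have "\<dots> = (\<Sum>A | A \<subseteq> B \<and> card A = r. fact r * \<Psi> A)"
  proof (rule sum.cong)
    fix A assume "A \<in> {A. A \<subseteq> B \<and> card A = r}"
    then have A: "A \<subseteq> B" "card A = r" "finite A" using fin finite_subset by auto
    have "K ` {1..r} = A" if "K \<in> {1..r} \<rightarrow>\<^sub>E A" "inj_on K {1..r}" for K
      using that A by (intro card_subset_eq) (auto simp: card_image)
    then have "{K \<in> ?J. K ` {1..r} = A} = {K \<in> {1..r} \<rightarrow>\<^sub>E A. inj_on K {1..r}}"
      using A by (auto simp: PiE_iff)
    then have "card {K \<in> ?J. K ` {1..r} = A} = fact r"
      using card_injective_labelings[OF A(3,2)] by simp
    moreover have "(\<Sum>K\<in>{K \<in> ?J. K ` {1..r} = A}. \<Psi> (K ` {1..r})) = (\<Sum>K\<in>{K \<in> ?J. K ` {1..r} = A}. \<Psi> A)"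
      by (rule sum.cong) auto
    ultimately show "(\<Sum>K\<in>{K \<in> ?J. K ` {1..r} = A}. \<Psi> (K ` {1..r})) = fact r * \<Psi> A"
      by (simp only: sum_constant of_nat_fact)
  qed simp
  finally show ?thesis by (simp add: sum_distrib_left)
qed

text \<open>The square of \<open>vander_set\<close>. Products over ordered pairs can be reindexed and split without regard to the
  order of the indices, so identities between Vandermonde products are proved for their squares.\<close>

definition pair_prod :: "(nat \<Rightarrow> real) \<Rightarrow> nat set \<Rightarrow> real" where
  "pair_prod X L = (\<Prod>i\<in>L. \<Prod>j\<in>L - {i}. \<bar>X i - X j\<bar>)"

lemma vander_set_square:
  assumes "finite L"
  shows "(vander_set X L)\<^sup>2 = pair_prod X L"
proof -
  have "vander_set X L = (\<Prod>j\<in>L. \<Prod>i\<in>{i \<in> L. i < j}. \<bar>X i - X j\<bar>)"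
    unfolding vander_set_def by (rule prod.swap_restrict) (use assms in simp_all)
  also have "\<dots> = (\<Prod>i\<in>L. \<Prod>j\<in>{j \<in> L. j < i}. \<bar>X i - X j\<bar>)"
    by (simp add: abs_minus_commute)
  finally have "(vander_set X L)\<^sup>2 = (\<Prod>i\<in>L. \<Prod>j\<in>{j \<in> L. i < j}. \<bar>X i - X j\<bar>) * (\<Prod>i\<in>L. \<Prod>j\<in>{j \<in> L. j < i}. \<bar>X i - X j\<bar>)"
    by (simp add: power2_eq_square vander_set_def)
  also have "\<dots> = (\<Prod>i\<in>L. (\<Prod>j\<in>{j \<in> L. i < j}. \<bar>X i - X j\<bar>) * (\<Prod>j\<in>{j \<in> L. j < i}. \<bar>X i - X j\<bar>))"
    by (simp add: prod.distrib)
  also have "\<dots> = pair_prod X L"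
    unfolding pair_prod_def
  proof (rule prod.cong)
    fix i assume "i \<in> L"
    have "L - {i} = {j \<in> L. i < j} \<union> {j \<in> L. j < i}" by auto
    then show "(\<Prod>j\<in>{j \<in> L. i < j}. \<bar>X i - X j\<bar>) * (\<Prod>j\<in>{j \<in> L. j < i}. \<bar>X i - X j\<bar>) = (\<Prod>j\<in>L - {i}. \<bar>X i - X j\<bar>)"
      using assms by (simp add: prod.union_disjoint[symmetric] disjoint_iff)
  qed simp
  finally show ?thesis .
qed

lemma vander_set_nonneg: "vander_set X L \<ge> 0"
  unfolding vander_set_def by (intro prod_nonneg) auto

lemma vander_set_image:
  assumes "inj_on K L" "finite L"
  shows "vander_set (\<lambda>i. X (K i)) L = vander_set X (K ` L)"
proof -
  have "K ` L - {K i} = K ` (L - {i})" if "i \<in> L" for i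
    using assms that by (auto simp: inj_on_def)
  then have "pair_prod X (K ` L) = pair_prod (\<lambda>i. X (K i)) L"
    unfolding pair_prod_def using assms
    by (simp add: prod.reindex inj_on_diff cong: prod.cong)
  then have "(vander_set (\<lambda>i. X (K i)) L)\<^sup>2 = (vander_set X (K ` L))\<^sup>2"
    using assms by (simp add: vander_set_square)
  then show ?thesis using vander_set_nonneg by (simp add: power2_eq_iff_nonneg)
qed

text \<open>Pairs of elements of \<open>N\<close> lie in \<open>A\<close>, in \<open>N - A\<close>, or across, and the rows of \<open>A\<close> count the first
  kind twice and the third once.\<close>

lemma vander_set_complement:
  assumes fin: "finite N" and A: "A \<subseteq> N"
  shows "vander_set X A * vander_set X N = (\<Prod>a\<in>A. \<Prod>b\<in>N - {a}. \<bar>X a - X b\<bar>) * vander_set X (N - A)"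
proof -
  let ?L = "N - A"
  let ?c = "\<Prod>a\<in>A. \<Prod>l\<in>?L. \<bar>X a - X l\<bar>"
  have fA: "finite A" using fin A finite_subset by blast
  have row: "(\<Prod>b\<in>N - {a}. \<bar>X a - X b\<bar>) = (\<Prod>b\<in>A - {a}. \<bar>X a - X b\<bar>) * (\<Prod>l\<in>?L. \<bar>X a - X l\<bar>)"
    if "a \<in> A" for a
  proof -
    have "N - {a} = (A - {a}) \<union> ?L" using A that by auto
    moreover have "(A - {a}) \<inter> ?L = {}" by auto
    ultimately show ?thesis using fin fA by (simp add: prod.union_disjoint)
  qed
  have row': "(\<Prod>b\<in>N - {a}. \<bar>X a - X b\<bar>) = (\<Prod>b\<in>?L - {a}. \<bar>X a - X b\<bar>) * (\<Prod>l\<in>A. \<bar>X a - X l\<bar>)"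
    if "a \<in> ?L" for a
  proof -
    have "N - {a} = (?L - {a}) \<union> A" using A that by auto
    moreover have "(?L - {a}) \<inter> A = {}" by auto
    ultimately show ?thesis using fin fA by (simp add: prod.union_disjoint)
  qed
  have R: "(\<Prod>a\<in>A. \<Prod>b\<in>N - {a}. \<bar>X a - X b\<bar>) = pair_prod X A * ?c"
    by (simp add: pair_prod_def row prod.distrib)
  have "(\<Prod>a\<in>?L. \<Prod>l\<in>A. \<bar>X a - X l\<bar>) = ?c"
    by (subst prod.swap) (simp add: abs_minus_commute)
  then have R': "(\<Prod>a\<in>?L. \<Prod>b\<in>N - {a}. \<bar>X a - X b\<bar>) = pair_prod X ?L * ?c"
    by (simp add: pair_prod_def row' prod.distrib)
  have "pair_prod X N = (\<Prod>a\<in>A. \<Prod>b\<in>N - {a}. \<bar>X a - X b\<bar>) * (\<Prod>a\<in>?L. \<Prod>b\<in>N - {a}. \<bar>X a - X b\<bar>)"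
    unfolding pair_prod_def using fin A by (subst prod.subset_diff[of A N]) auto
  then have "(vander_set X N)\<^sup>2 = (vander_set X A * vander_set X ?L * ?c)\<^sup>2"
    unfolding R R' using fin fA by (simp add: vander_set_square[symmetric] power2_eq_square mult_ac)
  moreover have "?c \<ge> 0" by (intro prod_nonneg) auto
  ultimately have "vander_set X N = vander_set X A * vander_set X ?L * ?c"
    using vander_set_nonneg by (simp add: power2_eq_iff_nonneg)
  then show ?thesis
    unfolding R using fA by (simp add: vander_set_square[symmetric] power2_eq_square mult_ac)
qed

section \<open>Pochhammer symbols and the summand\<close>

lemma q_factors_convergent:
  fixes a q :: real
  assumes "0 < q" "q < 1"
  shows "convergent_prod (\<lambda>k. 1 - a * q ^ k)"
proof -
  have "summable (\<lambda>k. norm (- a * q ^ k))"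
    using assms by (auto simp: abs_mult power_abs intro!: summable_mult summable_geometric)
  then have "abs_convergent_prod (\<lambda>k. 1 + (- a * q ^ k))"
    by (simp add: abs_convergent_prod_conv_summable)
  then show ?thesis by (auto dest: abs_convergent_prod_imp_convergent_prod)
qed

lemma q_factor_nonzero:
  fixes a q :: real
  assumes "0 < q" "q < 1" "a < 1"
  shows "1 - a * q ^ k > 0"
proof -
  have "a * q ^ k \<le> max a 0 * 1"
    using assms by (intro mult_mono) (auto intro: power_le_one)
  moreover have "max a 0 * 1 < 1" using assms by auto
  ultimately show ?thesis by linarith
qed

lemma q_poch_inf_nonzero: "0 < q \<Longrightarrow> q < 1 \<Longrightarrow> a < 1 \<Longrightarrow> q_poch_inf a q \<noteq> 0"
proof -
  assume a: "0 < q" "q < 1" "a < 1"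
  have "1 - a * q ^ k \<noteq> 0" for k
    using q_factor_nonzero[OF a, of k] by simp
  then show "q_poch_inf a q \<noteq> 0"
    unfolding q_poch_inf_def by (intro prodinf_nonzero q_factors_convergent a)
qed

lemma q_poch_inf_step:
  assumes "0 < q" "q < 1" "a < 1"
  shows "q_poch_inf a q = (1 - a) * q_poch_inf (a * q) q"
proof -
  have "(\<Prod>k. 1 - a * q ^ k) = (\<Prod>k. 1 - a * q ^ (k + 1)) * (\<Prod>k<1. 1 - a * q ^ k)"
    by (rule prodinf_split_initial_segment[OF q_factors_convergent[OF assms(1,2)]])
       (use assms in auto)
  then show ?thesis by (simp add: q_poch_inf_def mult_ac)
qed

lemma q_poch_0: "0 < q \<Longrightarrow> q < 1 \<Longrightarrow> a < 1 \<Longrightarrow> q_poch a q 0 = 1"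
  using q_poch_inf_nonzero by (simp add: q_poch_def)

text \<open>Also for negative \<open>k\<close>, where it determines the symbol with index \<open>- 1\<close>.\<close>

lemma q_poch_Suc:
  assumes "0 < q" "q < 1" "a * q powi k < 1"
  shows "q_poch a q (k + 1) = q_poch a q k * (1 - a * q powi k)"
proof -
  have e: "a * q powi (k + 1) = a * q powi k * q"
    using assms by (simp add: power_int_add)
  show ?thesis
    unfolding q_poch_def e q_poch_inf_step[OF assms] using assms(3) by simp
qed

lemma q_poch_nat:
  assumes "0 < q" "q < 1" "a < 1"
  shows "q_poch a q (int N) = (\<Prod>k<N. 1 - a * q ^ k)"
proof (induction N)
  case 0
  then show ?case using q_poch_0[OF assms] by simp
next
  case (Suc N)
  have "a * q powi int N < 1" using q_factor_nonzero[OF assms, of N] by simp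
  from q_poch_Suc[OF assms(1,2) this] show ?case using Suc by (simp add: add.commute)
qed

text \<open>The q-factorial \<open>(q; q)_N\<close>.\<close>

definition qpoch :: "real \<Rightarrow> nat \<Rightarrow> real" where
  "qpoch q N = (\<Prod>k<N. 1 - q ^ Suc k)"

lemma qpoch_0 [simp]: "qpoch q 0 = 1" by (simp add: qpoch_def)
lemma qpoch_Suc: "qpoch q (Suc N) = qpoch q N * (1 - q ^ Suc N)" by (simp add: qpoch_def)

lemma qpoch_pos: "0 < q \<Longrightarrow> q < 1 \<Longrightarrow> qpoch q N > 0"
  unfolding qpoch_def by (intro prod_pos) (auto simp: power_less_one_iff simp del: power_Suc)

lemma q_poch_qpoch: "0 < q \<Longrightarrow> q < 1 \<Longrightarrow> q_poch q q (int N) = qpoch q N"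
  by (simp add: q_poch_nat qpoch_def)

lemma q_binomial_qpoch:
  assumes "0 < q" "q < 1" "\<bar>k\<bar> \<le> int n"
  shows "q_binomial q (2 * int n) (int n + k)
     = qpoch q (2 * n) / (qpoch q (n + nat \<bar>k\<bar>) * qpoch q (n - nat \<bar>k\<bar>))"
proof (cases "k \<ge> 0")
  case True
  then have "int n + k = int (n + nat \<bar>k\<bar>)" "2 * int n - (int n + k) = int (n - nat \<bar>k\<bar>)"
    "2 * int n = int (2 * n)"
    using assms by auto
  then show ?thesis unfolding q_binomial_def using assms(1,2) by (simp only: q_poch_qpoch)
next
  case False
  then have "int n + k = int (n - nat \<bar>k\<bar>)" "2 * int n - (int n + k) = int (n + nat \<bar>k\<bar>)"
    "2 * int n = int (2 * n)"
    using assms by auto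
  then show ?thesis unfolding q_binomial_def using assms(1,2) by (simp only: q_poch_qpoch mult.commute)
qed

definition qX :: "real \<Rightarrow> nat \<Rightarrow> real" where "qX q l = q ^ l + 1 / q ^ l"

lemma qX_powr:
  assumes "0 < q"
  shows "qX q (nat \<bar>k\<bar>) = q powr (of_int k) + q powr (- of_int k)"
proof -
  have inv: "q powr (- of_int k) = inverse (q powr (of_int k))"
    by (rule powr_minus)
  have *: "q ^ nat j = q powr of_int j" if "j \<ge> 0" for j
    using assms that by (simp flip: powr_realpow)
  show ?thesis
  proof (cases "k \<ge> 0")
    case True
    then show ?thesis using *[of k] by (simp add: qX_def inv inverse_eq_divide)
  next
    case False
    then have "q ^ nat \<bar>k\<bar> = q powr (- of_int k)" using *[of "-k"] by simp
    then show ?thesis by (simp add: qX_def inv inverse_eq_divide)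
  qed
qed

lemma q_number_pair:
  assumes "0 < q" "q < 1"
  shows "\<bar>q_number q (of_int (a - b)) * q_number q (of_int (a + b))\<bar>
    = q powr of_int a / (1 - q)\<^sup>2 * \<bar>qX q (nat \<bar>a\<bar>) - qX q (nat \<bar>b\<bar>)\<bar>"
proof -
  define u v where "u = q powr of_int a" and "v = q powr of_int b"
  have "u > 0" "v > 0" using assms by (auto simp: u_def v_def)
  have "q_number q (of_int (a - b)) * q_number q (of_int (a + b))
      = (1 - u / v) * (1 - u * v) / (1 - q)\<^sup>2"
    by (simp add: q_number_def powr_diff powr_add u_def v_def power2_eq_square)
  also have "(1 - u / v) * (1 - u * v) = u * ((u + 1 / u) - (v + 1 / v))"
    using \<open>u > 0\<close> \<open>v > 0\<close> by (simp add: field_simps)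
  also have "(u + 1 / u) - (v + 1 / v) = qX q (nat \<bar>a\<bar>) - qX q (nat \<bar>b\<bar>)"
    using assms by (simp add: qX_powr u_def v_def powr_minus divide_inverse)
  finally show ?thesis using \<open>u > 0\<close> by (simp add: abs_mult u_def)
qed

definition point_weight :: "real \<Rightarrow> nat \<Rightarrow> nat \<Rightarrow> real" where
  "point_weight q n l = (qX q l - 2) * q powr (real l ^ 2 / 2) * (qpoch q (2 * n) / (qpoch q (n + l) * qpoch q (n - l)))"

lemma point_weight_0 [simp]: "point_weight q n 0 = 0" by (simp add: point_weight_def qX_def)

text \<open>With \<open>s = r + 1 - i\<close> there are \<open>s - 1\<close> factors \<open>q^k\<close> contributed by the pairs \<open>(i, j)\<close> with \<open>i < j\<close>.
  They complete the square in the exponent up to \<open>q^(- k)\<close>, which turns \<open>(1 - q^k)^2\<close> into the even function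
  \<open>q^k + q^(- k) - 2\<close>.\<close>

lemma q_weight_factor:
  assumes q: "0 < q" "q < 1" and k: "\<bar>k\<bar> \<le> int n" and s: "s \<ge> 1"
  shows "(q powr of_int k / (1 - q)\<^sup>2) ^ (s - 1) * ((q_number q (of_int k))\<^sup>2
          * q powr ((of_int k - real s)\<^sup>2 / 2) * q_binomial q (2 * int n) (int n + k))
     = (q powr (real s ^ 2 / 2) / (1 - q) ^ (2 * s)) * point_weight q n (nat \<bar>k\<bar>)"
proof -
  obtain t where t: "s = Suc t" using s by (cases s) auto
  define u where "u = q powr of_int k"
  have u: "u > 0" using q by (simp add: u_def)
  have "u ^ s * q powr ((of_int k - real s)\<^sup>2 / 2) = q powr (real s ^ 2 / 2) * q powr (real (nat \<bar>k\<bar>) ^ 2 / 2)"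
  proof -
    have "u ^ s = q powr (of_int k * real s)"
      using q by (simp add: u_def powr_powr flip: powr_realpow)
    then show ?thesis
      by (simp add: powr_add[symmetric]) (simp add: power2_eq_square field_simps)
  qed
  then have 1: "u ^ t * u * q powr ((of_int k - real s)\<^sup>2 / 2) = q powr (real s ^ 2 / 2) * q powr (real (nat \<bar>k\<bar>) ^ 2 / 2)"
    by (simp add: t mult_ac)
  have 2: "(1 - u)\<^sup>2 = u * (qX q (nat \<bar>k\<bar>) - 2)"
    using u q by (simp add: qX_powr powr_minus u_def[symmetric] field_simps power2_eq_square)
  have 3: "q_number q (of_int k) = (1 - u) / (1 - q)" by (simp add: q_number_def u_def)
  define B where "B = qpoch q (2 * n) / (qpoch q (n + nat \<bar>k\<bar>) * qpoch q (n - nat \<bar>k\<bar>))"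
  have "(u / (1 - q)\<^sup>2) ^ t * (((1 - u) / (1 - q))\<^sup>2 * q powr ((of_int k - real s)\<^sup>2 / 2) * B)
      = u ^ t * (u * (qX q (nat \<bar>k\<bar>) - 2)) * q powr ((of_int k - real s)\<^sup>2 / 2) * B / (1 - q) ^ (2 * s)"
  proof -
    have "(1 - q) ^ (2 * s) = (1 - q)\<^sup>2 * ((1 - q)\<^sup>2) ^ t"
      by (simp only: t power_mult power_Suc)
    then show ?thesis unfolding power_divide 2 by (simp only:) (simp add: mult_ac)
  qed
  also have "\<dots> = (u ^ t * u * q powr ((of_int k - real s)\<^sup>2 / 2)) * (qX q (nat \<bar>k\<bar>) - 2) * B / (1 - q) ^ (2 * s)"
    by (simp add: mult_ac)
  also have "\<dots> = (q powr (real s ^ 2 / 2) / (1 - q) ^ (2 * s)) * point_weight q n (nat \<bar>k\<bar>)"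
    unfolding 1 point_weight_def B_def by (simp add: mult_ac)
  finally show ?thesis
    unfolding q_binomial_qpoch[OF q k] B_def[symmetric] 3 u_def[symmetric] by (simp add: t)
qed

text \<open>Signs of the \<open>k_i\<close> give the factor \<open>2^r\<close> and orderings the factor \<open>r!\<close>; tuples with a zero entry or
  with two entries of equal modulus contribute nothing.\<close>

lemma lhs_eq_subset_sum:
  assumes q: "0 < q" "q < 1"
  shows "(\<Sum>k \<in> {1..r} \<rightarrow>\<^sub>E {- int n..int n}.
        (\<Prod>i=1..r. \<Prod>j\<in>{i<..r}.
           \<bar>q_number q (of_int (k i - k j)) * q_number q (of_int (k i + k j))\<bar>) *
        (\<Prod>i=1..r.
           (q_number q (of_int (k i)))\<^sup>2
           * q powr ((of_int (k i) - real r + real i - 1)\<^sup>2 / 2)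
           * q_binomial q (2 * int n) (int n + k i)))
    = 2 ^ r * fact r * (\<Prod>s=1..r. q powr (real s ^ 2 / 2) / (1 - q) ^ (2 * s))
      * (\<Sum>A | A \<subseteq> {1..n} \<and> card A = r. vander_set (qX q) A * (\<Prod>a\<in>A. point_weight q n a))"
    (is "(\<Sum>k \<in> _. ?f k) = _")
proof -
  define c where "c = (\<Prod>s=1..r. q powr (real s ^ 2 / 2) / (1 - q) ^ (2 * s))"
  define F where "F K = vander_set (\<lambda>i. qX q (K i)) {1..r} * (\<Prod>i=1..r. point_weight q n (K i))" for K
  have summand: "?f k = c * F (\<lambda>i\<in>{1..r}. nat \<bar>k i\<bar>)"
    if k: "k \<in> {1..r} \<rightarrow>\<^sub>E {- int n..int n}" for k
  proof -
    let ?x = "\<lambda>i j. \<bar>qX q (nat \<bar>k i\<bar>) - qX q (nat \<bar>k j\<bar>)\<bar>"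
    have "?f k = (\<Prod>i=1..r. (\<Prod>j\<in>{i<..r}. ?x i j) * ((q powr (real (r + 1 - i) ^ 2 / 2) / (1 - q) ^ (2 * (r + 1 - i))) * point_weight q n (nat \<bar>k i\<bar>)))"
      unfolding prod.distrib[symmetric]
    proof (rule prod.cong)
      fix i assume i: "i \<in> {1..r}"
      have ki: "\<bar>k i\<bar> \<le> int n" using k i by (force simp: PiE_iff)
      have e: "of_int (k i) - real r + real i - 1 = of_int (k i) - real (r + 1 - i)"
        using i by (auto simp: of_nat_diff)
      have "r + 1 - i \<ge> 1" using i by (auto simp: Suc_diff_le)
      note w = q_weight_factor[OF q ki this]
      have p: "(\<Prod>j\<in>{i<..r}. \<bar>q_number q (of_int (k i - k j)) * q_number q (of_int (k i + k j))\<bar>)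
          = (q powr of_int (k i) / (1 - q)\<^sup>2) ^ (r + 1 - i - 1) * (\<Prod>j\<in>{i<..r}. ?x i j)"
        unfolding q_number_pair[OF q] prod.distrib prod_constant by simp
      show "(\<Prod>j\<in>{i<..r}. \<bar>q_number q (of_int (k i - k j)) * q_number q (of_int (k i + k j))\<bar>) *
         ((q_number q (of_int (k i)))\<^sup>2
           * q powr ((of_int (k i) - real r + real i - 1)\<^sup>2 / 2)
           * q_binomial q (2 * int n) (int n + k i))
        = (\<Prod>j\<in>{i<..r}. ?x i j) * ((q powr (real (r + 1 - i) ^ 2 / 2) / (1 - q) ^ (2 * (r + 1 - i))) * point_weight q n (nat \<bar>k i\<bar>))"
        unfolding p e w[symmetric] by (simp only: mult_ac)
    qed simp
    also have "\<dots> = (\<Prod>i=1..r. q powr (real (r + 1 - i) ^ 2 / 2) / (1 - q) ^ (2 * (r + 1 - i)))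
        * ((\<Prod>i=1..r. \<Prod>j\<in>{i<..r}. ?x i j) * (\<Prod>i=1..r. point_weight q n (nat \<bar>k i\<bar>)))"
      unfolding prod.distrib by (simp only: mult_ac)
    also have "(\<Prod>i=1..r. q powr (real (r + 1 - i) ^ 2 / 2) / (1 - q) ^ (2 * (r + 1 - i))) = c"
      unfolding c_def by (subst (2) prod.atLeastAtMost_rev) (simp add: add.commute)
    also have "(\<Prod>i=1..r. \<Prod>j\<in>{i<..r}. ?x i j) * (\<Prod>i=1..r. point_weight q n (nat \<bar>k i\<bar>)) = F (\<lambda>i\<in>{1..r}. nat \<bar>k i\<bar>)"
    proof -
      have "{j \<in> {1..r}. i < j} = {i<..r}" if "i \<in> {1..r}" for i
        using that by auto
      then show ?thesis unfolding F_def vander_set_def by (auto intro!: prod.cong arg_cong2[where f = "(*)"])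
    qed
    finally show ?thesis .
  qed
  have "(\<Sum>k \<in> {1..r} \<rightarrow>\<^sub>E {- int n..int n}. ?f k) = (\<Sum>k \<in> {1..r} \<rightarrow>\<^sub>E {- int n..int n}. c * F (\<lambda>i\<in>{1..r}. nat \<bar>k i\<bar>))"
    by (rule sum.cong[OF refl]) (rule summand)
  also have "\<dots> = c * (2 ^ card {1..r} * (\<Sum>K\<in>{1..r} \<rightarrow>\<^sub>E {1..n}. F K))"
    unfolding sum_distrib_left[symmetric]
  proof (subst sum_signs)
    fix K :: "nat \<Rightarrow> nat" and i assume "i \<in> {1..r}" "K i = 0"
    then have "(\<Prod>i=1..r. point_weight q n (K i)) = 0"
      by (intro prod_zero) (auto intro!: bexI[of _ i])
    then show "F K = 0" by (simp add: F_def)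
  qed simp_all
  also have "(\<Sum>K\<in>{1..r} \<rightarrow>\<^sub>E {1..n}. F K)
      = fact r * (\<Sum>A | A \<subseteq> {1..n} \<and> card A = r. vander_set (qX q) A * (\<Prod>a\<in>A. point_weight q n a))"
  proof (rule sum_labelings)
    fix K :: "nat \<Rightarrow> nat"
    show "F K = vander_set (qX q) (K ` {1..r}) * (\<Prod>a\<in>K ` {1..r}. point_weight q n a)" if "inj_on K {1..r}"
      using that by (simp add: F_def vander_set_image prod.reindex)
    show "F K = 0" if not_inj: "\<not> inj_on K {1..r}"
    proof -
      obtain a b where ab: "a \<in> {1..r}" "b \<in> {1..r}" "a \<noteq> b" "K a = K b"
        using not_inj unfolding inj_on_def by blast
      obtain i j where ij: "i \<in> {1..r}" "j \<in> {1..r}" "i < j" "K i = K j"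
        using ab by (cases "a < b") (auto intro: that dest: sym)
      have "\<exists>j\<in>{j \<in> {1..r}. i < j}. \<bar>qX q (K i) - qX q (K j)\<bar> = 0"
        using ij by (intro bexI[of _ j]) simp_all
      then have "(\<Prod>j\<in>{j \<in> {1..r}. i < j}. \<bar>qX q (K i) - qX q (K j)\<bar>) = 0"
        by (rule prod_zero[rotated]) simp
      then have "\<exists>i\<in>{1..r}. (\<Prod>j\<in>{j \<in> {1..r}. i < j}. \<bar>qX q (K i) - qX q (K j)\<bar>) = 0"
        using ij(1) by blast
      then have "vander_set (\<lambda>i. qX q (K i)) {1..r} = 0"
        unfolding vander_set_def by (rule prod_zero[rotated]) simp
      then show ?thesis by (simp add: F_def)
    qed
  qed simp
  finally show ?thesis by (simp add: c_def mult_ac)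
qed

section \<open>Passing to the complement\<close>

lemma qX_diff:
  assumes "q > 0" "l \<le> k"
  shows "qX q k - qX q l = (1 - q ^ (k - l)) * (1 - q ^ (k + l)) / q ^ k"
proof -
  have "q ^ k = q ^ (k - l) * q ^ l" using assms(2) by (simp flip: power_add)
  then show ?thesis using assms(1)
    by (simp add: qX_def power_add field_simps)
qed

lemma qX_strict_mono: "0 < q \<Longrightarrow> q < 1 \<Longrightarrow> l < k \<Longrightarrow> qX q l < qX q k"
proof -
  assume q: "0 < q" "q < 1" and "l < k"
  then have "q ^ (k - l) < 1" "q ^ (k + l) < 1" by (auto simp: power_less_one_iff)
  then have "qX q k - qX q l > 0"
    using q \<open>l < k\<close> by (subst qX_diff) auto
  then show ?thesis by simp
qed

text \<open>Each difference splits as in \<open>qX_diff\<close>, so the row is a quotient of q-factorials.\<close>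

lemma qX_row_below:
  assumes "0 < q" "j < k"
  shows "(\<Prod>l=1..j. qX q k - qX q l) * (q ^ (k * j) * qpoch q (k - 1 - j) * qpoch q k) = qpoch q (k - 1) * qpoch q (k + j)"
  using assms(2)
proof (induction j)
  case (Suc j)
  let ?P = "\<Prod>l=1..j. qX q k - qX q l"
  have d: "qX q k - qX q (Suc j) = (1 - q ^ (k - Suc j)) * (1 - q ^ (k + Suc j)) / q ^ k"
    using assms(1) Suc.prems by (intro qX_diff) auto
  have "k - 1 - j = Suc (k - 1 - Suc j)" using Suc.prems by simp
  then have f: "qpoch q (k - 1 - j) = qpoch q (k - 1 - Suc j) * (1 - q ^ (k - Suc j))"
    using qpoch_Suc[of q "k - 1 - Suc j"] Suc.prems by (simp add: Suc_diff_Suc)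
  have f': "qpoch q (k + Suc j) = qpoch q (k + j) * (1 - q ^ (k + Suc j))"
    using qpoch_Suc[of q "k + j"] by simp
  have qk: "q ^ (k * Suc j) = q ^ k * q ^ (k * j)" by (simp add: power_add)
  have "q ^ k \<noteq> 0" using assms(1) by simp
  have "(\<Prod>l=1..Suc j. qX q k - qX q l) * (q ^ (k * Suc j) * qpoch q (k - 1 - Suc j) * qpoch q k)
      = ?P * (q ^ (k * j) * qpoch q (k - 1 - j) * qpoch q k) * (1 - q ^ (k + Suc j))"
    unfolding f qk using \<open>q ^ k \<noteq> 0\<close> by (simp add: d)
  also have "\<dots> = qpoch q (k - 1) * qpoch q (k + j) * (1 - q ^ (k + Suc j))"
    by (subst Suc.IH) (use Suc.prems in simp_all)
  finally show ?case unfolding f' by (simp only: mult.assoc)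
qed (simp add: mult.commute)

lemma qX_row_above:
  assumes "0 < h" "k \<le> n" "q = h\<^sup>2"
  shows "(\<Prod>l\<in>{k<..n}. qX q l - qX q k) * (h ^ (n * (n + 1)) * qpoch q (2 * k))
     = qpoch q (n - k) * qpoch q (n + k) * h ^ (k * (k + 1))"
  using assms(2)
proof (induction n rule: dec_induct)
  case base
  then show ?case by (simp add: mult_2)
next
  case (step n)
  have q: "q > 0" using assms by simp
  have d: "qX q (Suc n) - qX q k = (1 - q ^ (Suc n - k)) * (1 - q ^ (Suc n + k)) / q ^ Suc n"
    using q step by (intro qX_diff) auto
  have f: "qpoch q (Suc n - k) = qpoch q (n - k) * (1 - q ^ (Suc n - k))"
    using step qpoch_Suc[of q "n - k"] by (simp add: Suc_diff_le)
  have f': "qpoch q (Suc n + k) = qpoch q (n + k) * (1 - q ^ (Suc n + k))"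
    using qpoch_Suc[of q "n + k"] by simp
  have hh: "h ^ (Suc n * (Suc n + 1)) = q ^ Suc n * h ^ (n * (n + 1))"
  proof -
    have "Suc n * (Suc n + 1) = 2 * Suc n + n * (n + 1)" by simp
    then show ?thesis unfolding assms(3) by (simp only: power_mult[symmetric] power_add[symmetric])
  qed
  have "{k<..Suc n} = insert (Suc n) {k<..n}" using step by auto
  then have "(\<Prod>l\<in>{k<..Suc n}. qX q l - qX q k) * (h ^ (Suc n * (Suc n + 1)) * qpoch q (2 * k))
    = (1 - q ^ (Suc n - k)) * (1 - q ^ (Suc n + k)) * ((\<Prod>l\<in>{k<..n}. qX q l - qX q k) * (h ^ (n * (n + 1)) * qpoch q (2 * k)))"
    unfolding hh using q by (simp add: d del: power_Suc)
  then show ?case unfolding step.IH f f' by simp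
qed

definition qY :: "real \<Rightarrow> nat \<Rightarrow> real" where "qY h l = h ^ l + 1 / h ^ l"

text \<open>The weight of a point is, up to a constant, the reciprocal of its row of differences to the other
  points and of \<open>qY\<close>; this is what makes the passage to the complement remove the weights.\<close>

lemma point_weight_row:
  assumes h: "0 < h" "h < 1" and q: "q = h\<^sup>2" and k: "1 \<le> k" "k \<le> n"
  shows "point_weight q n k * (\<Prod>l\<in>{1..n} - {k}. \<bar>qX q k - qX q l\<bar>) * qY h k = qpoch q (2 * n) / h ^ (n * (n + 1))"
proof -
  have q01: "0 < q" "q < 1" using h by (auto simp: q power_less_one_iff)
  let ?B = "\<Prod>l=1..k-1. qX q k - qX q l" and ?A = "\<Prod>l\<in>{k<..n}. qX q l - qX q k"
  have "{1..n} - {k} = {1..k-1} \<union> {k<..n}" "{1..k-1} \<inter> {k<..n} = {}" using k by auto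
  then have "(\<Prod>l\<in>{1..n} - {k}. \<bar>qX q k - qX q l\<bar>) = (\<Prod>l=1..k-1. \<bar>qX q k - qX q l\<bar>) * (\<Prod>l\<in>{k<..n}. \<bar>qX q k - qX q l\<bar>)"
    by (simp add: prod.union_disjoint)
  also have "(\<Prod>l=1..k-1. \<bar>qX q k - qX q l\<bar>) = ?B"
  proof (rule prod.cong)
    fix l assume "l \<in> {1..k-1}"
    then have "qX q l < qX q k" using k q01 by (intro qX_strict_mono) auto
    then show "\<bar>qX q k - qX q l\<bar> = qX q k - qX q l" by simp
  qed simp
  also have "(\<Prod>l\<in>{k<..n}. \<bar>qX q k - qX q l\<bar>) = ?A"
  proof (rule prod.cong)
    fix l assume "l \<in> {k<..n}"
    then have "qX q k < qX q l" using q01 by (intro qX_strict_mono) auto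
    then show "\<bar>qX q k - qX q l\<bar> = qX q l - qX q k" by simp
  qed simp
  finally have rows: "(\<Prod>l\<in>{1..n} - {k}. \<bar>qX q k - qX q l\<bar>) = ?B * ?A" .
  obtain j where j: "k = Suc j" using k by (cases k) auto
  have pos: "qpoch q N > 0" "qpoch q N \<noteq> 0" for N using qpoch_pos[OF q01, of N] by auto
  have 1: "?B * (q ^ (k * j) * qpoch q k) = qpoch q j * qpoch q (k + j)"
    using qX_row_below[OF q01(1), of j k] j by simp
  have 2: "?A * (h ^ (n * (n + 1)) * qpoch q (2 * k)) = qpoch q (n - k) * qpoch q (n + k) * h ^ (k * (k + 1))"
    by (rule qX_row_above[OF h(1) k(2) q])
  have f1: "qpoch q k = qpoch q j * (1 - q ^ k)" unfolding j by (rule qpoch_Suc)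
  have f2: "qpoch q (2 * k) = qpoch q (k + j) * (1 - q ^ (2 * k))"
  proof -
    have "2 * k = Suc (k + j)" using j by simp
    then show ?thesis using qpoch_Suc[of q "k + j"] by (simp only:)
  qed
  have pw1: "q ^ k < 1" "q ^ (2 * k) < 1" using q01 k by (auto simp: power_less_one_iff)
  have B: "?B = qpoch q (k + j) / (q ^ (k * j) * (1 - q ^ k))"
  proof -
    have "1 - q ^ k \<noteq> 0" "q ^ (k * j) \<noteq> 0" using q01 pw1 by auto
    moreover have "a = e / (b * d)" if "a * (b * (c * d)) = c * e" "b \<noteq> 0" "c \<noteq> 0" "d \<noteq> 0" for a b c d e :: real
    proof -
      have "c * (a * (b * d)) = c * e" using that(1) by (simp add: mult_ac)
      then show ?thesis using that(2-4) by (simp add: eq_divide_eq)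
    qed
    ultimately show ?thesis using 1 pos(2)[of j] unfolding f1 by blast
  qed
  have A: "?A = qpoch q (n - k) * qpoch q (n + k) * h ^ (k * (k + 1)) / (h ^ (n * (n + 1)) * (qpoch q (k + j) * (1 - q ^ (2 * k))))"
  proof -
    have "1 - q ^ (2 * k) \<noteq> 0" using pw1 by auto
    then have "h ^ (n * (n + 1)) * qpoch q (2 * k) \<noteq> 0" using pos(2) h by simp
    then show ?thesis using 2 unfolding f2 by (rule nonzero_eq_divide_eq[THEN iffD2])
  qed
  define u where "u = h ^ k"
  have u: "0 < u" "u < 1" using h k by (auto simp: u_def power_less_one_iff)
  have qk: "q ^ k = u\<^sup>2" "q ^ (2 * k) = (u\<^sup>2)\<^sup>2"
    by (simp_all add: u_def q power_mult[symmetric] mult_ac)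
  have pw: "q powr (real k ^ 2 / 2) = h ^ (k * k)"
  proof -
    have "q = h powr 2" using h by (simp add: q powr_numeral)
    then have "q powr (real k ^ 2 / 2) = h powr (real (k * k))"
      by (simp add: powr_powr power2_eq_square)
    then show ?thesis using powr_realpow[OF h(1), of "k * k"] by simp
  qed
  have e: "h ^ (k * k) * h ^ (k * (k + 1)) = q ^ (k * j) * (u * u\<^sup>2)"
  proof -
    have "k * k + k * (k + 1) = 2 * (k * j) + (k + k * 2)" using j by (simp add: algebra_simps)
    then show ?thesis
      unfolding q u_def by (simp only: power_mult[symmetric] power_add[symmetric])
  qed
  have s: "1 - u\<^sup>2 \<noteq> 0" "1 - (u\<^sup>2)\<^sup>2 \<noteq> 0"
  proof -
    have "u\<^sup>2 < 1" "(u\<^sup>2)\<^sup>2 < 1" using u by (auto simp: power_less_one_iff simp flip: power_mult)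
    then show "1 - u\<^sup>2 \<noteq> 0" "1 - (u\<^sup>2)\<^sup>2 \<noteq> 0" by linarith+
  qed
  let ?N = "h ^ (n * (n + 1))"
  have "point_weight q n k * (?B * ?A) * qY h k
      = (u\<^sup>2 + 1 / u\<^sup>2 - 2) * (h ^ (k * k) * h ^ (k * (k + 1))) * (qpoch q (2 * n) / (qpoch q (n + k) * qpoch q (n - k)))
        * (qpoch q (k + j) / (q ^ (k * j) * (1 - u\<^sup>2)))
        * (qpoch q (n - k) * qpoch q (n + k) / (?N * (qpoch q (k + j) * (1 - (u\<^sup>2)\<^sup>2)))) * (u + 1 / u)"
  proof -
    have "point_weight q n k = (u\<^sup>2 + 1 / u\<^sup>2 - 2) * h ^ (k * k) * (qpoch q (2 * n) / (qpoch q (n + k) * qpoch q (n - k)))"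
      unfolding point_weight_def pw qX_def qk ..
    moreover have "qY h k = u + 1 / u" by (simp add: qY_def u_def)
    ultimately show ?thesis
      unfolding A[unfolded qk] B[unfolded qk] by (simp only: divide_inverse inverse_mult_distrib mult_ac)
  qed
  also have "\<dots> = qpoch q (2 * n) / ?N * ((u\<^sup>2 + 1 / u\<^sup>2 - 2) * (u * u\<^sup>2) * (u + 1 / u) / ((1 - u\<^sup>2) * (1 - (u\<^sup>2)\<^sup>2)))"
    unfolding e using pos(2) q01 by (simp add: mult_ac)
  also have "(u\<^sup>2 + 1 / u\<^sup>2 - 2) * (u * u\<^sup>2) * (u + 1 / u) = (1 - u\<^sup>2) * (1 - (u\<^sup>2)\<^sup>2)"
    using u by (simp add: field_simps power2_eq_square)
  finally show ?thesis unfolding rows using s by simp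
qed

lemma subset_sum_evaluation:
  assumes g: "0 < g" "g < 1" and h: "h = g\<^sup>2" and q: "q = h\<^sup>2" and r: "r + m \<ge> 1"
  shows "(\<Sum>A | A \<subseteq> {1..r + m} \<and> card A = r. vander_set (qX q) A * (\<Prod>a\<in>A. point_weight q (r + m) a))
    = (qpoch q (2 * (r + m)) / h ^ ((r + m) * (r + m + 1))) ^ r
      / (vander_set (qX q) {1..r + m} * (\<Prod>l=1..r + m. qY h l)) * odd_sum_value g r m"
proof -
  let ?n = "r + m" and ?N = "{1..r + m}"
  let ?V = "vander_set (qX q) ?N * (\<Prod>l\<in>?N. qY h l)" and ?u = "\<lambda>A. (\<Prod>l\<in>?N - A. qY h l) * vander_set (qX q) (?N - A)"
  have h01: "0 < h" "h < 1" using g by (auto simp: h power_less_one_iff)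
  have q01: "0 < q" "q < 1" using h01 by (auto simp: q power_less_one_iff)
  let ?C = "qpoch q (2 * ?n) / h ^ (?n * (?n + 1))"
  have xX: "(\<lambda>l. xvar (g ^ (2 * l))) = qX q" and yY: "(\<lambda>l. recip 1 1 (g ^ (2 * l))) = qY h"
    by (auto simp: fun_eq_iff xvar_def recip_def qX_def qY_def h q power_mult[symmetric] mult_ac)
  have Ypos: "qY h l > 0" for l using h01 by (simp add: qY_def add_pos_pos)
  have VN: "vander_set (qX q) ?N > 0"
    unfolding vander_set_def using qX_strict_mono[OF q01] by (intro prod_pos ballI) (force simp: less_imp_neq)
  have trm: "vander_set (qX q) A * (\<Prod>a\<in>A. point_weight q ?n a)
     = ?C ^ r / (?V) * (?u A)"
    if A: "A \<subseteq> ?N" "card A = r" for A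
  proof -
    have fA: "finite A" using A finite_subset by blast
    let ?R = "\<Prod>a\<in>A. \<Prod>b\<in>?N - {a}. \<bar>qX q a - qX q b\<bar>"
    have "(\<Prod>a\<in>A. point_weight q ?n a) * ?R * (\<Prod>a\<in>A. qY h a) = (\<Prod>a\<in>A. ?C)"
      unfolding prod.distrib[symmetric]
    proof (rule prod.cong[OF refl])
      fix a assume "a \<in> A"
      then have "1 \<le> a" "a \<le> ?n" using A by auto
      then show "point_weight q ?n a * (\<Prod>b\<in>?N - {a}. \<bar>qX q a - qX q b\<bar>) * qY h a = ?C"
        by (rule point_weight_row[OF h01 q])
    qed
    then have W: "(\<Prod>a\<in>A. point_weight q ?n a) * ?R * (\<Prod>a\<in>A. qY h a) = ?C ^ r" using A by simp
    have Y: "(\<Prod>l\<in>?N. qY h l) = (\<Prod>l\<in>?N - A. qY h l) * (\<Prod>a\<in>A. qY h a)"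
      using A by (intro prod.subset_diff) auto
    have V: "vander_set (qX q) A * vander_set (qX q) ?N = ?R * vander_set (qX q) (?N - A)"
      by (rule vander_set_complement) (use A in auto)
    have YA: "(\<Prod>a\<in>A. qY h a) \<noteq> 0" "(\<Prod>l\<in>?N - A. qY h l) \<noteq> 0"
      using Ypos by (metis less_irrefl prod_pos)+
    have alg: "vA * W = c / (vN * (yL * yA)) * (yL * vL)"
      if "W * R * yA = c" "vA * vN = R * vL" "vN \<noteq> 0" "yL \<noteq> 0" "yA \<noteq> 0" for vA W c vN yL yA vL R :: real
    proof -
      have "vA * W * (vN * yA) = W * yA * (vA * vN)" by simp
      also have "\<dots> = c * vL" unfolding that(2) that(1)[symmetric] by simp
      finally have "vA * W = c * vL / (vN * yA)" using that by (simp add: eq_divide_eq)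
      then show ?thesis using that by simp
    qed
    show ?thesis unfolding Y by (rule alg[OF W V _ YA(2,1)]) (use VN in simp)
  qed
  have "(\<Sum>A | A \<subseteq> ?N \<and> card A = r. vander_set (qX q) A * (\<Prod>a\<in>A. point_weight q ?n a))
     = (\<Sum>A | A \<subseteq> ?N \<and> card A = r. ?C ^ r / (?V) * (?u A))"
    by (rule sum.cong) (use trm in auto)
  also have "\<dots> = ?C ^ r / (?V)
      * (\<Sum>A | A \<subseteq> ?N \<and> card A = r. ?u A)"
    by (rule sum_distrib_left[symmetric])
  also have "(\<Sum>A | A \<subseteq> ?N \<and> card A = r. ?u A)
     = (\<Sum>L | L \<subseteq> ?N \<and> card L = m. (\<Prod>l\<in>L. qY h l) * vander_set (qX q) L)"
  proof (rule sum.reindex_bij_witness[where i = "\<lambda>L. ?N - L" and j = "\<lambda>A. ?N - A"])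
    fix A assume "A \<in> {A. A \<subseteq> ?N \<and> card A = r}"
    moreover from this have "finite A" using finite_subset by blast
    ultimately show "?N - (?N - A) = A" "?N - A \<in> {L. L \<subseteq> ?N \<and> card L = m}"
      by (auto simp: card_Diff_subset)
  next
    fix A assume "A \<in> {A. A \<subseteq> ?N \<and> card A = m}"
    moreover from this have "finite A" using finite_subset by blast
    ultimately show "?N - (?N - A) = A" "?N - A \<in> {L. L \<subseteq> ?N \<and> card L = r}"
      by (auto simp: card_Diff_subset)
  qed simp
  also have "\<dots> = odd_sum_value g r m"
    using odd_subset_sum[OF g r] by (simp only: xX yY fun_cong[OF yY])
  finally show ?thesis .
qed

section \<open>The q-Gamma function at half-integers\<close>

lemma prod_shift:
  fixes f :: "nat \<Rightarrow> real"
  shows "(\<Prod>j<s. f (Suc (a + j))) * f a = (\<Prod>j<s. f (a + j)) * f (a + s)"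
  by (induction s) (simp_all add: mult_ac)

text \<open>The symbol \<open>(- 1; h)_k\<close>. It is used instead of \<open>(- h; h)_k\<close> because the latter at \<open>k = - 1\<close> occurs in the theorem;
  shifting the index by one makes all indices natural numbers.\<close>

definition pochm :: "real \<Rightarrow> nat \<Rightarrow> real" where "pochm h k = (\<Prod>i<k. 1 + h ^ i)"

lemma pochm_Suc: "pochm h (Suc k) = pochm h k * (1 + h ^ k)" by (simp add: pochm_def)
lemma pochm_pos: "h > 0 \<Longrightarrow> pochm h k > 0" unfolding pochm_def by (intro prod_pos) (auto intro: add_pos_pos)

lemma qpoch_split: "q = h\<^sup>2 \<Longrightarrow> 2 * qpoch q k = qpoch h k * pochm h (Suc k)"
proof (induction k)
  case (Suc k)
  have "q ^ Suc k = h ^ Suc k * h ^ Suc k"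
    unfolding Suc.prems by (simp add: power_mult[symmetric] power_add[symmetric] mult_2)
  then have "1 - q ^ Suc k = (1 - h ^ Suc k) * (1 + h ^ Suc k)" by (simp add: algebra_simps)
  then show ?case using Suc by (simp add: qpoch_Suc pochm_Suc[of h "Suc k"] del: power_Suc)
qed (simp add: pochm_def)

lemma q_poch_pochm: "0 < h \<Longrightarrow> h < 1 \<Longrightarrow> q_poch (-1) h (int k) = pochm h k"
  by (simp add: q_poch_nat pochm_def)

lemma q_poch_half:
  assumes "0 < h" "h < 1"
  shows "q_poch (- h) h (int k - 1) = pochm h k / 2"
proof (induction k)
  case 0
  have "q_poch (- h) h (-1 + 1) = q_poch (- h) h (-1) * (1 - - h * h powi (-1))"
    using assms by (intro q_poch_Suc) (auto simp: power_int_minus)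
  then have "1 = q_poch (- h) h (-1) * 2"
    using assms q_poch_0[of h "- h"] by (simp add: power_int_minus)
  then show ?case by (simp add: pochm_def)
next
  case (Suc k)
  have e: "- h * h powi (int k - 1) = - (h ^ k)"
    using assms by (simp add: power_int_diff)
  have "q_poch (- h) h (int k - 1 + 1) = q_poch (- h) h (int k - 1) * (1 - - h * h powi (int k - 1))"
  proof (rule q_poch_Suc[OF assms])
    show "- h * h powi (int k - 1) < 1"
      unfolding e using zero_less_power[OF assms(1), of k] by linarith
  qed
  then show ?case using Suc unfolding e by (simp add: pochm_Suc)
qed

lemma q_Gamma_pos:
  assumes "0 < q" "q < 1" "x > 0"
  shows "q_Gamma q x \<noteq> 0"
proof -
  have "q powr x < 1" using assms by (simp add: powr01_less_one)
  then show ?thesis using assms q_poch_inf_nonzero by (simp add: q_Gamma_def)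
qed

lemma q_Gamma_plus1:
  assumes "0 < q" "q < 1" "x > 0"
  shows "q_Gamma q (x + 1) = (1 - q powr x) / (1 - q) * q_Gamma q x"
proof -
  have l: "q powr x < 1" using assms by (simp add: powr01_less_one)
  have "q powr (x + 1) = q powr x * q" using assms by (simp add: powr_add)
  then have "q_poch_inf (q powr x) q = (1 - q powr x) * q_poch_inf (q powr (x + 1)) q"
    using q_poch_inf_step[OF assms(1,2) l] by simp
  moreover have "(1 - q) powr (1 - (x + 1)) = (1 - q) powr (1 - x) / (1 - q)"
    using assms powr_diff[of "1 - q" "1 - x" 1] by simp
  ultimately show ?thesis using l by (simp add: q_Gamma_def)
qed

text \<open>The q-Gamma function at \<open>k / 2\<close>, so that half-integers are indexed by natural numbers.\<close>

definition gam2 :: "real \<Rightarrow> nat \<Rightarrow> real" where "gam2 q k = q_Gamma q (real k / 2)"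

lemma gam2_nonzero: "0 < q \<Longrightarrow> q < 1 \<Longrightarrow> k \<ge> 1 \<Longrightarrow> gam2 q k \<noteq> 0"
  unfolding gam2_def by (rule q_Gamma_pos) auto

lemma gam2_step:
  assumes "0 < h" "h < 1" "q = h\<^sup>2" "k \<ge> 1"
  shows "gam2 q (k + 2) = (1 - h ^ k) / (1 - q) * gam2 q k"
proof -
  have q: "0 < q" "q < 1" using assms by (auto simp: power_less_one_iff)
  have "q powr (real k / 2) = h ^ k"
  proof -
    have "q = h powr 2" using assms by (simp add: powr_numeral)
    then have "q powr (real k / 2) = h powr (2 * (real k / 2))" by (simp only: powr_powr)
    then show ?thesis using assms(1) by (simp add: powr_realpow)
  qed
  moreover have e: "real (k + 2) / 2 = real k / 2 + 1" by simp
  ultimately show ?thesis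
    unfolding gam2_def e using q_Gamma_plus1[OF q, of "real k / 2"] assms(4) by simp
qed

lemma gam2_2: "0 < q \<Longrightarrow> q < 1 \<Longrightarrow> gam2 q 2 = 1"
  using q_poch_inf_nonzero by (simp add: gam2_def q_Gamma_def)

lemma gam2_even:
  assumes "0 < h" "h < 1" "q = h\<^sup>2"
  shows "gam2 q (2 * n + 2) = qpoch q n / (1 - q) ^ n"
proof (induction n)
  case 0
  have "0 < q" "q < 1" using assms by (auto simp: power_less_one_iff)
  from gam2_2[OF this] show ?case by (simp add: numeral_2_eq_2)
next
  case (Suc n)
  have "h ^ (2 * n + 2) = q ^ Suc n"
    unfolding assms(3) power_mult[symmetric] by simp
  then have "gam2 q (2 * Suc n + 2) = (1 - q ^ Suc n) / (1 - q) * gam2 q (2 * n + 2)"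
    using gam2_step[OF assms, of "2 * n + 2"] by simp
  then show ?case unfolding Suc by (simp add: qpoch_Suc mult_ac)
qed

text \<open>The duplication formula at half-integers, by induction from the functional equation.\<close>

lemma gam2_dup:
  assumes "0 < h" "h < 1" "q = h\<^sup>2"
  shows "gam2 q (k + 1) * gam2 q (k + 2) = gam2 q 1 * qpoch h k / (1 - q) ^ k"
proof (induction k)
  case 0
  have "0 < q" "q < 1" using assms by (auto simp: power_less_one_iff)
  from gam2_2[OF this] show ?case by (simp add: numeral_2_eq_2)
next
  case (Suc k)
  have "gam2 q (Suc k + 1) * gam2 q (Suc k + 2) = gam2 q (k + 2) * ((1 - h ^ (k + 1)) / (1 - q) * gam2 q (k + 1))"
    using gam2_step[OF assms, of "k + 1"] by (simp add: numeral_2_eq_2)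
  also have "\<dots> = (1 - h ^ (k + 1)) / (1 - q) * (gam2 q (k + 1) * gam2 q (k + 2))"
    by (simp only: mult_ac)
  finally show ?case unfolding Suc by (simp add: qpoch_Suc mult_ac)
qed

section \<open>The two sides as functions of r and m\<close>

text \<open>The right-hand side of the theorem without \<open>2^r r!\<close>, for \<open>n = r + m\<close>. The products over \<open>i\<close> are reindexed so
  that the arguments increase with \<open>j\<close>; an increment of \<open>m\<close> then shifts each run of arguments.\<close>

definition gamma_side :: "real \<Rightarrow> real \<Rightarrow> nat \<Rightarrow> nat \<Rightarrow> real" where
  "gamma_side q h r m = 1 / q_fact q r * pochm h (r + 1)
     * ((\<Prod>k<m. 1 + h ^ (r + 2 + 2 * k)) / (\<Prod>k<m. 1 + h ^ (2 * k)))
     * (\<Prod>j<r + 1. pochm h (j + 1) / 2) * (\<Prod>j<r + 1. pochm h (2 * m + j)) / (\<Prod>j<r + 1. pochm h (2 * (m + j) + 1))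
     * (\<Prod>j<r. gam2 q (j + 3))\<^sup>2 / gam2 q 1 ^ r
     * (gam2 q (4 * (r + m) + 2) ^ r * (\<Prod>j<r. gam2 q (2 * (m + j) + 3))
        / ((\<Prod>j<r. gam2 q (2 * (m + j) + 2)) * (\<Prod>j<r. gam2 q (2 * m + r + 2 + j))\<^sup>2))"

text \<open>The left-hand side of the theorem without \<open>2^r r!\<close>, for \<open>n = r + m\<close>, as evaluated by
  \<open>lhs_eq_subset_sum\<close> and \<open>subset_sum_evaluation\<close>.\<close>

definition subset_side :: "real \<Rightarrow> real \<Rightarrow> real \<Rightarrow> nat \<Rightarrow> nat \<Rightarrow> real" where
  "subset_side q h g r m = (\<Prod>s=1..r. h ^ (s * s) / (1 - q) ^ (2 * s))
     * ((qpoch q (2 * (r + m)) / h ^ ((r + m) * (r + m + 1))) ^ r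
      / (vander_set (qX q) {1..r + m} * (\<Prod>l=1..r + m. qY h l)) * odd_sum_value g r m)"

lemma gamma_side_0: "gamma_side q h 0 0 = 1"
  by (simp add: gamma_side_def q_fact_def pochm_def)

lemma subset_side_0: "subset_side q h g 0 0 = 1"
  by (simp add: subset_side_def odd_sum_value_def vander_set_def)

lemma qpoch_add: "qpoch q (a + b) = qpoch q a * (\<Prod>k<b. 1 - q ^ (a + k + 1))"
  by (induction b) (simp_all add: qpoch_Suc)

lemma vander_set_Suc:
  assumes "0 < q" "q < 1"
  shows "vander_set (qX q) {1..Suc n} = vander_set (qX q) {1..n} * (qpoch q n * qpoch q (2 * n + 1) / (q ^ (n * (n + 1)) * qpoch q (n + 1)))"
proof -
  have "{1..Suc n} = insert (Suc n) {1..n}" by auto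
  then have "vander_set (qX q) {1..Suc n} = (\<Prod>l\<in>{1..n}. \<bar>qX q l - qX q (Suc n)\<bar>) * vander_set (qX q) {1..n}"
    by (simp only:) (rule vander_set_insert_max, auto)
  also have "(\<Prod>l\<in>{1..n}. \<bar>qX q l - qX q (Suc n)\<bar>) = (\<Prod>l=1..n. qX q (Suc n) - qX q l)"
  proof (rule prod.cong)
    fix l assume "l \<in> {1..n}"
    then have "qX q l < qX q (Suc n)" using assms by (intro qX_strict_mono) auto
    then show "\<bar>qX q l - qX q (Suc n)\<bar> = qX q (Suc n) - qX q l" by simp
  qed simp
  also have "\<dots> = qpoch q n * qpoch q (2 * n + 1) / (q ^ (n * (n + 1)) * qpoch q (n + 1))"
  proof -
    have "(\<Prod>l=1..n. qX q (Suc n) - qX q l) * (q ^ (n * (n + 1)) * qpoch q (n + 1)) = qpoch q n * qpoch q (2 * n + 1)"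
    proof -
      have e: "Suc n + n = 2 * n + 1" "Suc n * n = n * (n + 1)" by simp_all
      show ?thesis using qX_row_below[OF assms(1), of n "Suc n"] unfolding e by simp
    qed
    moreover have "q ^ (n * (n + 1)) * qpoch q (n + 1) \<noteq> 0" using assms qpoch_pos[OF assms, of "n + 1"] by simp
    ultimately show ?thesis by (intro nonzero_eq_divide_eq[THEN iffD2])
  qed
  finally show ?thesis by (simp only: mult.commute)
qed

text \<open>The new row of a Vandermonde product over the exponents \<open>t + 1, t + 3, ...\<close>. As the exponents have
  the same parity, the differences involve only powers of \<open>q = h^2\<close>, and the row is a quotient of q-factorials.\<close>

lemma row_step:
  assumes "0 < h" "h < 1" "q = h\<^sup>2"
  shows "(\<Prod>k<m. qX h (Suc t + 2 * m) - qX h (Suc t + 2 * k))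
     = qpoch q m * qpoch q (t + 2 * m) / (h ^ ((Suc t + 2 * m) * m) * qpoch q (t + m))"
proof -
  have q: "0 < q" "q < 1" using assms by (auto simp: power_less_one_iff)
  have "(\<Prod>k<m. qX h (Suc t + 2 * m) - qX h (Suc t + 2 * k))
     = (\<Prod>k<m. (1 - q ^ (m - k)) * (1 - q ^ (t + m + k + 1)) / h ^ (Suc t + 2 * m))"
  proof (rule prod.cong)
    fix k assume k: "k \<in> {..<m}"
    have "h ^ (Suc t + 2 * m - (Suc t + 2 * k)) = q ^ (m - k)" "h ^ (Suc t + 2 * m + (Suc t + 2 * k)) = q ^ (t + m + k + 1)"
      using k unfolding assms(3) power_mult[symmetric] by (auto intro!: arg_cong[where f = "power h"])
    then show "qX h (Suc t + 2 * m) - qX h (Suc t + 2 * k) = (1 - q ^ (m - k)) * (1 - q ^ (t + m + k + 1)) / h ^ (Suc t + 2 * m)"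
      using qX_diff[of h "Suc t + 2 * k" "Suc t + 2 * m"] assms(1) k by simp
  qed simp
  also have "\<dots> = (\<Prod>k<m. 1 - q ^ (m - k)) * (\<Prod>k<m. 1 - q ^ (t + m + k + 1)) / h ^ ((Suc t + 2 * m) * m)"
    by (simp only: prod_dividef prod.distrib prod_constant card_lessThan power_mult)
  also have "(\<Prod>k<m. 1 - q ^ (m - k)) = qpoch q m"
    unfolding qpoch_def by (subst prod.nat_diff_reindex[symmetric]) (auto intro!: prod.cong simp: Suc_diff_Suc)
  also have "(\<Prod>k<m. 1 - q ^ (t + m + k + 1)) = qpoch q (t + 2 * m) / qpoch q (t + m)"
    using qpoch_add[of q "t + m" m] qpoch_pos[OF q, of "t + m"] by (simp add: mult_2 add.assoc)
  finally show ?thesis by simp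
qed

lemma odd_sum_value_Suc:
  assumes g: "0 < g" "g < 1" and h: "h = g\<^sup>2" and q: "q = h\<^sup>2"
  shows "odd_sum_value g r (Suc m) = odd_sum_value g r m * ((1 - h ^ (r + 1 + 2 * m)) * (1 + h ^ (r + 2 + 2 * m)) / (1 - h ^ (2 * m + 1)) / h ^ (r + m + 1)
     * (qpoch q m * qpoch q (r + 2 * m) / (h ^ ((r + 1 + 2 * m) * m) * qpoch q (r + m))
        * (qpoch q m * qpoch q (r + 1 + 2 * m) / (h ^ ((r + 2 + 2 * m) * m) * qpoch q (r + 1 + m)))
        / (qpoch q m * qpoch q (2 * m) / (h ^ ((1 + 2 * m) * m) * qpoch q m))))"
proof -
  have h01: "0 < h" "h < 1" using g by (auto simp: h power_less_one_iff)
  have X: "xvar (g ^ a) = qX h a" for a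
    by (simp add: xvar_def recip_def qX_def h power_mult[symmetric] mult.commute)
  have z: "recip (-1) 1 (g ^ a) = - ((1 - h ^ a) / g ^ a)" and y: "recip 1 1 (g ^ a) = (1 + h ^ a) / g ^ a" for a
  proof -
    have "h ^ a = g ^ a * g ^ a" by (simp add: h power2_eq_square power_mult_distrib)
    then show "recip (-1) 1 (g ^ a) = - ((1 - h ^ a) / g ^ a)" "recip 1 1 (g ^ a) = (1 + h ^ a) / g ^ a"
      using g by (simp_all add: recip_def field_simps)
  qed
  have gg: "g ^ (r + 1 + 2 * m) * g ^ (r + 2 + 2 * m) = h ^ (r + m + 1) * g ^ (2 * m + 1)"
    unfolding h power_mult[symmetric] power_add[symmetric] by (simp add: algebra_simps)
  have zz: "recip (-1) 1 (g ^ (r + 1 + 2 * m)) * recip 1 1 (g ^ (r + 2 + 2 * m)) / recip (-1) 1 (g ^ (2 * m + 1))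
    = (1 - h ^ (r + 1 + 2 * m)) * (1 + h ^ (r + 2 + 2 * m)) / (1 - h ^ (2 * m + 1)) / h ^ (r + m + 1)"
  proof -
    have "(- (a / b)) * (c / d) / (- (e / f)) = a * c / e / p" if "b * d = p * f" "f \<noteq> 0" for a b c d e f p :: real
    proof -
      have "(- (a / b)) * (c / d) / (- (e / f)) = a * c * f / (e * (b * d))" by simp
      then show ?thesis unfolding that(1) using that(2) by simp
    qed
    then show ?thesis unfolding z y using gg g by simp
  qed
  have t: "odd_sum_value g r (Suc m) = odd_sum_value g r m * (recip (-1) 1 (g ^ (r + 1 + 2 * m)) * recip 1 1 (g ^ (r + 2 + 2 * m)) / recip (-1) 1 (g ^ (2 * m + 1))
     * ((\<Prod>k<m. qX h (r + 1 + 2 * m) - qX h (r + 1 + 2 * k)) * (\<Prod>k<m. qX h (r + 2 + 2 * m) - qX h (r + 2 + 2 * k))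
        / (\<Prod>k<m. qX h (2 * m + 1) - qX h (2 * k + 1))))"
    unfolding odd_sum_value_def prod.lessThan_Suc X prod_dividef prod.distrib
    by (simp only: divide_inverse inverse_mult_distrib mult_ac)
  have r1: "(\<Prod>k<m. qX h (r + 1 + 2 * m) - qX h (r + 1 + 2 * k))
     = qpoch q m * qpoch q (r + 2 * m) / (h ^ ((r + 1 + 2 * m) * m) * qpoch q (r + m))"
    using row_step[OF h01 q, where t = r and m = m] by simp
  have r2: "(\<Prod>k<m. qX h (r + 2 + 2 * m) - qX h (r + 2 + 2 * k))
     = qpoch q m * qpoch q (r + 1 + 2 * m) / (h ^ ((r + 2 + 2 * m) * m) * qpoch q (r + 1 + m))"
    using row_step[OF h01 q, where t = "r + 1" and m = m] by simp
  have r3: "(\<Prod>k<m. qX h (2 * m + 1) - qX h (2 * k + 1))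
     = qpoch q m * qpoch q (2 * m) / (h ^ ((1 + 2 * m) * m) * qpoch q m)"
    using row_step[OF h01 q, where t = 0 and m = m] by simp
  show ?thesis
    unfolding t zz r1 r2 r3 by (simp only: mult.assoc)
qed

text \<open>The powers of \<open>h\<close> cancel because, with \<open>n = r + m\<close>, their exponents add up to
  \<open>(n + 1) (2 n + 1 - 2 r - 2 m - 1) = 0\<close>.\<close>

lemma subset_side_Suc:
  fixes r m :: nat
  assumes g: "0 < g" "g < 1" and h: "h = g\<^sup>2" and q: "q = h\<^sup>2"
  defines "n \<equiv> r + m"
  shows "subset_side q h g r (Suc m) = subset_side q h g r m
    * (((1 - q ^ (2 * n + 1)) * (1 - q ^ (2 * n + 2))) ^ r
       * ((1 - h ^ (r + 1 + 2 * m)) * (1 + h ^ (r + 2 + 2 * m)) / (1 - h ^ (2 * m + 1)))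
       * (qpoch q m ^ 2 * qpoch q (r + 2 * m) * qpoch q (r + 1 + 2 * m))
       / ((qpoch q (n)) ^ 2 * qpoch q (2 * m) * qpoch q (2 * n + 1) * (1 + q ^ (n + 1))))"
proof -
  define N where "N = n"
  have nN: "r + m = N" "r + Suc m = Suc N" "n = N" "r + m + 1 = N + 1" "r + 1 + m = N + 1" by (simp_all add: N_def n_def)
  have h01: "0 < h" "h < 1" using g by (auto simp: h power_less_one_iff)
  have q01: "0 < q" "q < 1" using h01 by (auto simp: q power_less_one_iff)
  have pos: "qpoch q k \<noteq> 0" for k using qpoch_pos[OF q01, of k] by simp
  let ?c = "(1 - q ^ (2 * N + 1)) * (1 - q ^ (2 * N + 2))"
  have "2 * Suc N = Suc (Suc (2 * N))" by simp
  then have f: "qpoch q (2 * Suc N) = qpoch q (2 * N) * ?c"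
    by (simp add: qpoch_Suc)
  have hN: "h ^ (Suc N * (Suc N + 1)) = h ^ (N * (N + 1)) * h ^ (2 * N + 2)"
    unfolding power_add[symmetric] by (rule arg_cong[where f = "power h"]) simp
  have C: "(qpoch q (2 * Suc N) / h ^ (Suc N * (Suc N + 1))) ^ r
     = (qpoch q (2 * N) / h ^ (N * (N + 1))) ^ r * (?c ^ r / h ^ ((2 * N + 2) * r))"
  proof -
    have "(x * c / (a * b)) ^ r = (x / a) ^ r * (c ^ r / b ^ r)" for x c a b :: real
      by (simp add: power_divide power_mult_distrib)
    then show ?thesis unfolding f hN power_mult[of h _ r] .
  qed
  have Y: "(\<Prod>l=1..Suc N. qY h l) = (\<Prod>l=1..N. qY h l) * ((1 + q ^ (N + 1)) / h ^ (N + 1))"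
  proof -
    have "qY h (Suc N) = (1 + q ^ (N + 1)) / h ^ (N + 1)"
    proof -
      have "q ^ (N + 1) = h ^ (N + 1) * h ^ (N + 1)"
        unfolding q by (simp only: power_mult[symmetric] power_add[symmetric] mult_2)
      then show ?thesis using h01 by (simp add: qY_def field_simps)
    qed
    then show ?thesis by simp
  qed
  have V: "vander_set (qX q) {1..Suc N} = vander_set (qX q) {1..N} * (qpoch q N * qpoch q (2 * N + 1) / (h ^ (2 * (N * (N + 1))) * qpoch q (N + 1)))"
    using vander_set_Suc[OF q01, of N] unfolding q by (simp only: power_mult)
  define p where "p = (1 - h ^ (r + 1 + 2 * m)) * (1 + h ^ (r + 2 + 2 * m)) / (1 - h ^ (2 * m + 1))"
  define a where "a = qpoch q (r + 2 * m)"
  define b where "b = qpoch q (r + 1 + 2 * m)"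
  have T: "odd_sum_value g r (Suc m) = odd_sum_value g r m * (p / h ^ (N + 1) * (qpoch q m * a / (h ^ ((r + 1 + 2 * m) * m) * qpoch q N)
     * (qpoch q m * b / (h ^ ((r + 2 + 2 * m) * m) * qpoch q (N + 1))) / (qpoch q m * qpoch q (2 * m) / (h ^ ((1 + 2 * m) * m) * qpoch q m))))"
    unfolding odd_sum_value_Suc[OF g h q] p_def a_def b_def nN ..
  have hh: "h ^ (2 * (N * (N + 1))) * h ^ (N + 1) * h ^ ((1 + 2 * m) * m)
     = h ^ ((2 * N + 2) * r) * (h ^ (N + 1) * (h ^ ((r + 1 + 2 * m) * m) * h ^ ((r + 2 + 2 * m) * m)))"
    unfolding power_add[symmetric] nN(1)[symmetric]
    by (rule arg_cong[where f = "power h"]) (simp add: algebra_simps)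
  have alg: "P * (C * (cr / H1) / (V * (x * y / (H2 * z)) * (Yy * (w / H3))) * (t * (p / H3 * (M * a / (H4 * x) * (M * b / (H5 * z)) / (M * d / (H6 * M))))))
      = P * (C / (V * Yy) * t) * (cr * p * (M ^ 2 * a * b) / (x ^ 2 * d * y * w))"
    if "H2 * H3 * H6 = H1 * (H3 * (H4 * H5))" "H1 \<noteq> 0" "H2 \<noteq> 0" "H3 \<noteq> 0" "H4 \<noteq> 0" "H5 \<noteq> 0" "H6 \<noteq> 0" "M \<noteq> 0" "z \<noteq> 0"
    for P C cr V x y z w t p M a b d Yy H1 H2 H3 H4 H5 H6 :: real
  proof -
    have "P * (C * (cr / H1) / (V * (x * y / (H2 * z)) * (Yy * (w / H3))) * (t * (p / H3 * (M * a / (H4 * x) * (M * b / (H5 * z)) / (M * d / (H6 * M))))))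
      = P * (C / (V * Yy) * t) * (cr * p * (M ^ 2 * a * b) / (x ^ 2 * d * y * w)) * ((H2 * H3 * H6) / (H1 * (H3 * (H4 * H5))))"
      using that(2-) by (simp add: power2_eq_square mult_ac)
    then show ?thesis unfolding that(1) using that(2-) by simp
  qed
  show ?thesis
    unfolding subset_side_def nN C V Y T p_def[symmetric] a_def[symmetric] b_def[symmetric]
    by (rule alg[OF hh]) (use h01 pos in simp_all)
qed

lemma prod_shift_div:
  fixes f :: "nat \<Rightarrow> real"
  assumes "f a \<noteq> 0"
  shows "(\<Prod>j<s. f (Suc (a + j))) = (\<Prod>j<s. f (a + j)) * f (a + s) / f a"
  using prod_shift[of f a s] assms by (simp add: nonzero_eq_divide_eq)

lemma prod_shift2_div:
  fixes f :: "nat \<Rightarrow> real"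
  assumes "f a \<noteq> 0" "f (Suc a) \<noteq> 0"
  shows "(\<Prod>j<s. f (Suc (Suc (a + j)))) = (\<Prod>j<s. f (a + j)) * (f (a + s) * f (Suc (a + s))) / (f a * f (Suc a))"
  using prod_shift_div[of "\<lambda>j. f (Suc j)" a s] prod_shift_div[of f a s] assms by simp

text \<open>In the recurrences, Gamma values at half-integers occur only through these quotients and the
  products of \<open>gam2_dup\<close>, so \<open>gam2 q 1\<close> cancels.\<close>

lemma gam2_quotient:
  assumes "0 < h" "h < 1" "q = h\<^sup>2"
  shows "gam2 q (2 * k + 3) / gam2 q (2 * k + 2) = gam2 q 1 * qpoch h (2 * k + 1) / ((1 - q) * qpoch q k ^ 2)"
proof -
  have q01: "0 < q" "q < 1" using assms by (auto simp: power_less_one_iff)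
  have nz: "qpoch q k \<noteq> 0" "1 - q \<noteq> 0" using qpoch_pos[OF q01, of k] q01 by simp_all
  let ?a = "gam2 q (2 * k + 2)" and ?b = "gam2 q (2 * k + 3)"
  have a: "?a = qpoch q k / (1 - q) ^ k" by (rule gam2_even[OF assms])
  have "2 * k + 1 + 1 = 2 * k + 2" "2 * k + 1 + 2 = 2 * k + 3" by simp_all
  then have ab: "?a * ?b = gam2 q 1 * qpoch h (2 * k + 1) / (1 - q) ^ (2 * k + 1)"
    using gam2_dup[OF assms, of "2 * k + 1"] by (simp only:)
  have "?a \<noteq> 0" using gam2_nonzero[OF q01] by simp
  then have "?b / ?a = ?a * ?b / ?a ^ 2" by (simp add: power2_eq_square)
  also have "\<dots> = gam2 q 1 * qpoch h (2 * k + 1) / (1 - q) ^ (2 * k + 1) * ((1 - q) ^ (2 * k) / qpoch q k ^ 2)"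
    unfolding ab unfolding a by (simp add: power_divide power_mult[symmetric] mult.commute)
  also have "\<dots> = gam2 q 1 * qpoch h (2 * k + 1) / ((1 - q) * qpoch q k ^ 2)"
    using nz by simp
  finally show ?thesis .
qed

section \<open>Equality of the two sides\<close>

text \<open>Every product runs over arguments in steps of one or two, so shifting it leaves only a few boundary
  terms; the Gamma values among them combine into the pairs of \<open>gam2_dup\<close> and \<open>gam2_quotient\<close>.\<close>

lemma gamma_side_Suc:
  fixes r m :: nat
  assumes h: "0 < h" "h < 1" and q: "q = h\<^sup>2"
  defines "n \<equiv> r + m"
  shows "gamma_side q h r (Suc m) = gamma_side q h r m
    * (((1 - q ^ (2 * n + 1)) * (1 - q ^ (2 * n + 2))) ^ r
       * (pochm h (2 * m + r + 1) * pochm h (2 * m + r + 3) / (pochm h (2 * m + 1) * pochm h (2 * n + 3)))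
       * (qpoch q m ^ 2 * qpoch h (2 * m + r + 1) ^ 2 / (qpoch q n ^ 2 * qpoch h (2 * m + 1) * qpoch h (2 * n + 1))))"
proof -
  have q01: "0 < q" "q < 1" using h by (auto simp: q power_less_one_iff)
  have nz: "qpoch q k \<noteq> 0" "qpoch h k \<noteq> 0" "pochm h k \<noteq> 0" for k
    using qpoch_pos[OF q01, of k] qpoch_pos[OF h, of k] pochm_pos[OF h(1), of k] by simp_all
  have Gz: "gam2 q k \<noteq> 0" if "k \<ge> 1" for k using gam2_nonzero[OF q01 that] .
  let ?c = "(1 - q ^ (2 * n + 1)) * (1 - q ^ (2 * n + 2))"
  define P where "P = 1 - q"
  have P: "P \<noteq> 0" using q01 by (simp add: P_def)
  have s1: "(\<Prod>j<r + 1. pochm h (2 * Suc m + j)) = (\<Prod>j<r + 1. pochm h (2 * m + j)) * (pochm h (2 * m + r + 1) * pochm h (2 * m + r + 2)) / (pochm h (2 * m) * pochm h (2 * m + 1))"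
  proof -
    have e: "2 * Suc m + j = Suc (Suc (2 * m + j))" "2 * m + r + 1 = 2 * m + (r + 1)" "2 * m + r + 2 = Suc (2 * m + (r + 1))"
      "2 * m + 1 = Suc (2 * m)" for j by simp_all
    show ?thesis unfolding e by (rule prod_shift2_div) (rule nz)+
  qed
  have s2: "(\<Prod>j<r + 1. pochm h (2 * (Suc m + j) + 1)) = (\<Prod>j<r + 1. pochm h (2 * (m + j) + 1)) * pochm h (2 * n + 3) / pochm h (2 * m + 1)"
  proof -
    have e: "Suc m + j = Suc (m + j)" "2 * n + 3 = 2 * (m + (r + 1)) + 1" for j by (simp_all add: n_def)
    show ?thesis unfolding e by (rule prod_shift_div[of "\<lambda>j. pochm h (2 * j + 1)"]) (rule nz)
  qed
  have s3: "(\<Prod>j<r. gam2 q (2 * (Suc m + j) + 3)) = (\<Prod>j<r. gam2 q (2 * (m + j) + 3)) * gam2 q (2 * n + 3) / gam2 q (2 * m + 3)"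
  proof -
    have e: "Suc m + j = Suc (m + j)" "n = m + r" for j by (simp_all add: n_def)
    show ?thesis unfolding e by (rule prod_shift_div[of "\<lambda>j. gam2 q (2 * j + 3)"]) (rule Gz, simp)
  qed
  have s4: "(\<Prod>j<r. gam2 q (2 * (Suc m + j) + 2)) = (\<Prod>j<r. gam2 q (2 * (m + j) + 2)) * gam2 q (2 * n + 2) / gam2 q (2 * m + 2)"
  proof -
    have e: "Suc m + j = Suc (m + j)" "n = m + r" for j by (simp_all add: n_def)
    show ?thesis unfolding e by (rule prod_shift_div[of "\<lambda>j. gam2 q (2 * j + 2)"]) (rule Gz, simp)
  qed
  define dn where "dn = gam2 q (2 * n + 2) * gam2 q (2 * n + 3)"
  define dr where "dr = gam2 q (2 * m + r + 2) * gam2 q (2 * m + r + 3)"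
  have s5: "(\<Prod>j<r. gam2 q (2 * Suc m + r + 2 + j)) = (\<Prod>j<r. gam2 q (2 * m + r + 2 + j)) * dn / dr"
  proof -
    have e: "2 * Suc m + r + 2 + j = Suc (Suc (2 * m + r + 2 + j))"
      "2 * n + 2 = 2 * m + r + 2 + r" "2 * n + 3 = Suc (2 * m + r + 2 + r)" "2 * m + r + 3 = Suc (2 * m + r + 2)" for j
      by (simp_all add: n_def)
    show ?thesis unfolding dn_def dr_def e by (rule prod_shift2_div) (rule Gz, simp)+
  qed
  have s6: "gam2 q (4 * (r + Suc m) + 2) = gam2 q (4 * (r + m) + 2) * (?c / P ^ 2)"
  proof -
    have e: "4 * (r + Suc m) + 2 = 2 * Suc (Suc (2 * n)) + 2" "4 * (r + m) + 2 = 2 * (2 * n) + 2"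
      "2 * n + 2 = Suc (Suc (2 * n))" "2 * n + 1 = Suc (2 * n)" by (simp_all add: n_def)
    show ?thesis unfolding e gam2_even[OF h q] P_def qpoch_Suc
      by (simp only: power_Suc power2_eq_square) (simp add: mult_ac)
  qed
  \<comment> \<open>the two factors adjoined are quotients of neighbouring values of \<open>pochm\<close>, which lets them cancel against
    the boundary terms above\<close>
  have e1: "(\<Prod>k<Suc m. 1 + h ^ (r + 2 + 2 * k)) / (\<Prod>k<Suc m. 1 + h ^ (2 * k))
     = ((\<Prod>k<m. 1 + h ^ (r + 2 + 2 * k)) / (\<Prod>k<m. 1 + h ^ (2 * k))) * (pochm h (2 * m + r + 3) / pochm h (2 * m + r + 2) * pochm h (2 * m) / pochm h (2 * m + 1))"
  proof -
    have e: "2 * m + r + 3 = Suc (2 * m + r + 2)" "2 * m + 1 = Suc (2 * m)" "r + 2 + 2 * m = 2 * m + r + 2" by simp_all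
    have "pochm h (2 * m + r + 3) / pochm h (2 * m + r + 2) * pochm h (2 * m) / pochm h (2 * m + 1) = (1 + h ^ (r + 2 + 2 * m)) / (1 + h ^ (2 * m))"
      unfolding e pochm_Suc using nz(3)[of "2 * m"] nz(3)[of "2 * m + r + 2"] by (simp del: power_Suc add_2_eq_Suc add_2_eq_Suc')
    then show ?thesis by (simp only: prod.lessThan_Suc times_divide_times_eq)
  qed
  define A1 A2 A3 A4 A5 A6 A7 B0 B1 B2 B3 where A_defs:
    "A1 = (\<Prod>k<m. 1 + h ^ (r + 2 + 2 * k)) / (\<Prod>k<m. 1 + h ^ (2 * k))"
    "A2 = (\<Prod>j<r + 1. pochm h (2 * m + j))"
    "A3 = (\<Prod>j<r + 1. pochm h (2 * (m + j) + 1))"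
    "A4 = (\<Prod>j<r. gam2 q (2 * (m + j) + 3))"
    "A5 = (\<Prod>j<r. gam2 q (2 * (m + j) + 2))"
    "A6 = (\<Prod>j<r. gam2 q (2 * m + r + 2 + j))"
    "A7 = gam2 q (4 * (r + m) + 2)"
    "B0 = 1 / q_fact q r * pochm h (r + 1)"
    "B1 = (\<Prod>j<r + 1. pochm h (j + 1) / 2)"
    "B2 = (\<Prod>j<r. gam2 q (j + 3))\<^sup>2"
    "B3 = gam2 q 1 ^ r"
  define cr where "cr = ?c ^ r"
  have cr: "(A7 * (?c / P ^ 2)) ^ r = A7 ^ r * (cr / (P ^ r) ^ 2)"
    by (simp only: cr_def power_mult_distrib power_divide power_mult[symmetric] mult.commute)
  define g3n g2n g3m g2m where g_defs: "g3n = gam2 q (2 * n + 3)" "g2n = gam2 q (2 * n + 2)" "g3m = gam2 q (2 * m + 3)" "g2m = gam2 q (2 * m + 2)"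
  have gz: "g3n \<noteq> 0" "g2n \<noteq> 0" "g3m \<noteq> 0" "g2m \<noteq> 0" "dn \<noteq> 0" "dr \<noteq> 0"
    unfolding g_defs dn_def dr_def using Gz by simp_all
  define e0 e1' e2 e3 f1 f3 where e_defs: "e0 = pochm h (2 * m)" "e1' = pochm h (2 * m + 1)" "e2 = pochm h (2 * m + r + 2)"
    "e3 = pochm h (2 * m + r + 3)" "f1 = pochm h (2 * m + r + 1)" "f3 = pochm h (2 * n + 3)"
  have ez: "e0 \<noteq> 0" "e1' \<noteq> 0" "e2 \<noteq> 0" "e3 \<noteq> 0" "f1 \<noteq> 0" "f3 \<noteq> 0" unfolding e_defs by (rule nz)+
  have R: "gamma_side q h r m = B0 * A1 * B1 * A2 / A3 * B2 / B3 * (A7 ^ r * A4 / (A5 * A6\<^sup>2))"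
    unfolding gamma_side_def A_defs ..
  have R': "gamma_side q h r (Suc m) = B0 * (A1 * (e3 / e2 * e0 / e1')) * B1 * (A2 * (f1 * e2) / (e0 * e1')) / (A3 * f3 / e1') * B2 / B3
      * (A7 ^ r * (cr / (P ^ r) ^ 2) * (A4 * g3n / g3m) / (A5 * g2n / g2m * (A6 * dn / dr)\<^sup>2))"
    unfolding gamma_side_def e1 s1 s2 s3 s4 s5 s6
    unfolding A_defs[symmetric] cr g_defs[symmetric] e_defs[symmetric] ..
  also have "\<dots> = gamma_side q h r m * (cr * (f1 * e3 / (e1' * f3)) * ((g3n / g2n) / (g3m / g2m) * (dr / dn / P ^ r) ^ 2))"
    unfolding R using ez gz P
    by (simp add: power_divide power_mult_distrib) (simp add: mult_ac)
  also have "(g3n / g2n) / (g3m / g2m) * (dr / dn / P ^ r) ^ 2 = qpoch q m ^ 2 * qpoch h (2 * m + r + 1) ^ 2 / (qpoch q n ^ 2 * qpoch h (2 * m + 1) * qpoch h (2 * n + 1))"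
  proof -
    have k: "g3n / g2n = gam2 q 1 * qpoch h (2 * n + 1) / (P * qpoch q n ^ 2)" "g3m / g2m = gam2 q 1 * qpoch h (2 * m + 1) / (P * qpoch q m ^ 2)"
      unfolding g_defs P_def by (rule gam2_quotient[OF h q])+
    have i: "2 * n + 2 = 2 * n + 1 + 1" "2 * n + 3 = 2 * n + 1 + 2" "2 * m + r + 2 = 2 * m + r + 1 + 1" "2 * m + r + 3 = 2 * m + r + 1 + 2"
      by simp_all
    have d: "dn = gam2 q 1 * qpoch h (2 * n + 1) / P ^ (2 * n + 1)" "dr = gam2 q 1 * qpoch h (2 * m + r + 1) / P ^ (2 * m + r + 1)"
      unfolding dn_def dr_def P_def i by (rule gam2_dup[OF h q])+
    have p: "P ^ (2 * n + 1) = P ^ r * P ^ (2 * m + r + 1)"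
      by (simp add: n_def power_add[symmetric] add_ac mult_2)
    have "dr / dn / P ^ r = qpoch h (2 * m + r + 1) / qpoch h (2 * n + 1)"
      unfolding d p using P Gz[of 1] nz by simp
    then show ?thesis unfolding k using P Gz[of 1] nz by (simp add: power2_eq_square)
  qed
  finally show ?thesis unfolding cr_def e_defs by (simp only: mult.assoc)
qed

text \<open>The two quotients agree once each \<open>(q; q)_k\<close> is split as \<open>(h; h)_k (- h; h)_k\<close>.\<close>

lemma gamma_side_eq_subset_side_Suc:
  assumes g: "0 < g" "g < 1" and h: "h = g\<^sup>2" and q: "q = h\<^sup>2"
    and eq: "gamma_side q h r m = subset_side q h g r m"
  shows "gamma_side q h r (Suc m) = subset_side q h g r (Suc m)"
proof -
  define n where "n = r + m"
  have h01: "0 < h" "h < 1" using g by (auto simp: h power_less_one_iff)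
  have q01: "0 < q" "q < 1" using h01 by (auto simp: q power_less_one_iff)
  have nz: "qpoch q k \<noteq> 0" "qpoch h k \<noteq> 0" "pochm h k \<noteq> 0" for k
    using qpoch_pos[OF q01, of k] qpoch_pos[OF h01, of k] pochm_pos[OF h01(1), of k] by simp_all
  have Q: "qpoch q k = qpoch h k * pochm h (Suc k) / 2" for k using qpoch_split[OF q, of k] by simp
  have pl: "1 + h ^ k \<noteq> 0" for k using zero_less_power[OF h01(1), of k] by linarith
  have mn: "1 - h ^ Suc k \<noteq> 0" for k using power_Suc_less_one[OF h01, of k] by linarith
  have E3: "pochm h (2 * m + r + 3) = pochm h (2 * m + r + 2) * (1 + h ^ (r + 2 + 2 * m))"
  proof -
    have "2 * m + r + 3 = Suc (2 * m + r + 2)" "r + 2 + 2 * m = 2 * m + r + 2" by simp_all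
    then show ?thesis by (simp only: pochm_Suc)
  qed
  have F3: "pochm h (2 * n + 3) = pochm h (2 * n + 2) * (1 + q ^ (n + 1))"
  proof -
    have "q ^ (n + 1) = h ^ (2 * n + 2)" unfolding q power_mult[symmetric] by simp
    moreover have "2 * n + 3 = Suc (2 * n + 2)" by simp
    ultimately show ?thesis by (simp only: pochm_Suc)
  qed
  have H1: "qpoch h (2 * m + r + 1) = qpoch h (2 * m + r) * (1 - h ^ (r + 1 + 2 * m))"
  proof -
    have "2 * m + r + 1 = Suc (2 * m + r)" "r + 1 + 2 * m = Suc (2 * m + r)" by simp_all
    then show ?thesis by (simp only: qpoch_Suc)
  qed
  have H2: "qpoch h (2 * m + 1) = qpoch h (2 * m) * (1 - h ^ (2 * m + 1))"
    using qpoch_Suc[of h "2 * m"] by simp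
  have a: "qpoch q (r + 2 * m) = qpoch h (2 * m + r) * pochm h (2 * m + r + 1) / 2"
    using Q[of "2 * m + r"] by (simp add: add.commute)
  have b: "qpoch q (r + 1 + 2 * m) = qpoch h (2 * m + r + 1) * pochm h (2 * m + r + 2) / 2"
  proof -
    have "r + 1 + 2 * m = 2 * m + r + 1" "Suc (2 * m + r + 1) = 2 * m + r + 2" by simp_all
    then show ?thesis using Q[of "2 * m + r + 1"] by (simp only:)
  qed
  have c: "qpoch q (2 * m) = qpoch h (2 * m) * pochm h (2 * m + 1) / 2" using Q[of "2 * m"] by simp
  have d: "qpoch q (2 * n + 1) = qpoch h (2 * n + 1) * pochm h (2 * n + 2) / 2"
  proof -
    have "Suc (2 * n + 1) = 2 * n + 2" by simp
    then show ?thesis using Q[of "2 * n + 1"] by (simp only:)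
  qed
  define u v x y where d4: "u = 1 - h ^ (r + 1 + 2 * m)" "v = 1 + h ^ (r + 2 + 2 * m)" "x = 1 - h ^ (2 * m + 1)" "y = 1 + q ^ (n + 1)"
  have xy: "x \<noteq> 0" "y \<noteq> 0"
  proof -
    show "x \<noteq> 0" using mn[of "2 * m"] by (simp add: d4)
    have "q ^ (n + 1) > 0" using q01 by simp
    then show "y \<noteq> 0" unfolding d4 by linarith
  qed
  show ?thesis
    unfolding gamma_side_Suc[OF h01 q, of r m] subset_side_Suc[OF g h q, of r m] eq
    unfolding n_def[symmetric] E3 F3 a b c d H2 unfolding H1
    unfolding d4[symmetric]
    by (simp add: power2_eq_square mult_ac)
qed

lemma q_fact_Suc:
  assumes "0 < q" "q < 1"
  shows "q_fact q (Suc r) = q_fact q r * ((1 - q ^ (r + 1)) / (1 - q))"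
proof -
  have "q powr real (Suc r) = q ^ Suc r" using assms by (intro powr_realpow)
  then have "q_number q (real (Suc r)) = (1 - q ^ (r + 1)) / (1 - q)"
    unfolding q_number_def by (simp only: Suc_eq_plus1)
  moreover have "q_fact q (Suc r) = q_fact q r * q_number q (real (Suc r))"
    by (simp add: q_fact_def)
  ultimately show ?thesis by (simp only:)
qed

text \<open>For \<open>m = 0\<close> the recurrence runs over \<open>r\<close>. The run of Gamma values starting at \<open>r + 2\<close> is both shifted
  and lengthened.\<close>

lemma gamma_side_base_Suc:
  assumes h: "0 < h" "h < 1" and q: "q = h\<^sup>2"
  shows "gamma_side q h (Suc r) 0 = gamma_side q h r 0
    * (2 * qpoch q (2 * r) * ((1 - q ^ (2 * r + 1)) * (1 - q ^ (2 * r + 2))) ^ (r + 1) * (1 - q ^ (r + 1))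
       / ((1 - q) ^ (2 * (r + 1)) * qpoch h (2 * r + 1) * pochm h (2 * r + 3)))"
proof -
  have q01: "0 < q" "q < 1" using h by (auto simp: q power_less_one_iff)
  have nz: "qpoch q k \<noteq> 0" "qpoch h k \<noteq> 0" "pochm h k \<noteq> 0" for k
    using qpoch_pos[OF q01, of k] qpoch_pos[OF h, of k] pochm_pos[OF h(1), of k] by simp_all
  have Gz: "gam2 q k \<noteq> 0" if "k \<ge> 1" for k using gam2_nonzero[OF q01 that] .
  let ?c = "(1 - q ^ (2 * r + 1)) * (1 - q ^ (2 * r + 2))"
  define P where "P = 1 - q"
  have P: "P \<noteq> 0" using q01 by (simp add: P_def)
  define w where "w = 1 - q ^ (r + 1)"
  have w: "w \<noteq> 0" using power_Suc_less_one[OF q01, of r] by (simp add: w_def)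
  define g3 where "g3 = gam2 q (2 * r + 3)"
  define g2 where "g2 = gam2 q (2 * r + 2)"
  define b2 where "b2 = gam2 q (r + 2)"
  define b3 where "b3 = gam2 q (r + 3)"
  have gz: "g3 \<noteq> 0" "g2 \<noteq> 0" "b2 \<noteq> 0" "b3 \<noteq> 0" unfolding g3_def g2_def b2_def b3_def using Gz by simp_all
  have s5: "(\<Prod>j<Suc r. gam2 q (2 * 0 + Suc r + 2 + j)) = (\<Prod>j<r. gam2 q (2 * 0 + r + 2 + j)) * g2 * g3 / b2"
  proof -
    have e: "2 * 0 + Suc r + 2 + j = Suc (r + 2 + j)" "2 * 0 + r + 2 + j = r + 2 + j" "2 * r + 2 = r + 2 + r" "2 * r + 3 = r + 2 + Suc r" for j
      by simp_all
    have b2z: "gam2 q (r + 2) \<noteq> 0" by (rule Gz) simp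
    show ?thesis unfolding g2_def g3_def b2_def e prod_shift_div[of "gam2 q" "r + 2" "Suc r", OF b2z]
      by (simp only: prod.lessThan_Suc)
  qed
  define A7 where "A7 = gam2 q (4 * (r + 0) + 2)"
  have s6: "gam2 q (4 * (Suc r + 0) + 2) = A7 * (?c / P ^ 2)"
  proof -
    have e: "4 * (Suc r + 0) + 2 = 2 * Suc (Suc (2 * r)) + 2" "4 * (r + 0) + 2 = 2 * (2 * r) + 2"
      "2 * r + 2 = Suc (Suc (2 * r))" "2 * r + 1 = Suc (2 * r)" by simp_all
    show ?thesis unfolding A7_def e gam2_even[OF h q] P_def qpoch_Suc
      by (simp only: power_Suc power2_eq_square) (simp add: mult_ac)
  qed
  define cr where "cr = ?c ^ (r + 1)"
  have cr: "(A7 * (?c / P ^ 2)) ^ Suc r = A7 ^ r * A7 * (cr / (P ^ (r + 1)) ^ 2)"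
    by (simp add: cr_def power_mult_distrib power_divide power_mult[symmetric] mult_ac flip: power_Suc)
  define e1 where "e1 = pochm h (r + 1)"
  define f where "f = 1 + h ^ (r + 1)"
  define F where "F = pochm h (2 * r + 3)"
  have ez: "e1 \<noteq> 0" "F \<noteq> 0" unfolding e1_def F_def by (rule nz)+
  have e2: "pochm h (r + 2) = e1 * f" using pochm_Suc[of h "r + 1"] by (simp add: e1_def f_def)
  define a1 a2 a3 a4 a5 a6 a8 where a_defs:
    "a1 = (\<Prod>j<r + 1. pochm h (j + 1) / 2)"
    "a2 = (\<Prod>j<r + 1. pochm h (2 * 0 + j))"
    "a3 = (\<Prod>j<r + 1. pochm h (2 * (0 + j) + 1))"
    "a4 = (\<Prod>j<r. gam2 q (j + 3))"
    "a5 = (\<Prod>j<r. gam2 q (2 * (0 + j) + 3))"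
    "a6 = (\<Prod>j<r. gam2 q (2 * (0 + j) + 2))"
    "a8 = (\<Prod>j<r. gam2 q (2 * 0 + r + 2 + j))"
  define g1 where "g1 = gam2 q 1"
  have g1: "g1 \<noteq> 0" unfolding g1_def using Gz by simp
  have R: "gamma_side q h r 0 = 1 / q_fact q r * e1 * a1 * a2 / a3 * a4\<^sup>2 / g1 ^ r * (A7 ^ r * a5 / (a6 * a8\<^sup>2))"
    unfolding gamma_side_def a_defs A7_def e1_def g1_def by simp
  have p1: "(\<Prod>j<Suc r + 1. pochm h (j + 1) / 2) = a1 * (e1 * f / 2)"
    unfolding a_defs e2[symmetric] by (simp add: numeral_2_eq_2)
  have p2: "(\<Prod>j<Suc r + 1. pochm h (2 * 0 + j)) = a2 * e1"
    unfolding a_defs e1_def by simp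
  have p3: "(\<Prod>j<Suc r + 1. pochm h (2 * (0 + j) + 1)) = a3 * F"
    unfolding a_defs F_def by (simp add: numeral_3_eq_3)
  have p4: "(\<Prod>j<Suc r. gam2 q (j + 3)) = a4 * b3" unfolding a_defs b3_def by simp
  have p5: "(\<Prod>j<Suc r. gam2 q (2 * (0 + j) + 3)) = a5 * g3" unfolding a_defs g3_def by simp
  have p6: "(\<Prod>j<Suc r. gam2 q (2 * (0 + j) + 2)) = a6 * g2" unfolding a_defs g2_def by simp
  have p0: "pochm h (Suc r + 1) = e1 * f" using e2 by (simp add: numeral_2_eq_2)
  have R': "gamma_side q h (Suc r) 0 = 1 / (q_fact q r * (w / P)) * (e1 * f) * (a1 * (e1 * f / 2)) * (a2 * e1) / (a3 * F) * (a4 * b3)\<^sup>2 / g1 ^ Suc r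
     * (A7 ^ r * A7 * (cr / (P ^ (r + 1)) ^ 2) * (a5 * g3) / (a6 * g2 * (a8 * g2 * g3 / b2)\<^sup>2))"
    unfolding gamma_side_def p0 p1 p2 p3 p4 p5 p6 s5 s6 q_fact_Suc[OF q01] cr
    unfolding a_defs(7)[symmetric] w_def P_def g1_def by simp
  have "gamma_side q h (Suc r) 0 = gamma_side q h r 0 * ((P / w) * (e1 * f) ^ 2 / (2 * F) * (A7 * cr / (P ^ (r + 1)) ^ 2) * ((g3 / g2) * (b2 * b3) ^ 2 / (g1 * (g2 * g3) ^ 2)))"
    unfolding R R' using gz ez g1
    by (simp add: power_divide power_mult_distrib) (simp add: power2_eq_square mult_ac)
  also have "(P / w) * (e1 * f) ^ 2 / (2 * F) * (A7 * cr / (P ^ (r + 1)) ^ 2) * ((g3 / g2) * (b2 * b3) ^ 2 / (g1 * (g2 * g3) ^ 2))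
     = 2 * qpoch q (2 * r) * cr * w / (P ^ (2 * (r + 1)) * qpoch h (2 * r + 1) * F)"
  proof -
    have k: "g3 / g2 = g1 * qpoch h (2 * r + 1) / (P * qpoch q r ^ 2)"
      unfolding g3_def g2_def g1_def P_def by (rule gam2_quotient[OF h q])
    have "2 * r + 2 = 2 * r + 1 + 1" "2 * r + 3 = 2 * r + 1 + 2" by simp_all
    then have d: "g2 * g3 = g1 * qpoch h (2 * r + 1) / P ^ (2 * r + 1)"
      unfolding g3_def g2_def g1_def P_def using gam2_dup[OF h q, of "2 * r + 1"] by (simp only:)
    have "r + 2 = r + 1 + 1" "r + 3 = r + 1 + 2" by simp_all
    then have b: "b2 * b3 = g1 * qpoch h (r + 1) / P ^ (r + 1)"
      unfolding b2_def b3_def g1_def P_def using gam2_dup[OF h q, of "r + 1"] by (simp only:)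
    have A: "A7 = qpoch q (2 * r) / P ^ (2 * r)"
    proof -
      have "4 * (r + 0) + 2 = 2 * (2 * r) + 2" by simp
      then show ?thesis unfolding A7_def P_def by (simp only: gam2_even[OF h q])
    qed
    \<comment> \<open>the split \<open>2 (q; q)_(r + 1) = (h; h)_(r + 1) (-1; h)_(r + 2)\<close>\<close>
    have qq: "2 * (qpoch q r * w) = qpoch h (r + 1) * (e1 * f)"
      using qpoch_split[OF q, of "r + 1"] e2 by (simp add: qpoch_Suc w_def numeral_2_eq_2)
    have sq: "(e1 * f) ^ 2 * qpoch h (r + 1) ^ 2 = 4 * (qpoch q r ^ 2 * w ^ 2)"
    proof -
      have "(e1 * f) ^ 2 * qpoch h (r + 1) ^ 2 = (qpoch h (r + 1) * (e1 * f)) ^ 2" by (simp add: power_mult_distrib mult.commute)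
      then show ?thesis unfolding qq[symmetric] by (simp add: power_mult_distrib)
    qed
    define X where "X = P ^ r"
    have X: "X \<noteq> 0" "P ^ (2 * r + 1) = X * X * P" "P ^ (r + 1) = X * P" "P ^ (2 * r) = X * X" "P ^ (2 * (r + 1)) = X * X * P * P"
    proof -
      show "X \<noteq> 0" using P by (simp add: X_def)
      have e: "2 * r + 1 = r + r + 1" "2 * r = r + r" "2 * (r + 1) = r + r + 1 + 1" by simp_all
      show "P ^ (2 * r + 1) = X * X * P" "P ^ (r + 1) = X * P" "P ^ (2 * r) = X * X" "P ^ (2 * (r + 1)) = X * X * P * P"
        unfolding e X_def by (simp_all only: power_add power_one_right)
    qed
    have "(P / w) * E / (2 * F) * (Q / (X * X) * cr / (X * P) ^ 2) * ((g1 * H / (P * K)) * (g1 * T / (X * P)) ^ 2 / (g1 * (g1 * H / (X * X * P)) ^ 2))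
      = (E * T ^ 2) * Q * cr / (w * 2 * F * K * H * (X * X * P * P))"
      if "H \<noteq> 0" "K \<noteq> 0" for E Q H K T :: real
      using that P X(1) g1 ez w by (simp add: power2_eq_square) (simp add: mult_ac)
    from this[where H = "qpoch h (2 * r + 1)" and K = "qpoch q r ^ 2" and E = "(e1 * f) ^ 2" and Q = "qpoch q (2 * r)"
        and T = "qpoch h (r + 1)"] nz
    show ?thesis
      unfolding k d b A X(2-5) sq using w by (simp add: power2_eq_square mult_ac)
  qed
  finally show ?thesis unfolding cr_def w_def F_def P_def .
qed

lemma subset_side_base_Suc:
  assumes g: "0 < g" "g < 1" and h: "h = g\<^sup>2" and q: "q = h\<^sup>2"
  shows "subset_side q h g (Suc r) 0 = subset_side q h g r 0
    * (qpoch q (2 * r) * ((1 - q ^ (2 * r + 1)) * (1 - q ^ (2 * r + 2))) ^ (r + 1) * (1 - q ^ (r + 1))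
       / ((1 - q) ^ (2 * (r + 1)) * qpoch q (2 * r + 1) * (1 + q ^ (r + 1))))"
proof -
  have h01: "0 < h" "h < 1" using g by (auto simp: h power_less_one_iff)
  have q01: "0 < q" "q < 1" using h01 by (auto simp: q power_less_one_iff)
  have pos: "qpoch q k \<noteq> 0" for k using qpoch_pos[OF q01, of k] by simp
  let ?c = "(1 - q ^ (2 * r + 1)) * (1 - q ^ (2 * r + 2))"
  have "2 * Suc r = Suc (Suc (2 * r))" by simp
  then have f: "qpoch q (2 * Suc r) = qpoch q (2 * r) * ?c" by (simp add: qpoch_Suc)
  have Y: "(\<Prod>l=1..Suc r. qY h l) = (\<Prod>l=1..r. qY h l) * ((1 + q ^ (r + 1)) / h ^ (r + 1))"
  proof -
    have "q ^ (r + 1) = h ^ (r + 1) * h ^ (r + 1)"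
      unfolding q by (simp only: power_mult[symmetric] power_add[symmetric] mult_2)
    then have "qY h (Suc r) = (1 + q ^ (r + 1)) / h ^ (r + 1)" using h01 by (simp add: qY_def field_simps)
    then show ?thesis by simp
  qed
  have V: "vander_set (qX q) {1..Suc r} = vander_set (qX q) {1..r} * (qpoch q r * qpoch q (2 * r + 1) / (h ^ (2 * (r * (r + 1))) * qpoch q (r + 1)))"
    using vander_set_Suc[OF q01, of r] unfolding q by (simp only: power_mult)
  define H0 where "H0 = h ^ (r * (r + 1))"
  define H1 where "H1 = h ^ ((r + 1) * (r + 2))"
  have C: "(qpoch q (2 * Suc r) / h ^ (Suc r * (Suc r + 1))) ^ Suc r
     = (qpoch q (2 * r) / H0) ^ r * (qpoch q (2 * r) * ?c ^ (r + 1) * H0 ^ r / H1 ^ (r + 1))"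
  proof -
    have e: "Suc r * (Suc r + 1) = (r + 1) * (r + 2)" by simp
    have "H0 \<noteq> 0" using h01 by (simp add: H0_def)
    then show ?thesis unfolding e f H1_def[symmetric]
      by (simp add: power_divide power_mult_distrib mult_ac)
  qed
  have hh: "h ^ (Suc r * Suc r) * H0 ^ r * h ^ (2 * (r * (r + 1))) * h ^ (r + 1) = H1 ^ (r + 1)"
    unfolding H0_def H1_def power_mult[symmetric] power_add[symmetric]
    by (rule arg_cong[where f = "power h"]) (simp add: algebra_simps)
  have S: "(\<Prod>s=1..Suc r. h ^ (s * s) / (1 - q) ^ (2 * s)) = (\<Prod>s=1..r. h ^ (s * s) / (1 - q) ^ (2 * s)) * (h ^ (Suc r * Suc r) / (1 - q) ^ (2 * (r + 1)))"
    by simp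
  have t: "odd_sum_value g r 0 = 1" "odd_sum_value g (Suc r) 0 = 1" by (simp_all add: odd_sum_value_def)
  have F: "qpoch q (r + 1) = qpoch q r * (1 - q ^ (r + 1))" by (simp add: qpoch_Suc)
  have alg: "S * (a / p) * (C * (Q * cc * H / HH) / (V * (x * y / (b * (x * w))) * (Y * (z / d))) * 1)
     = S * (C / (V * Y) * 1) * (Q * cc * w / (p * y * z))"
    if "a * H * b * d = HH" "a \<noteq> 0" "H \<noteq> 0" "b \<noteq> 0" "d \<noteq> 0" "x \<noteq> 0"
    for S a p C Q cc H HH V x y b w Y z d :: real
    unfolding that(1)[symmetric] using that(2-) by (simp add: mult_ac)
  have z0: "r + 0 = r" "Suc r + 0 = Suc r" by simp_all
  show ?thesis
    unfolding subset_side_def z0 C S V Y F t H0_def[symmetric]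
    by (rule alg[OF hh]) (use h01 pos in \<open>simp_all add: H0_def\<close>)
qed

lemma gamma_side_eq_subset_side_0:
  assumes g: "0 < g" "g < 1" and h: "h = g\<^sup>2" and q: "q = h\<^sup>2"
  shows "gamma_side q h r 0 = subset_side q h g r 0"
proof (induction r)
  case 0
  then show ?case by (simp only: gamma_side_0 subset_side_0)
next
  case (Suc r)
  have h01: "0 < h" "h < 1" using g by (auto simp: h power_less_one_iff)
  have F3: "pochm h (2 * r + 3) = pochm h (2 * r + 2) * (1 + q ^ (r + 1))"
  proof -
    have "q ^ (r + 1) = h ^ (2 * r + 2)" unfolding q power_mult[symmetric] by simp
    moreover have "2 * r + 3 = Suc (2 * r + 2)" by simp
    ultimately show ?thesis by (simp only: pochm_Suc)
  qed
  have "Suc (2 * r + 1) = 2 * r + 2" by simp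
  then have d: "qpoch q (2 * r + 1) = qpoch h (2 * r + 1) * pochm h (2 * r + 2) / 2"
    using qpoch_split[OF q, of "2 * r + 1"] by (simp only:)
  show ?case
    unfolding gamma_side_base_Suc[OF h01 q] subset_side_base_Suc[OF g h q] Suc F3 d by (simp add: mult_ac)
qed

lemma gamma_side_eq_subset_side:
  assumes "0 < g" "g < 1" "h = g\<^sup>2" "q = h\<^sup>2"
  shows "gamma_side q h r m = subset_side q h g r m"
  by (induction m) (simp_all add: gamma_side_eq_subset_side_0[OF assms] gamma_side_eq_subset_side_Suc[OF assms])

section \<open>The theorem\<close>

lemma powr_quarter_powers:
  fixes q :: real
  assumes "0 < q" "q < 1"
  shows "0 < q powr (1/4)" "q powr (1/4) < 1" "q powr (1/2) = (q powr (1/4))\<^sup>2" "q = (q powr (1/2))\<^sup>2"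
proof -
  show "0 < q powr (1/4)" using assms by simp
  show "q powr (1/4) < 1" using assms by (simp add: powr01_less_one)
  show "q powr (1/2) = (q powr (1/4))\<^sup>2" using assms by (simp add: powr_powr flip: powr_numeral)
  show "q = (q powr (1/2))\<^sup>2" using assms by (simp add: powr_powr flip: powr_numeral)
qed

lemma powr_half_multiple:
  assumes "0 < q"
  shows "q powr (real k / 2) = (q powr (1/2)) ^ k"
proof -
  have "(q powr (1/2)) ^ k = (q powr (1/2)) powr real k" using assms by (simp add: powr_realpow)
  then show ?thesis by (simp add: powr_powr)
qed

lemma prod_up:
  fixes s :: nat
  shows "(\<Prod>i=1..s. f i) = (\<Prod>j<s. f (j + 1))"
  by (rule prod.reindex_bij_witness[where i = "\<lambda>j. j + 1" and j = "\<lambda>i. i - 1"]) auto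

lemma prod_down:
  fixes s :: nat
  shows "(\<Prod>i=1..s. f i) = (\<Prod>j<s. f (s - j))"
  by (rule prod.reindex_bij_witness[where i = "\<lambda>j. s - j" and j = "\<lambda>i. s - i"]) auto

text \<open>The index \<open>- 1\<close> occurs here for \<open>m = 0\<close> and \<open>i = r + 1\<close>, and is covered by \<open>q_poch_half\<close> with
  \<open>k = 0\<close>.\<close>

lemma rhs_eq_gamma_side:
  fixes q :: real and r m :: nat
  assumes q: "0 < q" "q < 1"
  defines "h \<equiv> q powr (1/2)" and "n \<equiv> int (r + m)"
  shows "2 ^ r * (fact r / q_fact q r)
       * (q_poch (- 1) h (int r + 1)
          * q_poch (- (q powr (real r / 2 + 1))) q (n - int r)
          / q_poch (- 1) q (n - int r))
       * (\<Prod>i=1..r+1.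
            q_poch (- h) h (int i - 1)
            * q_poch (- h) h (2 * n - int i - int r)
            / q_poch (- h) h (2 * n - 2 * int i + 2))
       * (\<Prod>i=1..r.
            (q_Gamma q (1 + real i / 2))\<^sup>2 / q_Gamma q (1/2)
            * (q_Gamma q (2 * of_int n + 1) * q_Gamma q (of_int n - real i + 3/2)
               / (q_Gamma q (of_int n - real i + 1)
                  * (q_Gamma q (of_int n - real i / 2 + 1))\<^sup>2)))
     = 2 ^ r * fact r * gamma_side q h r m"
proof -
  have hq: "0 < h" "h < 1" "q = h\<^sup>2"
    using q powr_quarter_powers(4)[OF q] by (auto simp: h_def powr01_less_one)
  have p1: "q_poch (- 1) h (int r + 1) = pochm h (r + 1)"
    using q_poch_pochm[OF hq(1,2), of "r + 1"] by (simp add: add.commute)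
  have nr: "n - int r = int m" by (simp add: n_def)
  have hpow: "q powr (real r / 2 + 1) = h ^ (r + 2)"
  proof -
    have "real r / 2 + 1 = real (r + 2) / 2" by simp
    then show ?thesis unfolding h_def by (simp only: powr_half_multiple[OF q(1)])
  qed
  have p2: "q_poch (- (q powr (real r / 2 + 1))) q (n - int r) = (\<Prod>k<m. 1 + h ^ (r + 2 + 2 * k))"
  proof -
    have "- (h ^ (r + 2)) < 1" using zero_less_power[OF hq(1), of "r + 2"] by linarith
    then have "q_poch (- (h ^ (r + 2))) q (int m) = (\<Prod>k<m. 1 - (- (h ^ (r + 2))) * q ^ k)"
      by (rule q_poch_nat[OF q])
    also have "\<dots> = (\<Prod>k<m. 1 + h ^ (r + 2 + 2 * k))"
      by (simp only: hq(3) power_mult[symmetric] power_add mult_minus_left diff_minus_eq_add)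
    finally show ?thesis unfolding hpow nr .
  qed
  have p3: "q_poch (- 1) q (n - int r) = (\<Prod>k<m. 1 + h ^ (2 * k))"
  proof -
    have "q_poch (- 1) q (int m) = (\<Prod>k<m. 1 - (- 1) * q ^ k)" by (rule q_poch_nat[OF q]) simp
    also have "\<dots> = (\<Prod>k<m. 1 + h ^ (2 * k))" by (simp add: hq(3) power_mult)
    finally show ?thesis unfolding nr .
  qed
  have half: "q_poch (- h) h (int k - 1) = pochm h k / 2" for k
    by (rule q_poch_half[OF hq(1,2)])
  have p4: "(\<Prod>i=1..r+1. q_poch (- h) h (int i - 1)
            * q_poch (- h) h (2 * n - int i - int r)
            / q_poch (- h) h (2 * n - 2 * int i + 2))
     = (\<Prod>j<r + 1. pochm h (j + 1) / 2) * (\<Prod>j<r + 1. pochm h (2 * m + j)) / (\<Prod>j<r + 1. pochm h (2 * (m + j) + 1))"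
  proof -
    have a: "(\<Prod>i=1..r+1. q_poch (- h) h (int i - 1)) = (\<Prod>j<r + 1. pochm h (j + 1) / 2)"
      unfolding prod_up half[symmetric] by simp
    have "(\<Prod>i=1..r+1. q_poch (- h) h (2 * n - int i - int r)) = (\<Prod>j<r + 1. q_poch (- h) h (2 * n - int (r + 1 - j) - int r))"
      by (rule prod_down)
    also have "\<dots> = (\<Prod>j<r + 1. pochm h (2 * m + j) / 2)"
    proof (rule prod.cong)
      fix j assume "j \<in> {..<r + 1}"
      then have e: "2 * n - int (r + 1 - j) - int r = int (2 * m + j) - 1" by (simp add: n_def of_nat_diff)
      show "q_poch (- h) h (2 * n - int (r + 1 - j) - int r) = pochm h (2 * m + j) / 2"
        unfolding e by (rule half)
    qed simp
    finally have b: "(\<Prod>i=1..r+1. q_poch (- h) h (2 * n - int i - int r)) = (\<Prod>j<r + 1. pochm h (2 * m + j) / 2)" .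
    have "(\<Prod>i=1..r+1. q_poch (- h) h (2 * n - 2 * int i + 2)) = (\<Prod>j<r + 1. q_poch (- h) h (2 * n - 2 * int (r + 1 - j) + 2))"
      by (rule prod_down)
    also have "\<dots> = (\<Prod>j<r + 1. pochm h (2 * (m + j) + 1) / 2)"
    proof (rule prod.cong)
      fix j assume "j \<in> {..<r + 1}"
      then have e: "2 * n - 2 * int (r + 1 - j) + 2 = int (2 * (m + j) + 1) - 1" by (simp add: n_def of_nat_diff)
      show "q_poch (- h) h (2 * n - 2 * int (r + 1 - j) + 2) = pochm h (2 * (m + j) + 1) / 2"
        unfolding e by (rule half)
    qed simp
    finally have c: "(\<Prod>i=1..r+1. q_poch (- h) h (2 * n - 2 * int i + 2)) = (\<Prod>j<r + 1. pochm h (2 * (m + j) + 1) / 2)" .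
    show ?thesis
      unfolding prod.distrib prod_dividef a b c by simp
  qed
  define t where "t = r + m"
  have nt: "of_int n = real t" by (simp add: n_def t_def)
  have p5: "(\<Prod>i=1..r. q_Gamma q (1 + real i / 2)) = (\<Prod>j<r. gam2 q (j + 3))"
    unfolding prod_up gam2_def by (simp add: add_divide_distrib add_ac)
  have p6: "(\<Prod>i=1..r. q_Gamma q (real t - real i + 3/2)) = (\<Prod>j<r. gam2 q (2 * (m + j) + 3))"
    unfolding prod_down
  proof (rule prod.cong)
    fix j assume "j \<in> {..<r}"
    then have "real t - real (r - j) + 3/2 = real (2 * (m + j) + 3) / 2" by (simp add: t_def of_nat_diff field_simps)
    then show "q_Gamma q (real t - real (r - j) + 3/2) = gam2 q (2 * (m + j) + 3)" by (simp only: gam2_def)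
  qed simp
  have p7: "(\<Prod>i=1..r. q_Gamma q (real t - real i + 1)) = (\<Prod>j<r. gam2 q (2 * (m + j) + 2))"
    unfolding prod_down
  proof (rule prod.cong)
    fix j assume "j \<in> {..<r}"
    then have "real t - real (r - j) + 1 = real (2 * (m + j) + 2) / 2" by (simp add: t_def of_nat_diff field_simps)
    then show "q_Gamma q (real t - real (r - j) + 1) = gam2 q (2 * (m + j) + 2)" by (simp only: gam2_def)
  qed simp
  have p8: "(\<Prod>i=1..r. q_Gamma q (real t - real i / 2 + 1)) = (\<Prod>j<r. gam2 q (2 * m + r + 2 + j))"
    unfolding prod_down
  proof (rule prod.cong)
    fix j assume "j \<in> {..<r}"
    then have "real t - real (r - j) / 2 + 1 = real (2 * m + r + 2 + j) / 2" by (simp add: t_def of_nat_diff field_simps)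
    then show "q_Gamma q (real t - real (r - j) / 2 + 1) = gam2 q (2 * m + r + 2 + j)" by (simp only: gam2_def)
  qed simp
  have p9: "q_Gamma q (2 * real t + 1) = gam2 q (4 * (r + m) + 2)"
  proof -
    have "2 * real t + 1 = real (4 * (r + m) + 2) / 2" by (simp add: t_def field_simps)
    then show ?thesis by (simp only: gam2_def)
  qed
  have p10: "q_Gamma q (1/2) = gam2 q 1" by (simp add: gam2_def)
  have "(\<Prod>i=1..r. (q_Gamma q (1 + real i / 2))\<^sup>2 / q_Gamma q (1/2)
            * (q_Gamma q (2 * of_int n + 1) * q_Gamma q (of_int n - real i + 3/2)
               / (q_Gamma q (of_int n - real i + 1) * (q_Gamma q (of_int n - real i / 2 + 1))\<^sup>2)))
     = (\<Prod>j<r. gam2 q (j + 3))\<^sup>2 / gam2 q 1 ^ r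
     * (gam2 q (4 * (r + m) + 2) ^ r * (\<Prod>j<r. gam2 q (2 * (m + j) + 3))
        / ((\<Prod>j<r. gam2 q (2 * (m + j) + 2)) * (\<Prod>j<r. gam2 q (2 * m + r + 2 + j))\<^sup>2))"
    unfolding nt prod.distrib prod_dividef prod_power_distrib[symmetric] p5 p6 p7 p8 p9 p10 prod_constant by simp
  then show ?thesis
    unfolding p1 p2 p3 p4 gamma_side_def by (simp only:) simp
qed

theorem proposition5p4:
  fixes q :: real and r :: nat and n :: int
  assumes "0 < q" and "q < 1" and "r \<ge> 1" and "n \<ge> int r"
  shows
    "(\<Sum>k \<in> {1..r} \<rightarrow>\<^sub>E {-n..n}.
        (\<Prod>i=1..r. \<Prod>j\<in>{i<..r}.
           \<bar>q_number q (of_int (k i - k j)) * q_number q (of_int (k i + k j))\<bar>) *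
        (\<Prod>i=1..r.
           (q_number q (of_int (k i)))\<^sup>2
           * q powr ((of_int (k i) - real r + real i - 1)\<^sup>2 / 2)
           * q_binomial q (2 * n) (n + k i)))
     = 2 ^ r * (fact r / q_fact q r)
       * (q_poch (- 1) (q powr (1/2)) (int r + 1)
          * q_poch (- (q powr (real r / 2 + 1))) q (n - int r)
          / q_poch (- 1) q (n - int r))
       * (\<Prod>i=1..r+1.
            q_poch (- (q powr (1/2))) (q powr (1/2)) (int i - 1)
            * q_poch (- (q powr (1/2))) (q powr (1/2)) (2 * n - int i - int r)
            / q_poch (- (q powr (1/2))) (q powr (1/2)) (2 * n - 2 * int i + 2))
       * (\<Prod>i=1..r.
            (q_Gamma q (1 + real i / 2))\<^sup>2 / q_Gamma q (1/2)
            * (q_Gamma q (2 * of_int n + 1) * q_Gamma q (of_int n - real i + 3/2)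
               / (q_Gamma q (of_int n - real i + 1)
                  * (q_Gamma q (of_int n - real i / 2 + 1))\<^sup>2)))"
proof -
  define m where "m = nat n - r"
  have n: "n = int (r + m)" using assms(4) by (simp add: m_def)
  let ?h = "q powr (1/2)" and ?g = "q powr (1/4)"
  note gh = powr_quarter_powers[OF assms(1,2)]
  have pw: "q powr (real s ^ 2 / 2) = ?h ^ (s * s)" for s :: nat
    using powr_half_multiple[OF assms(1), of "s * s"] by (simp add: power2_eq_square)
  have "gamma_side q ?h r m = subset_side q ?h ?g r m"
    by (rule gamma_side_eq_subset_side[OF gh])
  also have "subset_side q ?h ?g r m = (\<Prod>s=1..r. q powr (real s ^ 2 / 2) / (1 - q) ^ (2 * s))
      * (\<Sum>A | A \<subseteq> {1..r + m} \<and> card A = r. vander_set (qX q) A * (\<Prod>a\<in>A. point_weight q (r + m) a))"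
    unfolding subset_side_def pw using assms(3) by (subst subset_sum_evaluation[OF gh]) simp_all
  finally have W: "gamma_side q ?h r m = (\<Prod>s=1..r. q powr (real s ^ 2 / 2) / (1 - q) ^ (2 * s))
      * (\<Sum>A | A \<subseteq> {1..r + m} \<and> card A = r. vander_set (qX q) A * (\<Prod>a\<in>A. point_weight q (r + m) a))" .
  show ?thesis
    unfolding n lhs_eq_subset_sum[OF assms(1,2)] rhs_eq_gamma_side[OF assms(1,2)] W
    by (simp only: mult.assoc)
qed

end
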